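(* Assume $s<d$; $A$ is symmetric, continuous on $\overline{(\Omega\cup\Omega_\delta)^2}$, satisfies $0<r\le A\le R<\infty$, and $A(\mathbf y,\mathbf x)$ is $C^1$ with respect to $\mathbf x$; $a(\mathbf x):=A(\mathbf x,\mathbf x)$ satisfies $a\in C^\infty(\Omega)$; $\Omega$ is bounded and $\Omega\cup\Omega_\delta$ is a $C^1$ domain; and the solution $u^\delta$ of the nonlocal problem $$-\mathcal L^\delta[u^\delta]=f\ \text{ in }\Omega,\qquad u^\delta=u^D\ \text{ on }\Omega_\delta,$$ satisfies $u^\delta\in C^1(\Omega)$ (and is $C^1$ as a function on $\Omega\cup\Omega_\delta$). Then there exists $\delta_0>0$ such that for a fixed $\delta$ with $0<\delta<\delta_0$ and $h<C_{pos}\delta$, the numerical solution $u_h^\delta$ of the discretized nonlocal problem satisfies $$\|u_h^\delta-u^\delta\|_{L^\infty(\chi_h)}\le C\,h^{\min(1,d-s)},$$ where $C$ is a constant independent of $h$.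
   Context: $\Omega\subset\mathbb R^d$ ($d\ge1$) is a bounded Lipschitz domain; $\Omega_\delta=\{\mathbf x\in\mathbb R^d\setminus\Omega:\mathrm{dist}(\mathbf x,\partial\Omega)<\delta\}$; $B_\delta(\mathbf x)=\{\mathbf y:|\mathbf y-\mathbf x|<\delta\}$. Kernel: $\gamma_\delta(|\mathbf x-\mathbf y|)=\frac1{\delta^{d+2}}\gamma_1\!\left(\frac{|\mathbf x-\mathbf y|}{\delta}\right)$, equal to $\frac{D_0}{\delta^{d+2-s}|\mathbf x-\mathbf y|^s}$ for $|\mathbf x-\mathbf y|<\delta$ and $0$ otherwise ($D_0>0$), where $\gamma_1$ is nonnegative, nonincreasing, has a singularity of order $s$ at the origin, $\mathrm{supp}(\gamma_1)\subset B_1(\mathbf 0)$ and $\int_{B_1(\mathbf 0)}\gamma_1(|\mathbf z|)|\mathbf z|^2d\mathbf z=d$. $\mathcal L^\delta[u](\mathbf x)=2\int_{B_\delta(\mathbf x)}A(\mathbf x,\mathbf y)\gamma_\delta(|\mathbf x-\mathbf y|)(u(\mathbf y)-u(\mathbf x))\,d\mathbf y$. Grid: $\chi_h=\{(k_{(1)}h,\dots,k_{(d)}h):\mathbf k\in\mathbb Z^d\}\cap(\Omega\cup\Omega_\delta)=\{\mathbf x_i\}$. For each $\mathbf x_i\in\chi_h\cap\Omega$ the quadrature weights $\{\omega_{j,i}\}$, indexed by $\mathbf x_j\in\chi_h\cap B_\delta(\mathbf x_i)\setminus\{\mathbf x_i\}$, minimize $\sum_j\frac12\omega_{j,i}^2\,\gamma_\delta(|\mathbf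 x_j-\mathbf x_i|)$ subject to $\sum_j q(\mathbf x_i,\mathbf x_j)\omega_{j,i}=\int_{B_\delta(\mathbf x_i)}q(\mathbf x_i,\mathbf y)\,d\mathbf y$ for all $q(\mathbf x,\mathbf y)=p(\mathbf y-\mathbf x)\gamma_\delta(|\mathbf x-\mathbf y|)$ with $p$ a polynomial on $\mathbb R^d$ of degree at most $3$. Discrete operator: $(\mathcal L_h^\delta u)(\mathbf x_i)=2\sum_{\mathbf x_j\in\chi_h\cap B_\delta(\mathbf x_i)\setminus\{\mathbf x_i\}}A(\mathbf x_i,\mathbf x_j)\gamma_\delta(|\mathbf x_i-\mathbf x_j|)(u(\mathbf x_j)-u(\mathbf x_i))\omega_{j,i}$. Discretized problem: $-(\mathcal L_h^\delta u_h^\delta)(\mathbf x_i)=f(\mathbf x_i)$ for $\mathbf x_i\in\chi_h\cap\Omega$, $u_h^\delta(\mathbf x_i)=u^D(\mathbf x_i)$ for $\mathbf x_i\in\chi_h\cap\Omega_\delta$. $C_{pos}>0$ is a constant, independent of $\delta$ and $h$, such that for all $h<C_{pos}\delta$ the weight optimization problem is solvable (grid unisolvent) and all $\omega_{j,i}>0$. $\|v\|_{L^\infty(\chi_h)}=\max_{\mathbf x_i\in\chi_h}|v(\mathbf x_i)|$. Regularity classes $C^k$ of functions in $\Omega\cup\Omega_\delta$ are understood with bounded derivatives (uniformly in any other variable). *)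

theory Defs
  imports "HOL-Analysis.Analysis"
begin

section \<open>Domains\<close>

text \<open>
  \<open>graph_boundary P U\<close>: near each boundary point, \<open>U\<close> is the strict epigraph, in some direction \<open>e\<close>,
  of a function \<open>\<phi>\<close> with property \<open>P e \<phi>\<close>. The hyperplane orthogonal to \<open>e\<close> plays the role of the
  space of the first \<open>d - 1\<close> coordinates; only the values of \<open>\<phi>\<close> on that hyperplane matter.
\<close>

definition graph_boundary ::
  "(real^'n \<Rightarrow> (real^'n \<Rightarrow> real) \<Rightarrow> bool) \<Rightarrow> (real^'n) set \<Rightarrow> bool" where
  "graph_boundary P U \<longleftrightarrow>
     (\<forall>p\<in>frontier U. \<exists>e \<rho> \<phi>. norm e = 1 \<and> 0 < \<rho> \<and> P e \<phi> \<and>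
        U \<inter> ball p \<rho> = {x \<in> ball p \<rho>. \<phi> (x - (x \<bullet> e) *\<^sub>R e) < x \<bullet> e})"

definition lipschitz_domain :: "(real^'n) set \<Rightarrow> bool" where
  "lipschitz_domain U \<longleftrightarrow> open U \<and> connected U \<and> U \<noteq> {} \<and>
     graph_boundary (\<lambda>e \<phi>. \<exists>L. L-lipschitz_on {z. z \<bullet> e = 0} \<phi>) U"

text \<open>
  A function on the hyperplane orthogonal to \<open>e\<close> is \<open>C\<^sup>1\<close> iff its extension to the whole space,
  constant in the direction \<open>e\<close>, is \<open>C\<^sup>1\<close>.
\<close>

definition C1_domain :: "(real^'n) set \<Rightarrow> bool" where
  "C1_domain U \<longleftrightarrow> open U \<and> connected U \<and> U \<noteq> {} \<and>
     graph_boundary (\<lambda>e \<phi>. \<exists>g. continuous_on UNIV g \<and>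
        (\<forall>x. GDERIV (\<lambda>x. \<phi> (x - (x \<bullet> e) *\<^sub>R e)) x :> g x)) U"

definition collar :: "real \<Rightarrow> (real^'n) set \<Rightarrow> (real^'n) set" where
  "collar \<delta> \<Omega> = {x. x \<notin> \<Omega> \<and> infdist x (frontier \<Omega>) < \<delta>}"


section \<open>Regularity classes\<close>

text \<open>
  \<open>Ck_bounded B k S f\<close>: on the open set \<open>S\<close>, \<open>f\<close> is \<open>C\<^sup>k\<close> and all its partial derivatives of orders
  \<open>0, \<dots>, k\<close> are bounded by \<open>B\<close>. The explicit \<open>B\<close> allows bounds that are uniform in a parameter.
\<close>

primrec Ck_bounded ::
  "real \<Rightarrow> nat \<Rightarrow> (real^'n) set \<Rightarrow> (real^'n \<Rightarrow> real) \<Rightarrow> bool" where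
  "Ck_bounded B 0 S f \<longleftrightarrow> continuous_on S f \<and> (\<forall>x\<in>S. \<bar>f x\<bar> \<le> B)"
| "Ck_bounded B (Suc k) S f \<longleftrightarrow> (\<forall>x\<in>S. \<bar>f x\<bar> \<le> B) \<and>
     (\<exists>g. (\<forall>x\<in>S. GDERIV f x :> g x) \<and> (\<forall>i. Ck_bounded B k S (\<lambda>x. g x $ i)))"


section \<open>Kernel and nonlocal operator\<close>

text \<open>
  The value at \<open>0\<close> is left free: it represents the singularity, and it enters neither the integrals
  nor the quadrature sums. The exponent satisfies \<open>0 \<le> s\<close> by monotonicity.
\<close>

definition kernel_profile :: "real \<Rightarrow> real \<Rightarrow> (real \<Rightarrow> real) \<Rightarrow> bool" where
  "kernel_profile D0 s \<gamma>1 \<longleftrightarrow> 0 < D0 \<and>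
     (\<forall>\<tau>. 0 < \<tau> \<and> \<tau> < 1 \<longrightarrow> \<gamma>1 \<tau> = D0 / \<tau> powr s) \<and> (\<forall>\<tau>\<ge>1. \<gamma>1 \<tau> = 0) \<and>
     (\<forall>\<tau>>0. 0 \<le> \<gamma>1 \<tau>) \<and> antimono_on {0<..} \<gamma>1"

definition kernel :: "(real \<Rightarrow> real) \<Rightarrow> real \<Rightarrow> real^'n \<Rightarrow> real" where
  "kernel \<gamma>1 \<delta> z = 1 / \<delta> ^ (CARD('n) + 2) * \<gamma>1 (norm z / \<delta>)"

definition nonlocal_op ::
  "(real^'n \<Rightarrow> real^'n \<Rightarrow> real) \<Rightarrow> (real \<Rightarrow> real) \<Rightarrow> real \<Rightarrow> (real^'n \<Rightarrow> real) \<Rightarrow> real^'n \<Rightarrow> real" where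
  "nonlocal_op A \<gamma>1 \<delta> u x =
     2 * (LINT y:ball x \<delta>|lebesgue. A x y * kernel \<gamma>1 \<delta> (x - y) * (u y - u x))"

definition nonlocal_solution ::
  "(real^'n) set \<Rightarrow> (real^'n \<Rightarrow> real^'n \<Rightarrow> real) \<Rightarrow> (real \<Rightarrow> real) \<Rightarrow> real \<Rightarrow>
     (real^'n \<Rightarrow> real) \<Rightarrow> (real^'n \<Rightarrow> real) \<Rightarrow> (real^'n \<Rightarrow> real) \<Rightarrow> bool" where
  "nonlocal_solution \<Omega> A \<gamma>1 \<delta> f uD u \<longleftrightarrow>
     (\<forall>x\<in>\<Omega>. - nonlocal_op A \<gamma>1 \<delta> u x = f x) \<and> (\<forall>x\<in>collar \<delta> \<Omega>. u x = uD x)"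


section \<open>Meshfree discretization\<close>

definition grid :: "(real^'n) set \<Rightarrow> real \<Rightarrow> real \<Rightarrow> (real^'n) set" where
  "grid \<Omega> \<delta> h = {\<chi> i. of_int (k $ i) * h |k :: int^'n. True} \<inter> (\<Omega> \<union> collar \<delta> \<Omega>)"

definition stencil :: "(real^'n) set \<Rightarrow> real \<Rightarrow> real \<Rightarrow> real^'n \<Rightarrow> (real^'n) set" where
  "stencil \<Omega> \<delta> h xi = grid \<Omega> \<delta> h \<inter> ball xi \<delta> - {xi}"

definition poly_deg_le :: "nat \<Rightarrow> (real^'n \<Rightarrow> real) \<Rightarrow> bool" where
  "poly_deg_le m p \<longleftrightarrow>
     (\<exists>c :: ('n \<Rightarrow> nat) \<Rightarrow> real. \<forall>z.
        p z = (\<Sum>\<alpha> | (\<Sum>i\<in>UNIV. \<alpha> i) \<le> m. c \<alpha> * (\<Prod>i\<in>UNIV. (z $ i) ^ \<alpha> i)))"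

text \<open>
  \<open>w xj\<close> is the weight of the node \<open>xj\<close> in the quadrature rule centred at \<open>xi\<close>; its values outside
  the stencil are irrelevant.
\<close>

definition exact_weights ::
  "(real^'n) set \<Rightarrow> (real \<Rightarrow> real) \<Rightarrow> real \<Rightarrow> real \<Rightarrow> real^'n \<Rightarrow> (real^'n \<Rightarrow> real) \<Rightarrow> bool" where
  "exact_weights \<Omega> \<gamma>1 \<delta> h xi w \<longleftrightarrow>
     (\<forall>p. poly_deg_le 3 p \<longrightarrow>
        (\<Sum>xj\<in>stencil \<Omega> \<delta> h xi. p (xj - xi) * kernel \<gamma>1 \<delta> (xi - xj) * w xj)
        = (LINT y:ball xi \<delta>|lebesgue. p (y - xi) * kernel \<gamma>1 \<delta> (xi - y)))"

definition weight_energy ::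
  "(real^'n) set \<Rightarrow> (real \<Rightarrow> real) \<Rightarrow> real \<Rightarrow> real \<Rightarrow> real^'n \<Rightarrow> (real^'n \<Rightarrow> real) \<Rightarrow> real" where
  "weight_energy \<Omega> \<gamma>1 \<delta> h xi w =
     (\<Sum>xj\<in>stencil \<Omega> \<delta> h xi. 1/2 * (w xj)\<^sup>2 * kernel \<gamma>1 \<delta> (xj - xi))"

definition optimal_weights ::
  "(real^'n) set \<Rightarrow> (real \<Rightarrow> real) \<Rightarrow> real \<Rightarrow> real \<Rightarrow> real^'n \<Rightarrow> (real^'n \<Rightarrow> real) \<Rightarrow> bool" where
  "optimal_weights \<Omega> \<gamma>1 \<delta> h xi w \<longleftrightarrow> exact_weights \<Omega> \<gamma>1 \<delta> h xi w \<and>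
     (\<forall>w'. exact_weights \<Omega> \<gamma>1 \<delta> h xi w' \<longrightarrow>
        weight_energy \<Omega> \<gamma>1 \<delta> h xi w \<le> weight_energy \<Omega> \<gamma>1 \<delta> h xi w')"

definition positivity_constant :: "(real^'n) set \<Rightarrow> (real \<Rightarrow> real) \<Rightarrow> real \<Rightarrow> bool" where
  "positivity_constant \<Omega> \<gamma>1 Cpos \<longleftrightarrow> 0 < Cpos \<and>
     (\<forall>\<delta> h. 0 < \<delta> \<and> 0 < h \<and> h < Cpos * \<delta> \<longrightarrow>
        (\<forall>xi\<in>grid \<Omega> \<delta> h \<inter> \<Omega>.
           (\<exists>w. optimal_weights \<Omega> \<gamma>1 \<delta> h xi w) \<and>
           (\<forall>w. optimal_weights \<Omega> \<gamma>1 \<delta> h xi w \<longrightarrow> (\<forall>xj\<in>stencil \<Omega> \<delta> h xi. 0 < w xj))))"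

text \<open>In \<open>\<omega> xi xj\<close> the first argument is the centre of the quadrature rule.\<close>

definition discrete_op ::
  "(real^'n) set \<Rightarrow> (real^'n \<Rightarrow> real^'n \<Rightarrow> real) \<Rightarrow> (real \<Rightarrow> real) \<Rightarrow> real \<Rightarrow> real \<Rightarrow>
     (real^'n \<Rightarrow> real^'n \<Rightarrow> real) \<Rightarrow> (real^'n \<Rightarrow> real) \<Rightarrow> real^'n \<Rightarrow> real" where
  "discrete_op \<Omega> A \<gamma>1 \<delta> h \<omega> u xi =
     2 * (\<Sum>xj\<in>stencil \<Omega> \<delta> h xi.
            A xi xj * kernel \<gamma>1 \<delta> (xi - xj) * (u xj - u xi) * \<omega> xi xj)"

definition discrete_solution ::
  "(real^'n) set \<Rightarrow> (real^'n \<Rightarrow> real^'n \<Rightarrow> real) \<Rightarrow> (real \<Rightarrow> real) \<Rightarrow> real \<Rightarrow> real \<Rightarrow>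
     (real^'n \<Rightarrow> real) \<Rightarrow> (real^'n \<Rightarrow> real) \<Rightarrow> (real^'n \<Rightarrow> real) \<Rightarrow> bool" where
  "discrete_solution \<Omega> A \<gamma>1 \<delta> h f uD uh \<longleftrightarrow>
     (\<exists>\<omega>. (\<forall>xi\<in>grid \<Omega> \<delta> h \<inter> \<Omega>. optimal_weights \<Omega> \<gamma>1 \<delta> h xi (\<omega> xi)) \<and>
          (\<forall>xi\<in>grid \<Omega> \<delta> h \<inter> \<Omega>. - discrete_op \<Omega> A \<gamma>1 \<delta> h \<omega> uh xi = f xi) \<and>
          (\<forall>xi\<in>grid \<Omega> \<delta> h \<inter> collar \<delta> \<Omega>. uh xi = uD xi))"

definition grid_norm :: "(real^'n) set \<Rightarrow> (real^'n \<Rightarrow> real) \<Rightarrow> real" where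
  "grid_norm G v = Max ((\<lambda>x. \<bar>v x\<bar>) ` G)"


section \<open>Hypotheses on the diffusion coefficient\<close>

definition admissible_coefficient ::
  "(real^'n) set \<Rightarrow> real \<Rightarrow> real \<Rightarrow> real \<Rightarrow> (real^'n \<Rightarrow> real^'n \<Rightarrow> real) \<Rightarrow> bool" where
  "admissible_coefficient \<Omega> \<delta> r R A \<longleftrightarrow>
     (let S = \<Omega> \<union> collar \<delta> \<Omega> in
        (\<forall>(x, y)\<in>closure (S \<times> S). A x y = A y x \<and> r \<le> A x y \<and> A x y \<le> R) \<and>
        continuous_on (closure (S \<times> S)) (\<lambda>(x, y). A x y) \<and>
        (\<exists>B. \<forall>y\<in>S. Ck_bounded B 1 S (\<lambda>x. A y x)) \<and>
        (\<forall>k. \<exists>B. Ck_bounded B k \<Omega> (\<lambda>x. A x x)))"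

end

theory Submission
  imports Defs
begin

text \<open>
  The energy minimizing weights are restrictions of a polynomial of degree at most three to the
  stencil. Writing this polynomial as \<open>h\<^sup>d (1 + Q)\<close>, the exactness conditions say that pairing \<open>Q\<close> with
  a polynomial \<open>p\<close> gives the error of the punctured Riemann sum for \<open>p\<close> times the kernel. This error is
  of order \<open>min 1 (d - s)\<close>; taking \<open>p = Q\<close> and using the equivalence of norms on polynomials, \<open>Q\<close> is
  of the same order, and so is the consistency error for a Lipschitz integrand. For \<open>h\<close> bounded below,
  positivity and exactness on constants suffice. Stability is a discrete maximum principle with an
  exponential barrier whose constants do not depend on \<open>h\<close>.
\<close>

section \<open>Integrals of powers of the norm\<close>

text \<open>At fixed \<delta> the stencil ball keeps its radius while h tends to 0, so exactness on
  cubic polynomials alone gives no smallness for a Lipschitz integrand: the polynomial approximation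
  error does not shrink with h. The gain must come from the weights being close to h^d. No formula
  for them is at hand; duality with the Riemann error supplies the closeness, with constants taken
  from integrals and therefore free of h. The exponent min 1 (d - s) has two sources. The cell of
  the origin, which the punctured sum drops, has kernel mass of order h^(d-s); the layer of cells
  cut by the sphere and the variation of a Lipschitz factor cost order h. At d - s = 1 a first order
  expansion of the kernel on each cell would produce h log h. Hence the integrand is split as F 0 +
  (F - F 0): the constant part is treated with second differences, and in the other part the factor
  |y| gained from F - F 0 cancels the extra singularity of the gradient of the kernel.\<close>

lemma powr_neg_diff_le:
  fixes q m x y :: real
  assumes "0 \<le> q" "0 < m" "m \<le> x" "m \<le> y"
  shows "\<bar>x powr -q - y powr -q\<bar> \<le> q * m powr (-q-1) * \<bar>x - y\<bar>"
proof -
  have "norm (x powr -q - y powr -q) \<le> (q * m powr (-q-1)) * norm (x - y)"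
  proof (rule field_differentiable_bound[where S="{m..}" and f' = "\<lambda>x. -q * x powr (-q-1)"])
    show "((\<lambda>x. x powr -q) has_field_derivative - q * z powr (- q - 1)) (at z within {m..})"
      if "z \<in> {m..}" for z
      using that assms by (auto intro!: derivative_eq_intros has_real_derivative_powr)
    show "norm (- q * z powr (- q - 1)) \<le> q * m powr (- q - 1)" if "z \<in> {m..}" for z
      using that assms by (auto simp: abs_mult intro!: mult_left_mono powr_mono2')
  qed (use assms in auto)
  then show ?thesis by simp
qed

text \<open>Apply the mean value theorem on each side of \<open>x\<close>: the second difference
  becomes \<open>t * q\<close> times a difference of derivatives at two points at most
  \<open>2 * t\<close> apart, and \<open>powr_neg_diff_le\<close> with exponent \<open>q + 1\<close>
  bounds it.\<close>

lemma powr_neg_second_diff_le: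
  fixes q m x t :: real
  assumes q: "0 \<le> q" and m: "0 < m" and t: "0 \<le> t" and x: "m \<le> x - t"
  shows "\<bar>(x + t) powr -q + (x - t) powr -q - 2 * x powr -q\<bar> \<le> 2 * q * (q+1) * m powr (-q-2) * t\<^sup>2"
proof (cases "t = 0")
  case False
  with t have t: "0 < t" by simp
  have der: "((\<lambda>x. x powr -q) has_real_derivative - q * z powr (- q - 1)) (at z)" if "0 < z" for z
    using that by (auto intro!: derivative_eq_intros)
  obtain z1 where z1: "x < z1" "z1 < x + t" "(x + t) powr -q - x powr -q = t * (-q * z1 powr (-q-1))"
    using MVT2[of x "x+t" "\<lambda>x. x powr -q" "\<lambda>z. - q * z powr (- q - 1)"] der t x m by force
  obtain z2 where z2: "x - t < z2" "z2 < x" "x powr -q - (x-t) powr -q = t * (-q * z2 powr (-q-1))"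
    using MVT2[of "x-t" x "\<lambda>x. x powr -q" "\<lambda>z. - q * z powr (- q - 1)"] der t x m by force
  have eq: "(x + t) powr -q + (x - t) powr -q - 2 * x powr -q
          = t * q * (z2 powr (-q-1) - z1 powr (-q-1))"
    using z1(3) z2(3) by (simp add: algebra_simps)
  have "\<bar>z2 powr -(q+1) - z1 powr -(q+1)\<bar> \<le> (q+1) * m powr (-(q+1)-1) * \<bar>z2 - z1\<bar>"
    by (rule powr_neg_diff_le) (use q m z1 z2 x in auto)
  also have "\<dots> \<le> (q+1) * m powr (-(q+1)-1) * (2 * t)"
    using z1 z2 q by (intro mult_left_mono) auto
  finally have "\<bar>z2 powr -(q+1) - z1 powr -(q+1)\<bar> \<le> (q+1) * m powr (-(q+1)-1) * (2 * t)" .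
  moreover have "-(q+1) = -q-1" "-(q+1)-1 = -q-2" by auto
  ultimately have "\<bar>z2 powr (-q-1) - z1 powr (-q-1)\<bar> \<le> (q+1) * m powr (-q-2) * (2 * t)"
    by metis
  then have "(t * q) * \<bar>z2 powr (-q-1) - z1 powr (-q-1)\<bar> \<le> (t * q) * ((q+1) * m powr (-q-2) * (2 * t))"
    using t q by (intro mult_left_mono) auto
  then show ?thesis
    unfolding eq abs_mult[of "t * q"] using t q by (simp add: power2_eq_square algebra_simps)
qed simp

section \<open>Dyadic shells and integrability of powers of the norm\<close>

lemma dyadic_shell:
  fixes x \<rho> :: real
  assumes "0 < x" "x < \<rho>"
  obtains n :: nat where "\<rho> / 2 ^ Suc n \<le> x" "x < \<rho> / 2 ^ n"
proof -
  define P where "P n \<longleftrightarrow> \<rho> / 2 ^ Suc n \<le> x" for n :: nat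
  obtain n where "\<rho> / x < 2 ^ n" using real_arch_pow[of 2 "\<rho>/x"] by auto
  then have "P n"
    using assms by (simp add: P_def field_simps)
  then have "P (LEAST n. P n)" by (rule LeastI)
  moreover have "x < \<rho> / 2 ^ (LEAST n. P n)"
  proof (cases "LEAST n. P n")
    case 0 then show ?thesis using assms by simp
  next
    case (Suc k)
    then have "\<not> P k" using not_less_Least[of k P] by simp
    then show ?thesis using Suc by (simp add: P_def)
  qed
  ultimately show thesis using that by (auto simp: P_def)
qed

text \<open>The bound for \<open>norm y powr -p\<close> on the \<open>n\<close>-th shell times the
  size of its outer ball is a term of a geometric series, whose ratio \<open>2 powr (p - d)\<close>
  is below 1 exactly when \<open>p < d\<close>.\<close>

lemma dyadic_powr:
  fixes \<rho> p :: real
  assumes \<rho>: "0 < \<rho>"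
  shows "(\<rho>/2^Suc n) powr -p * (\<rho>/2^n) ^ d = 2 powr p * \<rho> powr (real d - p) * (2 powr (p - real d)) ^ n"
proof -
  define r where "r = \<rho> * 2 powr (-real n)"
  have r: "0 < r" "\<rho>/2^n = r" "\<rho>/2^Suc n = r * 2 powr -1"
    using \<rho> by (auto simp: r_def powr_minus powr_realpow field_simps)
  have "(r * 2 powr -1) powr -p * r ^ d = (r powr -p * (2 powr -1) powr -p) * r powr real d"
    using r(1) by (subst powr_mult) (auto simp: powr_realpow)
  also have "(2 powr -1) powr -p = 2 powr p"
    by (subst powr_powr) simp
  also have "r powr -p * 2 powr p * r powr real d = r powr (real d - p) * 2 powr p"
    by (simp add: powr_diff powr_minus_divide)
  also have "r powr (real d - p) = \<rho> powr (real d - p) * 2 powr (- real n * (real d - p))"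
    using \<rho> by (simp add: r_def powr_mult powr_powr)
  also have "2 powr (- real n * (real d - p)) = (2 powr (p - real d)) powr real n"
    by (simp add: powr_powr algebra_simps)
  also have "\<dots> = (2 powr (p - real d)) ^ n" by (simp add: powr_realpow)
  finally show ?thesis unfolding r by (simp add: mult_ac)
qed

text \<open>Dominating \<open>f\<close> by a series of multiples of ball indicators and integrating
  term by term gives integrability and the estimate together, without polar coordinates.\<close>

lemma integral_le_sum_balls:
  fixes f :: "real^'n \<Rightarrow> real"
  assumes fm: "f \<in> borel_measurable borel" and f0: "\<And>y. 0 \<le> f y"
    and a: "\<And>n. 0 \<le> a n" and r: "\<And>n. 0 \<le> r n"
    and dom: "\<And>y. f y \<noteq> 0 \<Longrightarrow> \<exists>n::nat. norm y < r n \<and> f y \<le> a n"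
    and sums: "(\<lambda>n. a n * r n ^ CARD('n)) sums c"
  shows "f absolutely_integrable_on UNIV" "integral UNIV f \<le> unit_ball_vol (real CARD('n)) * c"
proof -
  define V where "V = unit_ball_vol (real CARD('n))"
  have V: "0 \<le> V" by (simp add: V_def)
  have c: "0 \<le> c" using sums_le[OF _ sums_zero sums] a r by simp
  define g where "g n y = ennreal (a n) * indicator (ball (0::real^'n) (r n)) y" for n y
  have gm: "g n \<in> borel_measurable lborel" for n
  proof -
    have "ball (0::real^'n) (r n) \<in> sets lborel" by simp
    then show ?thesis unfolding g_def
      by (intro borel_measurable_times_ennreal borel_measurable_const borel_measurable_indicator)
  qed
  have "(\<integral>\<^sup>+y. ennreal (f y) \<partial>lborel) \<le> (\<integral>\<^sup>+y. (\<Sum>n. g n y) \<partial>lborel)"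
  proof (rule nn_integral_mono)
    fix y :: "real^'n"
    show "ennreal (f y) \<le> (\<Sum>n. g n y)"
    proof (cases "f y = 0")
      case False
      then obtain n where n: "norm y < r n" "f y \<le> a n" using dom by blast
      then have "ennreal (f y) \<le> g n y" by (auto simp: g_def ennreal_leI)
      also have "\<dots> \<le> (\<Sum>n. g n y)"
        using sum_le_suminf[of "\<lambda>n. g n y" "{n}"] by auto
      finally show ?thesis .
    qed simp
  qed
  also have "\<dots> = (\<Sum>n. \<integral>\<^sup>+y. g n y \<partial>lborel)"
    by (rule nn_integral_suminf[OF gm])
  also have "\<dots> = (\<Sum>n. ennreal (V * (a n * r n ^ CARD('n))))"
  proof (rule suminf_cong)
    fix n
    have "(\<integral>\<^sup>+y. g n y \<partial>lborel) = ennreal (a n) * emeasure lborel (ball (0::real^'n) (r n))"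
      unfolding g_def by (rule nn_integral_cmult_indicator) simp
    also have "\<dots> = ennreal (a n * (V * r n ^ CARD('n)))"
      using r a V by (subst emeasure_ball) (auto simp: ennreal_mult'' V_def)
    finally show "(\<integral>\<^sup>+y. g n y \<partial>lborel) = ennreal (V * (a n * r n ^ CARD('n)))"
      by (simp add: mult_ac)
  qed
  also have "\<dots> = ennreal (V * c)"
    using a r V sums_mult[OF sums, of V] by (intro suminf_ennreal_eq) auto
  finally have main: "(\<integral>\<^sup>+y. ennreal (f y) \<partial>lborel) \<le> ennreal (V * c)" .
  have int: "integrable lborel f"
  proof (rule integrableI_bounded)
    show "f \<in> borel_measurable lborel" using fm by simp
    show "(\<integral>\<^sup>+y. ennreal (norm (f y)) \<partial>lborel) < \<infinity>"
      using main f0 by (simp add: le_less_trans[OF _ ennreal_less_top])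
  qed
  have hi: "(f has_integral integral\<^sup>L lborel f) UNIV"
    by (rule has_integral_integral_lborel[OF int])
  then show "f absolutely_integrable_on UNIV"
    using f0 by (intro nonnegative_absolutely_integrable_1) auto
  have "ennreal (integral\<^sup>L lborel f) = (\<integral>\<^sup>+y. ennreal (f y) \<partial>lborel)"
    by (rule nn_integral_eq_integral[symmetric]) (use int f0 in auto)
  also note main
  finally have "integral\<^sup>L lborel f \<le> V * c"
    using V c by (simp add: ennreal_le_iff)
  then show "integral UNIV f \<le> unit_ball_vol (real CARD('n)) * c"
    using integral_unique[OF hi] by (simp add: V_def)
qed

lemma norm_powr_restrict_measurable:
  fixes S :: "(real^'n) set"
  assumes "S \<in> sets borel"
  shows "(\<lambda>y. if y \<in> S then norm y powr p else 0) \<in> borel_measurable borel"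
proof -
  have "(\<lambda>y::real^'n. norm y powr p) \<in> borel_measurable borel" by measurable
  then show ?thesis using assms by (intro measurable_If_set) auto
qed

text \<open>Shells shrink to the origin, with the integrand bounded by its value at the inner
  radius. The constant is the same for all radii because the estimate is later used at a radius
  proportional to the mesh size.\<close>

lemma norm_powr_integral_ball:
  fixes p :: real
  assumes p: "0 \<le> p" "p < real CARD('n)"
  obtains C where "0 \<le> C"
    "\<And>\<rho>. 0 < \<rho> \<Longrightarrow> (\<lambda>y::real^'n. norm y powr -p) absolutely_integrable_on ball 0 \<rho>"
    "\<And>\<rho>. 0 < \<rho> \<Longrightarrow> integral (ball 0 \<rho>) (\<lambda>y::real^'n. norm y powr -p) \<le> C * \<rho> powr (real CARD('n) - p)"
proof -
  define x where "x = 2 powr (p - real CARD('n))"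
  have x: "0 < x" "x < 1" using p unfolding x_def by (auto simp: powr_less_one)
  define C where "C = unit_ball_vol (real CARD('n)) * (2 powr p * (1 / (1 - x)))"
  have C: "0 \<le> C" using x by (simp add: C_def)
  have "(\<lambda>y::real^'n. norm y powr -p) absolutely_integrable_on ball 0 \<rho> \<and>
    integral (ball 0 \<rho>) (\<lambda>y::real^'n. norm y powr -p) \<le> C * \<rho> powr (real CARD('n) - p)" if \<rho>: "0 < \<rho>" for \<rho>
  proof -
    define f where "f y = (if y \<in> ball 0 \<rho> then norm y powr -p else 0)" for y :: "real^'n"
    define c where "c = 2 powr p * \<rho> powr (real CARD('n) - p) * (1 / (1 - x))"
    have s: "(\<lambda>n. (\<rho>/2^Suc n) powr -p * (\<rho>/2^n) ^ CARD('n)) sums c"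
      unfolding dyadic_powr[OF \<rho>] c_def x_def[symmetric]
      by (intro sums_mult geometric_sums) (use x in auto)
    have dom: "\<exists>n. norm y < \<rho>/2^n \<and> f y \<le> (\<rho>/2^Suc n) powr -p" if "f y \<noteq> 0" for y
    proof -
      from that have y: "y \<noteq> 0" "norm y < \<rho>" by (auto simp: f_def split: if_splits)
      then obtain n where n: "\<rho> / 2 ^ Suc n \<le> norm y" "norm y < \<rho> / 2 ^ n"
        using dyadic_shell[of "norm y" \<rho>] by auto
      have "norm y powr -p \<le> (\<rho>/2^Suc n) powr -p"
        using n p \<rho> by (intro powr_mono2') auto
      then show ?thesis using n y by (auto simp: f_def)
    qed
    have fm: "f \<in> borel_measurable borel" unfolding f_def
      by (rule norm_powr_restrict_measurable) simp
    note * = integral_le_sum_balls[of f "\<lambda>n. (\<rho>/2^Suc n) powr -p" "\<lambda>n. \<rho>/2^n", OF fm _ _ _ dom s]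
    have "f absolutely_integrable_on UNIV" by (rule *(1)) (use \<rho> in \<open>auto simp: f_def\<close>)
    moreover have "integral UNIV f \<le> unit_ball_vol (real CARD('n)) * c"
      by (rule *(2)) (use \<rho> in \<open>auto simp: f_def\<close>)
    moreover have "unit_ball_vol (real CARD('n)) * c = C * \<rho> powr (real CARD('n) - p)"
      by (simp add: C_def c_def)
    ultimately show ?thesis
      unfolding f_def absolutely_integrable_restrict_UNIV integral_restrict_UNIV by simp
  qed
  then show thesis using that C by blast
qed

text \<open>The counterpart at infinity: shells of doubling radius, with geometric ratio
  \<open>2 powr (d - p)\<close>, below 1 because \<open>p > d\<close>.\<close>

lemma norm_powr_integral_shell:
  fixes p :: real
  assumes p: "real CARD('n) < p"
  obtains C where "0 \<le> C"
    "\<And>\<rho>. 0 < \<rho> \<Longrightarrow> (\<lambda>y::real^'n. norm y powr -p) absolutely_integrable_on - ball 0 \<rho>"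
    "\<And>\<rho>. 0 < \<rho> \<Longrightarrow> integral (- ball 0 \<rho>) (\<lambda>y::real^'n. norm y powr -p) \<le> C * \<rho> powr (real CARD('n) - p)"
proof -
  define x where "x = 2 powr (real CARD('n) - p)"
  have x: "0 < x" "x < 1" using p unfolding x_def by (auto simp: powr_less_one)
  define C where "C = unit_ball_vol (real CARD('n)) * (2 ^ CARD('n) * (1 / (1 - x)))"
  have C: "0 \<le> C" using x by (simp add: C_def)
  have "(\<lambda>y::real^'n. norm y powr -p) absolutely_integrable_on - ball 0 \<rho> \<and>
    integral (- ball 0 \<rho>) (\<lambda>y::real^'n. norm y powr -p) \<le> C * \<rho> powr (real CARD('n) - p)" if \<rho>: "0 < \<rho>" for \<rho>
  proof -
    define f where "f y = (if y \<in> - ball 0 \<rho> then norm y powr -p else 0)" for y :: "real^'n"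
    define c where "c = 2 ^ CARD('n) * \<rho> powr (real CARD('n) - p) * (1 / (1 - x))"
    have eq: "(\<rho>*2^n) powr -p * (\<rho>*2^Suc n) ^ CARD('n)
        = 2 ^ CARD('n) * \<rho> powr (real CARD('n) - p) * x ^ n" for n
    proof -
      have "(\<rho>*2^n) powr -p * (\<rho>*2^Suc n) ^ CARD('n) = 2 ^ CARD('n) * ((\<rho>*2^n) powr -p * (\<rho>*2^n) powr real CARD('n))"
        using \<rho> by (simp add: powr_realpow power_mult_distrib)
      also have "(\<rho>*2^n) powr -p * (\<rho>*2^n) powr real CARD('n) = (\<rho>*2^n) powr (real CARD('n) - p)"
        by (simp add: powr_add[symmetric])
      also have "\<dots> = \<rho> powr (real CARD('n) - p) * (2 powr real n) powr (real CARD('n) - p)"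
        using \<rho> by (simp add: powr_mult powr_realpow)
      also have "(2 powr real n) powr (real CARD('n) - p) = x powr real n"
        unfolding x_def by (simp add: powr_powr mult.commute)
      also have "x powr real n = x ^ n" using x by (simp add: powr_realpow)
      finally show ?thesis by simp
    qed
    have s: "(\<lambda>n. (\<rho>*2^n) powr -p * (\<rho>*2^Suc n) ^ CARD('n)) sums c"
      unfolding eq c_def
      by (intro sums_mult geometric_sums) (use x in auto)
    have dom: "\<exists>n. norm y < \<rho>*2^Suc n \<and> f y \<le> (\<rho>*2^n) powr -p" if "f y \<noteq> 0" for y
    proof -
      from that have y: "\<rho> \<le> norm y" by (auto simp: f_def split: if_splits)
      obtain k :: nat where "norm y / \<rho> < 2 ^ k" using real_arch_pow[of 2 "norm y / \<rho>"] by auto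
      then have "\<rho> * 2 ^ k > norm y" using \<rho> by (simp add: field_simps)
      \<comment> \<open>Descend from a power of 2 that is too large: \<open>n\<close> is the last
        exponent for which \<open>\<rho> * 2^n\<close> does not exceed the norm.\<close>
      then obtain n where n: "\<rho> * 2^n \<le> norm y" "norm y < \<rho>*2^Suc n"
        using y
      proof (induction k arbitrary: thesis)
        case (Suc k)
        show ?case
        proof (cases "\<rho> * 2 ^ k > norm y")
          case True
          from Suc.IH[OF Suc.prems(1) True Suc.prems(3)] show ?thesis .
        next
          case False
          then show ?thesis using Suc.prems(1)[of k] Suc.prems(2) by simp
        qed
      qed auto
      have "norm y powr -p \<le> (\<rho>*2^n) powr -p"
        using n p \<rho> by (intro powr_mono2') auto
      then show ?thesis using n y by (auto simp: f_def)
    qed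
    have fm: "f \<in> borel_measurable borel" unfolding f_def
      by (rule norm_powr_restrict_measurable) simp
    note * = integral_le_sum_balls[of f "\<lambda>n. (\<rho>*2^n) powr -p" "\<lambda>n. \<rho>*2^Suc n", OF fm _ _ _ dom s]
    have "f absolutely_integrable_on UNIV" by (rule *(1)) (use \<rho> in \<open>auto simp: f_def\<close>)
    moreover have "integral UNIV f \<le> unit_ball_vol (real CARD('n)) * c"
      by (rule *(2)) (use \<rho> in \<open>auto simp: f_def\<close>)
    moreover have "unit_ball_vol (real CARD('n)) * c = C * \<rho> powr (real CARD('n) - p)"
      by (simp add: C_def c_def)
    ultimately show ?thesis
      unfolding f_def absolutely_integrable_restrict_UNIV integral_restrict_UNIV by simp
  qed
  then show thesis using that C by blast
qed

section \<open>Lattice cells\<close>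

definition lattice :: "real \<Rightarrow> (real^'n) set" where
  "lattice h = {\<chi> i. of_int (k $ i) * h |k :: int^'n. True}"

text \<open>Closed and centred at the lattice point: closedness makes it a \<open>cbox\<close>, and
  the symmetry about \<open>z\<close> is what the reflection argument exploits. Distinct lattice
  cells overlap only in null sets.\<close>

definition cell :: "real \<Rightarrow> real^'n \<Rightarrow> (real^'n) set" where
  "cell h z = cbox (z - (\<chi> i. h/2)) (z + (\<chi> i. h/2))"

lemma mem_cell: "y \<in> cell h z \<longleftrightarrow> (\<forall>i. \<bar>y $ i - z $ i\<bar> \<le> h/2)"
proof -
  have "z $ i - h/2 \<le> y $ i \<and> y $ i \<le> z $ i + h/2 \<longleftrightarrow> \<bar>y $ i - z $ i\<bar> \<le> h/2" for i by linarith
  then show ?thesis by (simp add: cell_def mem_box_cart)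
qed

lemma centre_mem_cell: "0 < h \<Longrightarrow> z \<in> cell h z"
  by (simp add: mem_cell)

lemma content_cell:
  assumes "0 < h" shows "measure lborel (cell h (z::real^'n)) = h ^ CARD('n)"
proof -
  have "cell h z \<noteq> {}" using centre_mem_cell[OF assms] by blast
  then show ?thesis
    unfolding cell_def by (subst content_cbox_cart) (auto simp: prod_constant)
qed

text \<open>Summing coordinates instead of squares loses only a dimensional factor; the radius
  \<open>CARD('n) * h / 2\<close> found here returns as \<open>a h\<close> in the Riemann sum
  error.\<close>

lemma cell_dist:
  fixes y z :: "real^'n"
  assumes "y \<in> cell h z" shows "norm (y - z) \<le> real CARD('n) * h / 2"
proof -
  have "norm (y - z) \<le> (\<Sum>i\<in>UNIV. \<bar>(y - z) $ i\<bar>)" by (rule norm_le_l1_cart)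
  also have "\<dots> \<le> (\<Sum>i\<in>(UNIV::'n set). h/2)"
    using assms by (intro sum_mono) (auto simp: mem_cell)
  finally show ?thesis by simp
qed

lemma cells_cover:
  fixes y :: "real^'n"
  assumes "0 < h" obtains z where "z \<in> lattice h" "y \<in> cell h z"
proof
  let ?k = "(\<chi> i. round (y $ i / h)) :: int^'n"
  show "(\<chi> i. of_int (?k $ i) * h) \<in> lattice h" unfolding lattice_def by blast
  have "\<bar>y $ i - of_int (round (y $ i / h)) * h\<bar> \<le> h/2" for i
  proof -
    have "\<bar>y $ i - of_int (round (y $ i / h)) * h\<bar> = h * \<bar>of_int (round (y $ i / h)) - y $ i / h\<bar>"
      using assms by (simp add: abs_mult[symmetric] abs_mult_pos field_simps abs_minus_commute)
    also have "\<dots> \<le> h * (1/2)" using assms by (intro mult_left_mono of_int_round_abs_le) auto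
    finally show ?thesis by simp
  qed
  then show "y \<in> cell h (\<chi> i. of_int (?k $ i) * h)" by (simp add: mem_cell)
qed

lemma lattice_diff_coord:
  assumes "0 < h" "z \<in> lattice h" "z' \<in> lattice h" "z \<noteq> z'"
  obtains i where "h \<le> \<bar>z $ i - z' $ i\<bar>"
proof -
  obtain k k' where k: "z = (\<chi> i. of_int (k $ i) * h)" "z' = (\<chi> i. of_int (k' $ i) * h)"
    using assms by (auto simp: lattice_def)
  with assms(4) obtain i where "k $ i \<noteq> k' $ i" by (auto simp: vec_eq_iff)
  then have "1 \<le> \<bar>of_int (k $ i - k' $ i) :: real\<bar>" by linarith
  then have "1 * h \<le> \<bar>of_int (k $ i - k' $ i) :: real\<bar> * h" using assms by (intro mult_right_mono) auto
  also have "\<dots> = \<bar>z $ i - z' $ i\<bar>" using assms by (simp add: k abs_mult left_diff_distrib[symmetric])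
  finally show thesis using that by simp
qed

lemma zero_mem_lattice: "0 \<in> lattice h"
  by (auto simp: lattice_def vec_eq_iff intro!: exI[of _ 0])

lemma lattice_diff: "z \<in> lattice h \<Longrightarrow> z' \<in> lattice h \<Longrightarrow> z - z' \<in> lattice h"
  unfolding lattice_def
proof clarify
  fix k k' :: "int^'n"
  show "\<exists>l. (\<chi> i. of_int (k $ i) * h) - (\<chi> i. of_int (k' $ i) * h) = (\<chi> i. of_int (l $ i) * h) \<and> True"
    by (intro exI[of _ "k - k'"]) (simp add: vec_eq_iff left_diff_distrib)
qed

lemma lattice_add: "z \<in> lattice h \<Longrightarrow> z' \<in> lattice h \<Longrightarrow> z + z' \<in> lattice h"
  using lattice_diff[of z h "0 - z'"] lattice_diff[OF zero_mem_lattice, of z' h] by simp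

text \<open>Some coordinate of a nonzero lattice point has size at least \<open>h\<close>, and the
  cell moves it by at most \<open>h / 2\<close>. So off the central cell the norm is comparable to
  its value at the centre, with constants depending on the dimension alone.\<close>

lemma lattice_nonzero_cell:
  fixes y z :: "real^'n"
  assumes h: "0 < h" and z: "z \<in> lattice h" "z \<noteq> 0" and y: "y \<in> cell h z"
  shows "h / 2 \<le> norm y" "norm y \<le> (1 + real CARD('n)) * norm z" "norm z \<le> (1 + real CARD('n)) * norm y"
proof -
  obtain i where i: "h \<le> \<bar>z $ i - 0 $ i\<bar>"
    using lattice_diff_coord[OF h z(1) zero_mem_lattice z(2)] by blast
  have zh: "h \<le> norm z" using i component_le_norm_cart[of z i] by simp
  have "\<bar>y $ i - z $ i\<bar> \<le> h/2" using y by (simp add: mem_cell)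
  then have "h/2 \<le> \<bar>y $ i\<bar>" using i unfolding zero_index by linarith
  then show yh: "h / 2 \<le> norm y" using component_le_norm_cart[of y i] by simp
  have d: "norm (y - z) \<le> real CARD('n) * h / 2" by (rule cell_dist[OF y])
  have "norm y \<le> norm z + norm (y - z)" by (rule norm_triangle_sub)
  also have "\<dots> \<le> norm z + real CARD('n) * norm z"
    using d zh mult_left_mono[OF zh, of "real CARD('n)"] mult_nonneg_nonneg[of "real CARD('n)" h] h by linarith
  finally show "norm y \<le> (1 + real CARD('n)) * norm z" by (simp add: algebra_simps)
  have "norm z \<le> norm y + norm (y - z)" using norm_triangle_sub[of z y] by (simp add: norm_minus_commute)
  also have "\<dots> \<le> norm y + real CARD('n) * norm y"
    using d mult_left_mono[OF yh, of "real CARD('n)"] by linarith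
  finally show "norm z \<le> (1 + real CARD('n)) * norm y" by (simp add: algebra_simps)
qed

text \<open>The centres differ by at least \<open>h\<close> in some coordinate, so a common point
  must have the midpoint value there and lies in a hyperplane.\<close>

lemma cells_negligible:
  fixes z z' :: "real^'n"
  assumes h: "0 < h" and z: "z \<in> lattice h" "z' \<in> lattice h" "z \<noteq> z'"
  shows "negligible (cell h z \<inter> cell h z')"
proof -
  obtain i where i: "h \<le> \<bar>z $ i - z' $ i\<bar>" using lattice_diff_coord[OF h z] by blast
  have "cell h z \<inter> cell h z' \<subseteq> {y. y $ i = (z $ i + z' $ i) / 2}"
  proof
    fix y assume "y \<in> cell h z \<inter> cell h z'"
    then have "\<bar>y $ i - z $ i\<bar> \<le> h/2" "\<bar>y $ i - z' $ i\<bar> \<le> h/2" by (auto simp: mem_cell)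
    then show "y \<in> {y. y $ i = (z $ i + z' $ i) / 2}" using i by (simp add: abs_if split: if_splits)
  qed
  moreover have "negligible {y::real^'n. y $ i = (z $ i + z' $ i) / 2}"
    using negligible_standard_hyperplane[of "axis i (1::real)" "(z $ i + z' $ i) / 2"] by (simp add: inner_axis)
  ultimately show ?thesis using negligible_subset by blast
qed

lemma finite_lattice_bounded:
  fixes S :: "(real^'n) set"
  assumes h: "0 < h" and S: "bounded S" shows "finite (lattice h \<inter> S)"
proof -
  obtain R where R: "\<And>x. x \<in> S \<Longrightarrow> norm x \<le> R" using S by (auto simp: bounded_iff)
  define M where "M = \<lceil>R / h\<rceil>"
  have "lattice h \<inter> S \<subseteq> (\<lambda>k. \<chi> i. of_int (k i) * h) ` PiE UNIV (\<lambda>_. {-M..M})"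
  proof
    fix z assume z: "z \<in> lattice h \<inter> S"
    then obtain k where k: "z = (\<chi> i. of_int (k $ i) * h)" by (auto simp: lattice_def)
    have "k $ i \<in> {-M..M}" for i
    proof -
      have "\<bar>of_int (k $ i)\<bar> * h = \<bar>z $ i\<bar>" using h by (simp add: k abs_mult)
      also have "\<dots> \<le> R" using component_le_norm_cart[of z i] R z by force
      finally have "\<bar>of_int (k $ i)\<bar> \<le> R / h" using h by (simp add: field_simps)
      also have "\<dots> \<le> of_int M" by (simp add: M_def)
      finally show ?thesis by (simp add: abs_le_iff)
    qed
    then show "z \<in> (\<lambda>k. \<chi> i. of_int (k i) * h) ` PiE UNIV (\<lambda>_. {-M..M})"
      by (intro image_eqI[of _ _ "($) k"]) (auto simp: k)
  qed
  moreover have "finite ((\<lambda>k. (\<chi> i. of_int (k i) * h) :: real^'n) ` PiE UNIV (\<lambda>_. {-M..M}))"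
    by (intro finite_imageI finite_PiE) auto
  ultimately show ?thesis using finite_subset by blast
qed

text \<open>
  Symmetrizing over the cell replaces first by second differences. For a constant integrand against
  the kernel this is what avoids a logarithm when \<open>d - s = 1\<close>.
\<close>

lemma cell_integral_reflect:
  fixes f :: "real^'n \<Rightarrow> real"
  assumes h: "0 < h" and f: "continuous_on (cell h z) f"
    and bd: "\<And>t. z + t \<in> cell h z \<Longrightarrow> \<bar>f (z + t) + f (z - t) - 2 * f z\<bar> \<le> M"
  shows "\<bar>integral (cell h z) f - h ^ CARD('n) * f z\<bar> \<le> M * h ^ CARD('n)"
proof -
  define v :: "real^'n" where "v = (\<chi> i. h/2)"
  have c: "cell h z = cbox (z - v) (z + v)" by (simp add: cell_def v_def)
  have c0: "z + t \<in> cell h z \<longleftrightarrow> t \<in> cbox (-v) v" for t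
  proof -
    have "- (h/2) \<le> t $ i \<and> t $ i \<le> h/2 \<longleftrightarrow> \<bar>t $ i\<bar> \<le> h/2" for i by linarith
    then show ?thesis by (simp add: mem_cell v_def mem_box_cart)
  qed
  obtain I where I: "(f has_integral I) (cbox (z - v) (z + v))"
    using integrable_continuous[of "z - v" "z + v" f] f unfolding c by blast
  have 1: "((\<lambda>t. f (t + z)) has_integral I) (cbox (-v) v)"
    using has_integral_shift_cbox[OF I, of z] by simp
  have 2: "((\<lambda>t. f (- t + z)) has_integral I) (cbox (-v) v)"
    using has_integral_reflect_lemma[OF 1] by simp
  have vol: "measure lborel (cbox (-v) v) = h ^ CARD('n)"
    using content_cell[OF h, of 0] by (simp add: cell_def v_def)
  have 3: "((\<lambda>t. 2 * f z) has_integral h ^ CARD('n) * (2 * f z)) (cbox (-v) v)"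
    using has_integral_const[of "2 * f z" "-v" v] by (simp add: vol)
  \<comment> \<open>Adding the two substitutions doubles the error and turns it into the integral of
    the second difference; the resulting factor 1/2 is not kept.\<close>
  have 4: "((\<lambda>t. f (t + z) + f (- t + z) - 2 * f z) has_integral (I + I - h ^ CARD('n) * (2 * f z))) (cbox (-v) v)"
    by (intro has_integral_diff has_integral_add 1 2 3)
  have M: "0 \<le> M" using bd[of 0] centre_mem_cell[OF h, of z] by auto
  have "norm (I + I - h ^ CARD('n) * (2 * f z)) \<le> M * measure lborel (cbox (-v) v)"
  proof (rule has_integral_bound[OF M 4])
    fix t assume "t \<in> cbox (-v) v"
    then show "norm (f (t + z) + f (- t + z) - 2 * f z) \<le> M"
      using bd[of t] c0[of t] by (simp add: add.commute)
  qed
  moreover have "integral (cell h z) f = I" unfolding c using I by (rule integral_unique)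
  ultimately show ?thesis using M h by (simp add: vol abs_if algebra_simps split: if_splits)
qed

lemma cell_integral_bound:
  fixes f :: "real^'n \<Rightarrow> real"
  assumes h: "0 < h" and f: "continuous_on (cell h z) f"
    and bd: "\<And>y. y \<in> cell h z \<Longrightarrow> \<bar>f y - f z\<bar> \<le> M"
  shows "\<bar>integral (cell h z) f - h ^ CARD('n) * f z\<bar> \<le> M * h ^ CARD('n)"
proof -
  obtain I where I: "(f has_integral I) (cell h z)"
    using integrable_continuous[of "z - (\<chi> i. h/2)" "z + (\<chi> i. h/2)" f] f unfolding cell_def by blast
  have 3: "((\<lambda>t. f z) has_integral h ^ CARD('n) * f z) (cell h z)"
    using has_integral_const[of "f z" "z - (\<chi> i. h/2)" "z + (\<chi> i. h/2)"]
      content_cell[OF h, of z] by (simp add: cell_def)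
  have M: "0 \<le> M" using bd[OF centre_mem_cell[OF h, of z]] by auto
  have "norm (I - h ^ CARD('n) * f z) \<le> M * measure lborel (cell h z)"
    using has_integral_bound[OF M has_integral_diff[OF I 3, unfolded cell_def]] bd
    by (auto simp: cell_def)
  then show ?thesis using integral_unique[OF I] by (simp add: content_cell[OF h])
qed

section \<open>Error on one cell for the kernel alone and for the kernel times a Lipschitz
  factor\<close>

lemma square_powr:
  fixes w a :: real
  assumes "0 \<le> w" shows "(w\<^sup>2) powr a = w powr (2 * a)"
proof (cases "w = 0")
  case False
  with assms have "w\<^sup>2 = w powr 2" by simp
  then show ?thesis by (simp only: powr_powr)
qed simp

text \<open>The squared norms of \<open>z + t\<close> and \<open>z - t\<close> are
  \<open>x + u\<close> and \<open>x - u\<close>, where \<open>x\<close> is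
  \<open>|z|^2 + |t|^2\<close> and \<open>u\<close> is twice the inner product, so the scalar second
  difference applies at \<open>x\<close> with exponent \<open>s / 2\<close>. Going from
  \<open>x\<close> back to \<open>|z|^2\<close> is a first order change, but in a quantity that
  moves only by \<open>|t|^2\<close>.\<close>

lemma norm_powr_second_diff:
  fixes z t :: "'a::real_inner"
  assumes s: "0 \<le> s" and z: "z \<noteq> 0" and c: "0 < c"
    and p: "norm z \<le> c * norm (z + t)" "norm z \<le> c * norm (z - t)"
  shows "\<bar>norm (z + t) powr -s + norm (z - t) powr -s - 2 * norm z powr -s\<bar>
      \<le> (2 * s * (s+2) * c powr (s+4) + s) * norm z powr (-s-2) * (norm t)\<^sup>2"
proof -
  define q where "q = s / 2"
  define m where "m = (norm z / c)\<^sup>2"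
  define x where "x = (norm z)\<^sup>2 + (norm t)\<^sup>2"
  define u where "u = 2 * (z \<bullet> t)"
  have q: "0 \<le> q" "s = 2 * q" using s by (auto simp: q_def)
  have nz: "0 < norm z" using z by simp
  have m: "0 < m" using z c by (simp add: m_def)
  have sq: "w powr -s = (w\<^sup>2) powr -q" if "0 \<le> w" for w
    using square_powr[OF that, of "-q"] by (simp add: q(2))
  have plus: "(norm (z + t))\<^sup>2 = x + u" and minus: "(norm (z - t))\<^sup>2 = x - u"
    by (auto simp: x_def u_def power2_norm_eq_inner algebra_simps inner_commute)
  have "norm z / c \<le> norm (z + t)" "norm z / c \<le> norm (z - t)"
    using p c by (auto simp: field_simps)
  then have mu: "m \<le> x + u" "m \<le> x - u"
    unfolding plus[symmetric] minus[symmetric] m_def using c by (auto intro!: power_mono)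
  have abs_u: "m \<le> x - \<bar>u\<bar>" using mu by (simp add: abs_if)
  \<comment> \<open>The sum is symmetric in the sign of \<open>u\<close>, which may therefore be
    replaced by its absolute value to get a nonnegative step.\<close>
  have "\<bar>norm (z + t) powr -s + norm (z - t) powr -s - 2 * x powr -q\<bar>
      = \<bar>(x + \<bar>u\<bar>) powr -q + (x - \<bar>u\<bar>) powr -q - 2 * x powr -q\<bar>"
    by (simp add: sq plus minus abs_if)
  also have "\<dots> \<le> 2 * q * (q+1) * m powr (-q-2) * \<bar>u\<bar>\<^sup>2"
    by (rule powr_neg_second_diff_le) (use q m abs_u in auto)
  also have "\<dots> \<le> 2 * q * (q+1) * m powr (-q-2) * (2 * (norm z * norm t))\<^sup>2"
  proof (intro mult_left_mono power_mono)
    show "\<bar>u\<bar> \<le> 2 * (norm z * norm t)" using Cauchy_Schwarz_ineq2[of z t] by (simp add: u_def abs_mult)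
  qed (use q in auto)
  finally have A: "\<bar>norm (z + t) powr -s + norm (z - t) powr -s - 2 * x powr -q\<bar>
    \<le> 2 * q * (q+1) * m powr (-q-2) * (2 * (norm z * norm t))\<^sup>2" .
  have "\<bar>x powr -q - ((norm z)\<^sup>2) powr -q\<bar> \<le> q * ((norm z)\<^sup>2) powr (-q-1) * \<bar>x - (norm z)\<^sup>2\<bar>"
    by (rule powr_neg_diff_le) (use q nz in \<open>auto simp: x_def\<close>)
  then have B: "\<bar>x powr -q - norm z powr -s\<bar> \<le> q * ((norm z)\<^sup>2) powr (-q-1) * (norm t)\<^sup>2"
    by (simp add: sq x_def)
  have e1: "m powr (-q-2) = norm z powr (-s-4) * c powr (s+4)"
  proof -
    have "m powr (-q-2) = (norm z / c) powr (2 * (-q-2))"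
      using nz c unfolding m_def by (intro square_powr) auto
    also have "\<dots> = norm z powr (-s-4) / c powr (-s-4)"
      using nz c by (simp add: q(2) powr_divide)
    also have "\<dots> = norm z powr (-s-4) * c powr (s+4)"
      using c by (simp add: divide_powr_uminus add.commute)
    finally show ?thesis .
  qed
  have e2: "norm z powr (-s-4) * (norm z)\<^sup>2 = norm z powr (-s-2)"
  proof -
    have "norm z powr (-s-4) * (norm z)\<^sup>2 = norm z powr (-s-4) * norm z powr 2"
      using nz by simp
    also have "\<dots> = norm z powr (-s-4 + 2)" by (rule powr_add[symmetric])
    also have "-s-4 + 2 = -s-2" by simp
    finally show ?thesis .
  qed
  have e3: "((norm z)\<^sup>2) powr (-q-1) = norm z powr (-s-2)"
    using square_powr[of "norm z" "-q-1"] by (simp add: q(2))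
  have eq: "2 * q * (q+1) * m powr (-q-2) * (2 * (norm z * norm t))\<^sup>2
      = 8 * q * (q+1) * c powr (s+4) * (norm z powr (-s-4) * (norm z)\<^sup>2) * (norm t)\<^sup>2"
    unfolding e1 by (simp add: power_mult_distrib mult_ac)
  have eq': "8 * q * (q+1) * c powr (s+4) * (norm z powr (-s-4) * (norm z)\<^sup>2) * (norm t)\<^sup>2
      = 2 * s * (s+2) * c powr (s+4) * norm z powr (-s-2) * (norm t)\<^sup>2"
    unfolding e2 using q(2) by (simp add: algebra_simps)
  have A': "\<bar>norm (z + t) powr -s + norm (z - t) powr -s - 2 * x powr -q\<bar>
    \<le> 2 * s * (s+2) * c powr (s+4) * norm z powr (-s-2) * (norm t)\<^sup>2"
    using A unfolding eq eq' .
  have cs: "2 * (q * ((norm z)\<^sup>2) powr (-q-1) * (norm t)\<^sup>2) = s * norm z powr (-s-2) * (norm t)\<^sup>2"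
    unfolding e3 using q(2) by simp
  have tri: "\<bar>v - 2 * w\<bar> \<le> \<bar>v - 2 * u\<bar> + 2 * \<bar>u - w\<bar>" for u v w :: real
  proof -
    have "\<bar>v - 2 * w\<bar> = \<bar>(v - 2 * u) + 2 * (u - w)\<bar>" by simp
    also have "\<dots> \<le> \<bar>v - 2 * u\<bar> + \<bar>2 * (u - w)\<bar>" by (rule abs_triangle_ineq)
    finally show ?thesis by (simp only: abs_mult abs_numeral)
  qed
  have "\<bar>norm (z + t) powr -s + norm (z - t) powr -s - 2 * norm z powr -s\<bar>
      \<le> \<bar>norm (z + t) powr -s + norm (z - t) powr -s - 2 * x powr -q\<bar> + 2 * \<bar>x powr -q - norm z powr -s\<bar>"
    by (rule tri)
  also have "\<dots> \<le> 2 * s * (s+2) * c powr (s+4) * norm z powr (-s-2) * (norm t)\<^sup>2 + s * norm z powr (-s-2) * (norm t)\<^sup>2"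
    using add_mono[OF A' mult_left_mono[where c=2, OF B zero_le_numeral]] unfolding cs .
  finally show ?thesis by (simp add: algebra_simps)
qed

lemma powr_neg_scale_le:
  fixes x y c p :: real
  assumes "0 \<le> p" "0 < c" "0 < x" "x \<le> c * y"
  shows "y powr -p \<le> c powr p * x powr -p"
proof -
  have "y powr -p \<le> (x / c) powr -p"
    using assms by (intro powr_mono2') (auto simp: field_simps)
  also have "\<dots> = x powr -p * c powr p"
    using assms by (simp add: powr_divide powr_minus_divide)
  finally show ?thesis by (simp add: mult.commute)
qed

lemma lattice_cell_continuous_powr:
  assumes "0 < h" "z \<in> lattice h" "z \<noteq> 0"
  shows "continuous_on (cell h z) (\<lambda>y::real^'n. norm y powr p)"
proof -
  have "y \<noteq> 0" if "y \<in> cell h z" for y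
    using lattice_nonzero_cell(1)[OF assms that] assms(1) by auto
  then show ?thesis by (intro continuous_intros) auto
qed

lemma cell_powr_integral_error:
  assumes s: "0 \<le> s"
  obtains C where "0 \<le> C" "\<And>h z. 0 < h \<Longrightarrow> z \<in> lattice h \<Longrightarrow> z \<noteq> 0 \<Longrightarrow>
    \<bar>integral (cell h z) (\<lambda>y::real^'n. norm y powr -s) - h ^ CARD('n) * norm z powr -s\<bar>
      \<le> C * h\<^sup>2 * norm z powr (-s-2) * h ^ CARD('n)"
proof -
  define d where "d = real CARD('n)"
  define C where "C = (2 * s * (s+2) * (1+d) powr (s+4) + s)"
  have C: "0 \<le> C" using s by (simp add: C_def d_def)
  show thesis
  proof (rule that)
    show "0 \<le> C * (d/2)\<^sup>2" using C by simp
    fix h :: real and z :: "real^'n" assume h: "0 < h" and z: "z \<in> lattice h" "z \<noteq> 0"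
    show "\<bar>integral (cell h z) (\<lambda>y. norm y powr -s) - h ^ CARD('n) * norm z powr -s\<bar>
      \<le> C * (d/2)\<^sup>2 * h\<^sup>2 * norm z powr (-s-2) * h ^ CARD('n)"
    proof (rule cell_integral_reflect[OF h lattice_cell_continuous_powr[OF h z]])
      fix t assume t: "z + t \<in> cell h z"
      then have t': "z - t \<in> cell h z" by (simp add: mem_cell)
      have "\<bar>norm (z + t) powr -s + norm (z - t) powr -s - 2 * norm z powr -s\<bar>
          \<le> C * norm z powr (-s-2) * (norm t)\<^sup>2"
        unfolding C_def
        by (rule norm_powr_second_diff[OF s z(2)])
           (use lattice_nonzero_cell(3)[OF h z t] lattice_nonzero_cell(3)[OF h z t'] in \<open>auto simp: d_def\<close>)
      also have "norm t \<le> d * h / 2" using cell_dist[OF t] by (simp add: d_def)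
      then have "(norm t)\<^sup>2 \<le> (d * h / 2)\<^sup>2" by (intro power_mono) auto
      then have "C * norm z powr (-s-2) * (norm t)\<^sup>2 \<le> C * norm z powr (-s-2) * (d * h / 2)\<^sup>2"
        using C by (intro mult_left_mono) auto
      also have "\<dots> = C * (d/2)\<^sup>2 * h\<^sup>2 * norm z powr (-s-2)"
        by (simp add: power_mult_distrib power_divide)
      finally show "\<bar>norm (z + t) powr -s + norm (z - t) powr -s - 2 * norm z powr -s\<bar>
          \<le> C * (d/2)\<^sup>2 * h\<^sup>2 * norm z powr (-s-2)" by simp
    qed
  qed
qed

text \<open>The gradient of the kernel is of order \<open>norm z powr (-s-1)\<close>. Since
  \<open>F\<close> is at most \<open>N * norm y\<close>, the excess power cancels and the error
  keeps the weight \<open>norm z powr -s\<close>, which is integrable when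
  \<open>s < d\<close>.\<close>

lemma cell_powr_lipschitz_integral_error:
  assumes s: "0 \<le> s"
  obtains C where "0 \<le> C" "\<And>h z N F. 0 < h \<Longrightarrow> z \<in> lattice h \<Longrightarrow> z \<noteq> 0 \<Longrightarrow> 0 \<le> N \<Longrightarrow>
    (\<And>y. y \<in> cell h z \<Longrightarrow> \<bar>F y\<bar> \<le> N * norm y) \<Longrightarrow>
    (\<And>y y'. y \<in> cell h z \<Longrightarrow> y' \<in> cell h z \<Longrightarrow> \<bar>F y - F y'\<bar> \<le> N * norm (y - y')) \<Longrightarrow>
    \<bar>integral (cell h z) (\<lambda>y::real^'n. norm y powr -s * F y) - h ^ CARD('n) * (norm z powr -s * F z)\<bar>
      \<le> C * N * h * norm z powr -s * h ^ CARD('n)"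
proof -
  define d where "d = real CARD('n)"
  have d: "0 \<le> d" by (simp add: d_def)
  define C where "C = (1+d) powr s * d + s * (1+d) powr (s+1) * d"
  have C: "0 \<le> C" using s d by (simp add: C_def)
  show thesis
  proof (rule that[OF C])
    fix h N :: real and z :: "real^'n" and F assume h: "0 < h" and z: "z \<in> lattice h" "z \<noteq> 0" and N: "0 \<le> N"
     and F1: "\<And>y. y \<in> cell h z \<Longrightarrow> \<bar>F y\<bar> \<le> N * norm y"
     and F2: "\<And>y y'. y \<in> cell h z \<Longrightarrow> y' \<in> cell h z \<Longrightarrow> \<bar>F y - F y'\<bar> \<le> N * norm (y - y')"
    have "N-lipschitz_on (cell h z) F"
      using F2 N by (intro lipschitz_onI) (auto simp: dist_norm)
    then have contF: "continuous_on (cell h z) F" by (rule lipschitz_on_continuous_on)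
    have zc: "z \<in> cell h z" by (rule centre_mem_cell[OF h])
    show "\<bar>integral (cell h z) (\<lambda>y. norm y powr -s * F y) - h ^ CARD('n) * (norm z powr -s * F z)\<bar>
      \<le> C * N * h * norm z powr -s * h ^ CARD('n)"
    proof (rule cell_integral_bound[OF h])
      show "continuous_on (cell h z) (\<lambda>y. norm y powr -s * F y)"
        by (intro continuous_on_mult lattice_cell_continuous_powr[OF h z] contF)
      fix y assume y: "y \<in> cell h z"
      have dist: "norm (y - z) \<le> d * h" using cell_dist[OF y] mult_nonneg_nonneg[OF d, of h] h unfolding d_def by linarith
      have nz: "0 < norm z" using z by simp
      have zy: "norm z \<le> (1 + d) * norm y" using lattice_nonzero_cell(3)[OF h z y] by (simp add: d_def)
      have Ky: "norm y powr -s \<le> (1+d) powr s * norm z powr -s"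
        by (rule powr_neg_scale_le) (use s d nz zy in auto)
      have m: "norm z / (1+d) \<le> norm y" "norm z / (1+d) \<le> norm z" "0 < norm z / (1+d)"
        using zy d nz by (auto simp: field_simps mult_nonneg_nonneg)
      have "\<bar>norm y powr -s - norm z powr -s\<bar> \<le> s * (norm z / (1+d)) powr (-s-1) * \<bar>norm y - norm z\<bar>"
        by (rule powr_neg_diff_le) (use m s in auto)
      also have "(norm z / (1+d)) powr (-s-1) = norm z powr (-s-1) * (1+d) powr (s+1)"
        using nz d by (simp add: powr_divide divide_powr_uminus add.commute)
      also have "s * (norm z powr (-s-1) * (1+d) powr (s+1)) * \<bar>norm y - norm z\<bar>
           \<le> s * (norm z powr (-s-1) * (1+d) powr (s+1)) * (d * h)"
        using s d dist norm_triangle_ineq3[of y z] by (intro mult_left_mono) auto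
      finally have Kd: "\<bar>norm y powr -s - norm z powr -s\<bar> \<le> s * (1+d) powr (s+1) * (d * h) * norm z powr (-s-1)"
        by (simp add: mult_ac)
      have zz: "norm z powr (-s-1) * norm z = norm z powr -s"
        using nz powr_add[of "norm z" "-s-1" 1] by simp
      have "\<bar>norm y powr -s * F y - norm z powr -s * F z\<bar>
        = \<bar>norm y powr -s * (F y - F z) + (norm y powr -s - norm z powr -s) * F z\<bar>"
        by (simp add: algebra_simps)
      also have "\<dots> \<le> norm y powr -s * \<bar>F y - F z\<bar> + \<bar>norm y powr -s - norm z powr -s\<bar> * \<bar>F z\<bar>"
        by (rule order_trans[OF abs_triangle_ineq]) (simp add: abs_mult)
      also have "\<dots> \<le> ((1+d) powr s * norm z powr -s) * (N * (d * h)) +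
           (s * (1+d) powr (s+1) * (d * h) * norm z powr (-s-1)) * (N * norm z)"
      proof (intro add_mono mult_mono Ky Kd F1[OF zc])
        show "\<bar>F y - F z\<bar> \<le> N * (d * h)"
          using F2[OF y zc] mult_left_mono[OF dist N] by linarith
      qed (use s d h in auto)
      also have "\<dots> = (1+d) powr s * d * N * h * norm z powr -s +
           s * (1+d) powr (s+1) * d * N * h * (norm z powr (-s-1) * norm z)"
        by (simp add: mult_ac)
      also have "\<dots> = C * N * h * norm z powr -s"
        unfolding zz C_def by (simp add: algebra_simps)
      finally show "\<bar>norm y powr -s * F y - norm z powr -s * F z\<bar> \<le> C * N * h * norm z powr -s" .
    qed
  qed
qed

section \<open>Comparison of sums over cells with integrals\<close>

lemma cells_has_integral:
  fixes f :: "real^'n \<Rightarrow> real"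
  assumes h: "0 < h" and I: "finite I" "I \<subseteq> lattice h"
    and f: "\<And>z. z \<in> I \<Longrightarrow> f integrable_on cell h z"
  shows "(f has_integral (\<Sum>z\<in>I. integral (cell h z) f)) (\<Union>z\<in>I. cell h z)"
proof (rule has_integral_UN[OF I(1)])
  show "pairwise (\<lambda>i i'. negligible (cell h i \<inter> cell h i')) I"
    using I(2) by (auto intro!: pairwiseI cells_negligible[OF h])
qed (use f in \<open>auto intro: integrable_integral\<close>)

lemma cells_sum_le_integral:
  fixes g :: "real^'n \<Rightarrow> real"
  assumes h: "0 < h" and I: "finite I" "I \<subseteq> lattice h" and S: "\<And>z. z \<in> I \<Longrightarrow> cell h z \<subseteq> S"
    and g: "g integrable_on S" "\<And>y. y \<in> S \<Longrightarrow> 0 \<le> g y"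
    and c: "\<And>z y. z \<in> I \<Longrightarrow> y \<in> cell h z \<Longrightarrow> c z \<le> g y"
  shows "(\<Sum>z\<in>I. h ^ CARD('n) * c z) \<le> integral S g"
proof -
  have ac: "g absolutely_integrable_on S" using g by (rule nonnegative_absolutely_integrable_1)
  have gi: "g integrable_on cell h z" if "z \<in> I" for z
  proof -
    have "g absolutely_integrable_on cell h z"
      using set_integrable_subset[OF ac] S[OF that] by (simp add: cell_def)
    then show ?thesis by (rule set_lebesgue_integral_eq_integral(1))
  qed
  have "(\<Sum>z\<in>I. h ^ CARD('n) * c z) \<le> (\<Sum>z\<in>I. integral (cell h z) g)"
  proof (rule sum_mono)
    fix z assume z: "z \<in> I"
    have "((\<lambda>t. c z) has_integral h ^ CARD('n) * c z) (cell h z)"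
      using has_integral_const[of "c z" "z - (\<chi> i. h/2)" "z + (\<chi> i. h/2)"]
        content_cell[OF h, of z] by (simp add: cell_def)
    then show "h ^ CARD('n) * c z \<le> integral (cell h z) g"
      using integrable_integral[OF gi[OF z]] c[OF z] by (rule has_integral_le)
  qed
  also have "\<dots> = integral (\<Union>z\<in>I. cell h z) g"
    using cells_has_integral[OF h I gi] by (simp add: integral_unique)
  also have "\<dots> \<le> integral S g"
    using cells_has_integral[OF h I gi] g S by (intro integral_subset_le) auto
  finally show ?thesis .
qed

section \<open>The error of the Riemann sum\<close>

text \<open>The difference of the two \<open>d\<close>-th powers factors as \<open>3 * a\<close>
  times a sum of \<open>d\<close> products, each at most \<open>(2 * \<delta>) ^ (d - 1)\<close>.
  The shell is asymmetric because uncovered points lie up to \<open>2 * a\<close> inside the sphere,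
  while cells of nodes in the ball reach at most \<open>a\<close> outside it.\<close>

lemma measure_shell_le:
  fixes \<delta> a :: real
  assumes a: "0 < a" "2 * a \<le> \<delta>"
  shows "measure lebesgue (ball (0::real^'n) (\<delta> + a) - ball 0 (\<delta> - 2 * a))
    \<le> 3 * unit_ball_vol (real CARD('n)) * real CARD('n) * (2 * \<delta>) ^ (CARD('n) - 1) * a"
proof -
  define V where "V = unit_ball_vol (real CARD('n))"
  have V: "0 \<le> V" by (simp add: V_def)
  obtain m where m: "CARD('n) = Suc m" by (metis zero_less_card_finite gr0_implies_Suc)
  have le: "(\<Sum>i<Suc m. (\<delta> + a) ^ i * (\<delta> - 2 * a) ^ (m - i)) \<le> (\<Sum>i<Suc m. (2 * \<delta>) ^ m)"
  proof (rule sum_mono)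
    fix i assume i: "i \<in> {..<Suc m}"
    have "(\<delta> + a) ^ i * (\<delta> - 2 * a) ^ (m - i) \<le> (2 * \<delta>) ^ i * (2 * \<delta>) ^ (m - i)"
      using a by (intro mult_mono power_mono) auto
    also have "\<dots> = (2 * \<delta>) ^ m" using i by (subst power_add[symmetric]) simp
    finally show "(\<delta> + a) ^ i * (\<delta> - 2 * a) ^ (m - i) \<le> (2 * \<delta>) ^ m" .
  qed
  have "measure lebesgue (ball (0::real^'n) (\<delta> + a) - ball 0 (\<delta> - 2 * a))
     = measure lebesgue (ball (0::real^'n) (\<delta> + a)) - measure lebesgue (ball (0::real^'n) (\<delta> - 2 * a))"
    using a by (intro measurable_measure_Diff) auto
  also have "\<dots> = V * ((\<delta> + a) ^ CARD('n) - (\<delta> - 2 * a) ^ CARD('n))"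
    using a by (simp add: measure_completion content_ball V_def algebra_simps)
  also have "(\<delta> + a) ^ CARD('n) - (\<delta> - 2 * a) ^ CARD('n)
      = 3 * a * (\<Sum>i<Suc m. (\<delta> + a) ^ i * (\<delta> - 2 * a) ^ (m - i))"
    unfolding m by (subst power_diff_sumr2) (auto simp: mult.commute)
  also have "V * (3 * a * (\<Sum>i<Suc m. (\<delta> + a) ^ i * (\<delta> - 2 * a) ^ (m - i)))
      \<le> V * (3 * a * (\<Sum>i<Suc m. (2 * \<delta>) ^ m))"
    using V a by (intro mult_left_mono le) auto
  also have "\<dots> = 3 * V * real CARD('n) * (2 * \<delta>) ^ (CARD('n) - 1) * a"
    by (simp add: m)
  finally show ?thesis unfolding V_def .
qed

text \<open>Nodes at depth more than \<open>a h\<close> own cells inside the ball, and these carry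
  the main sum. What they leave uncovered lies near the origin or in a thin shell, where the bound
  by the kernel is enough. The cells of the remaining nodes lie in the same shell, which is thus
  charged twice; hence the factor 2.\<close>

lemma riemann_error_decomposition:
  fixes f :: "real^'n \<Rightarrow> real"
  defines "a h \<equiv> real CARD('n) * h / 2"
  assumes h: "0 < h" and ah: "4 * a h \<le> \<delta>" and s: "0 \<le> s" "s < real CARD('n)"
    and f: "f absolutely_integrable_on ball 0 \<delta>"
    and N: "0 \<le> N" "\<And>y. y \<in> ball 0 \<delta> \<Longrightarrow> \<bar>f y\<bar> \<le> N * norm y powr -s"
  shows "\<bar>integral (ball 0 \<delta>) f - h ^ CARD('n) * (\<Sum>z\<in>lattice h \<inter> ball 0 \<delta> - {0}. f z)\<bar>
    \<le> \<bar>\<Sum>z\<in>{z\<in>lattice h. z \<noteq> 0 \<and> norm z < \<delta> - a h}. integral (cell h z) f - h ^ CARD('n) * f z\<bar>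
      + N * (integral (ball 0 (2 * a h)) (\<lambda>y::real^'n. norm y powr -s)
         + 2 * (\<delta>/2) powr -s * measure lebesgue (ball (0::real^'n) (\<delta> + a h) - ball 0 (\<delta> - 2 * a h)))"
proof -
  let ?K = "\<lambda>y::real^'n. norm y powr -s"
  define b where "b = a h"
  have b: "0 < b" "4 * b \<le> \<delta>" using h ah by (auto simp: b_def a_def)
  define B where "B = ball (0::real^'n) \<delta>"
  define T where "T = ball (0::real^'n) (\<delta> + b) - ball 0 (\<delta> - 2 * b)"
  define I where "I = {z\<in>lattice h. z \<noteq> 0 \<and> norm (z::real^'n) < \<delta> - b}"
  define J where "J = {z\<in>lattice h. z \<noteq> 0 \<and> \<delta> - b \<le> norm (z::real^'n) \<and> norm z < \<delta>}"
  define U where "U = (\<Union>z\<in>I. cell h z)"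
  have fin: "finite (lattice h \<inter> B)" unfolding B_def by (rule finite_lattice_bounded[OF h]) simp
  have IJ: "lattice h \<inter> B - {0} = I \<union> J" "I \<inter> J = {}" using b by (auto simp: I_def J_def B_def)
  have finI: "finite I" "finite J" using fin IJ(1) by (metis finite_Diff finite_Un)+
  have near: "norm (y - z) \<le> b" if "y \<in> cell h z" for y z :: "real^'n"
    using cell_dist[OF that] by (simp add: b_def a_def)
  have cellB: "cell h z \<subseteq> B" if "z \<in> I" for z
  proof
    fix y assume "y \<in> cell h z"
    from near[OF this] that norm_triangle_sub[of y z] show "y \<in> B"
      by (simp add: I_def B_def)
  qed
  have cellT: "cell h z \<subseteq> T" if "z \<in> J" for z
  proof
    fix y assume y: "y \<in> cell h z"
    from near[OF y] that norm_triangle_sub[of y z] norm_triangle_sub[of z y] show "y \<in> T"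
      by (auto simp: J_def T_def norm_minus_commute)
  qed
  have rest: "y \<in> ball 0 (2 * b) \<or> y \<in> T" if y: "y \<in> B - U" for y
  proof -
    obtain z where z: "z \<in> lattice h" "y \<in> cell h z" using cells_cover[OF h] by blast
    show ?thesis
    proof (cases "z = 0")
      case True
      then have "norm y < 2 * b" using near[OF z(2)] b by simp
      then show ?thesis by simp
    next
      case False
      then have "\<delta> - b \<le> norm z" using z y by (auto simp: U_def I_def not_less)
      then show ?thesis using near[OF z(2)] y b norm_triangle_sub[of z y]
        by (auto simp: T_def B_def norm_minus_commute)
    qed
  qed
  have fcell: "f integrable_on cell h z" if "z \<in> I" for z
  proof -
    have "f absolutely_integrable_on cell h z"
      using set_integrable_subset[OF f] cellB[OF that] by (simp add: cell_def B_def)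
    then show ?thesis by (rule set_lebesgue_integral_eq_integral(1))
  qed
  have fU: "(f has_integral (\<Sum>z\<in>I. integral (cell h z) f)) U"
    unfolding U_def by (rule cells_has_integral[OF h finI(1) _ fcell]) (auto simp: I_def)
  have UB: "U \<subseteq> B" using cellB by (auto simp: U_def)
  have fB: "f integrable_on B" using set_lebesgue_integral_eq_integral(1)[OF f] by (simp add: B_def)
  have fBU: "(f has_integral (integral B f - (\<Sum>z\<in>I. integral (cell h z) f))) (B - U)"
    using UB by (intro has_integral_setdiff[OF integrable_integral[OF fB] fU])
      (simp add: Diff_eq_empty_iff[THEN iffD2])
  obtain C where "\<And>\<rho>. 0 < \<rho> \<Longrightarrow> ?K absolutely_integrable_on ball 0 \<rho>"
    using norm_powr_integral_ball[OF s] by blast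
  then have "?K absolutely_integrable_on ball 0 (2 * b)" using b by simp
  then have K2b: "?K integrable_on ball 0 (2 * b)" by (rule set_lebesgue_integral_eq_integral(1))
  have Tm: "T \<in> lmeasurable" unfolding T_def by (intro fmeasurable.Diff) auto
  \<comment> \<open>By \<open>4 * b \<le> \<delta>\<close> the shell stays outside radius
    \<open>\<delta> / 2\<close>, so this constant bounds the kernel on it.\<close>
  define \<kappa> where "\<kappa> = (\<delta>/2) powr -s"
  define g where "g y = N * ((if y \<in> ball 0 (2 * b) then ?K y else 0) + \<kappa> * indicator T y)" for y
  define G where "G = N * (integral (ball 0 (2 * b)) ?K + \<kappa> * measure lebesgue T)"
  have gU: "(g has_integral G) UNIV" unfolding g_def G_def
  proof (intro has_integral_mult_right has_integral_add)
    show "((\<lambda>y. if y \<in> ball 0 (2 * b) then ?K y else 0) has_integral integral (ball 0 (2 * b)) ?K) UNIV"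
      by (subst has_integral_restrict_UNIV) (rule integrable_integral[OF K2b])
    show "(indicator T has_integral measure lebesgue T) UNIV"
      using Tm by (simp add: lmeasurable_iff_has_integral)
  qed
  have \<kappa>: "0 \<le> \<kappa>" by (simp add: \<kappa>_def)
  have g0: "0 \<le> g y" for y using N(1) \<kappa> by (auto simp: g_def)
  have Kshell: "?K y \<le> \<kappa>" if "y \<in> T" for y
    unfolding \<kappa>_def using that s b by (intro powr_mono2') (auto simp: T_def)
  have fg: "\<bar>f y\<bar> \<le> g y" if y: "y \<in> B - U" for y
  proof -
    have "\<bar>f y\<bar> \<le> N * ?K y" using N(2) y by (simp add: B_def)
    also have "?K y \<le> (if y \<in> ball 0 (2 * b) then ?K y else 0) + \<kappa> * indicator T y"
      using rest[OF y] Kshell[of y] \<kappa> by (auto simp: indicator_def)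
    finally show ?thesis unfolding g_def using N(1) by (simp add: mult_left_mono)
  qed
  have BUm: "B - U \<in> sets lebesgue"
    unfolding B_def U_def using finI by (intro sets.Diff sets.finite_UN) (auto simp: cell_def)
  have gBU: "g integrable_on (B - U)"
  proof -
    have "g absolutely_integrable_on UNIV"
      using gU g0 by (intro nonnegative_absolutely_integrable_1) auto
    then have "g absolutely_integrable_on (B - U)"
      by (rule set_integrable_subset) (use BUm in auto)
    then show ?thesis by (rule set_lebesgue_integral_eq_integral(1))
  qed
  have "norm (integral (B - U) f) \<le> integral (B - U) g"
    using fBU gBU fg by (intro integral_norm_bound_integral) auto
  also have "\<dots> \<le> integral UNIV g"
    using gBU gU g0 by (intro integral_subset_le) auto
  also have "\<dots> = G" using gU by (rule integral_unique)
  finally have E1: "\<bar>integral B f - (\<Sum>z\<in>I. integral (cell h z) f)\<bar> \<le> G"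
    using integral_unique[OF fBU] by simp
  \<comment> \<open>The cells of the boundary nodes overlap in null sets and lie in
    \<open>T\<close>, so a volume \<open>h ^ d\<close> per node adds up to at most the measure of
    \<open>T\<close>.\<close>
  have "(\<Sum>z\<in>J. h ^ CARD('n) * (N * \<kappa>)) \<le> integral T (\<lambda>y. N * \<kappa>)"
    by (rule cells_sum_le_integral[OF h finI(2)])
       (use cellT N(1) \<kappa> Tm in \<open>auto simp: J_def integrable_on_const\<close>)
  also have "\<dots> = N * \<kappa> * measure lebesgue T"
    using Tm integral_mult_right[of T "N * \<kappa>" "\<lambda>_. 1"] by (simp add: lmeasure_integral)
  finally have E2': "(\<Sum>z\<in>J. h ^ CARD('n) * (N * \<kappa>)) \<le> N * \<kappa> * measure lebesgue T" .
  have "\<bar>\<Sum>z\<in>J. h ^ CARD('n) * f z\<bar> \<le> (\<Sum>z\<in>J. h ^ CARD('n) * (N * \<kappa>))"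
  proof (rule order_trans[OF sum_abs sum_mono])
    fix z assume z: "z \<in> J"
    have "\<bar>f z\<bar> \<le> N * ?K z" using N(2) z by (simp add: J_def)
    also have "\<dots> \<le> N * \<kappa>"
      using cellT[OF z] centre_mem_cell[OF h, of z] N(1) by (intro mult_left_mono Kshell) auto
    finally show "\<bar>h ^ CARD('n) * f z\<bar> \<le> h ^ CARD('n) * (N * \<kappa>)" using h by (simp add: abs_mult)
  qed
  with E2' have E2: "\<bar>\<Sum>z\<in>J. h ^ CARD('n) * f z\<bar> \<le> N * \<kappa> * measure lebesgue T" by linarith
  have "h ^ CARD('n) * (\<Sum>z\<in>lattice h \<inter> B - {0}. f z)
      = (\<Sum>z\<in>I. h ^ CARD('n) * f z) + (\<Sum>z\<in>J. h ^ CARD('n) * f z)"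
    unfolding IJ(1) using finI IJ(2) by (simp add: sum.union_disjoint sum_distrib_left distrib_left)
  then have "\<bar>integral B f - h ^ CARD('n) * (\<Sum>z\<in>lattice h \<inter> B - {0}. f z)\<bar>
     \<le> \<bar>\<Sum>z\<in>I. integral (cell h z) f - h ^ CARD('n) * f z\<bar> + G + N * \<kappa> * measure lebesgue T"
    using E1 E2 unfolding sum_subtractf by linarith
  also have "\<dots> = \<bar>\<Sum>z\<in>I. integral (cell h z) f - h ^ CARD('n) * f z\<bar>
     + N * (integral (ball 0 (2 * b)) ?K + 2 * \<kappa> * measure lebesgue T)"
    by (simp add: G_def algebra_simps)
  finally show ?thesis unfolding B_def I_def \<kappa>_def T_def b_def .
qed

text \<open>One number controls both the values and the Lipschitz quotients, so that it acts as a
  norm: the error bounds below are linear in it.\<close>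

definition lip_bounded :: "('a::real_normed_vector) set \<Rightarrow> real \<Rightarrow> ('a \<Rightarrow> real) \<Rightarrow> bool" where
  "lip_bounded S M F \<longleftrightarrow> (\<forall>y\<in>S. \<bar>F y\<bar> \<le> M) \<and> (\<forall>y\<in>S. \<forall>y'\<in>S. \<bar>F y - F y'\<bar> \<le> M * norm (y - y'))"

section \<open>Summation of the cell errors and the Riemann sum estimate\<close>

lemma norm_powr_absolutely_integrable:
  fixes p :: real
  assumes p: "0 \<le> p" "p < real CARD('n)" and \<rho>: "0 < \<rho>"
  shows "(\<lambda>y::real^'n. norm y powr -p) absolutely_integrable_on ball 0 \<rho>"
  by (rule norm_powr_integral_ball[OF p]) (use \<rho> in blast)

lemma cells_sum_powr_le:
  assumes h: "0 < h" and I: "finite I" "I \<subseteq> lattice h - {0}" and S: "\<And>z. z \<in> I \<Longrightarrow> cell h z \<subseteq> S"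
    and p: "0 \<le> p" and g: "(\<lambda>y::real^'n. norm y powr -p) integrable_on S"
  shows "(\<Sum>z\<in>I. h ^ CARD('n) * norm z powr -p) \<le> (1 + real CARD('n)) powr p * integral S (\<lambda>y::real^'n. norm y powr -p)"
proof -
  have "(\<Sum>z\<in>I. h ^ CARD('n) * norm z powr -p)
      \<le> integral S (\<lambda>y::real^'n. (1 + real CARD('n)) powr p * norm y powr -p)"
  proof (rule cells_sum_le_integral[OF h I(1) _ S])
    show "norm z powr -p \<le> (1 + real CARD('n)) powr p * norm y powr -p" if z: "z \<in> I" and y: "y \<in> cell h z" for z y
    proof (rule powr_neg_scale_le[OF p])
      have zl: "z \<in> lattice h" "z \<noteq> 0" using z I by auto
      show "norm y \<le> (1 + real CARD('n)) * norm z" by (rule lattice_nonzero_cell(2)[OF h zl y])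
      show "0 < norm y" using lattice_nonzero_cell(1)[OF h zl y] h by linarith
    qed auto
  qed (use I g in \<open>auto intro: integrable_on_mult_right\<close>)
  then show ?thesis by simp
qed

text \<open>The cell errors add up to \<open>h^2\<close> times a lattice sum of
  \<open>norm z powr (-s-2)\<close>. If \<open>d - s \<le> 1\<close>, that power is integrable at
  infinity, and the sum outside radius \<open>h / 2\<close> is of order
  \<open>h powr (d - s - 2)\<close>. Otherwise one factor \<open>h\<close> is traded for
  \<open>norm z\<close>, which leaves the exponent \<open>s + 1 < d\<close>, integrable at the
  origin. The borderline falls under the first case, where no logarithm arises.\<close>

lemma cells_powr_error_sum:
  assumes s: "0 \<le> s" "s < real CARD('n)" and \<delta>: "0 < \<delta>"
  obtains C where "0 \<le> C" "\<And>h I. 0 < h \<Longrightarrow> finite I \<Longrightarrow> I \<subseteq> lattice h - {0} \<Longrightarrow>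
      (\<And>z. z \<in> I \<Longrightarrow> cell h z \<subseteq> ball (0::real^'n) \<delta>) \<Longrightarrow>
      (\<Sum>z\<in>I. \<bar>integral (cell h z) (\<lambda>y. norm y powr -s) - h ^ CARD('n) * norm z powr -s\<bar>)
      \<le> C * h powr (min 1 (real CARD('n) - s))"
proof -
  define d where "d = real CARD('n)"
  obtain C where C: "0 \<le> C" "\<And>h z. 0 < h \<Longrightarrow> z \<in> lattice h \<Longrightarrow> z \<noteq> 0 \<Longrightarrow>
    \<bar>integral (cell h z) (\<lambda>y::real^'n. norm y powr -s) - h ^ CARD('n) * norm z powr -s\<bar>
      \<le> C * h\<^sup>2 * norm z powr (-s-2) * h ^ CARD('n)"
    using cell_powr_integral_error[OF s(1)] by blast
  show thesis
  proof (cases "d - s \<le> 1")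
    case True
    then have p: "real CARD('n) < s + 2" by (simp add: d_def)
    obtain C' where C': "0 \<le> C'"
      "\<And>\<rho>. 0 < \<rho> \<Longrightarrow> (\<lambda>y::real^'n. norm y powr -(s+2)) absolutely_integrable_on - ball 0 \<rho>"
      "\<And>\<rho>. 0 < \<rho> \<Longrightarrow> integral (- ball 0 \<rho>) (\<lambda>y::real^'n. norm y powr -(s+2)) \<le> C' * \<rho> powr (real CARD('n) - (s+2))"
      using norm_powr_integral_shell[OF p] by blast
    define D where "D = C * (1+d) powr (s+2) * C' * (1/2) powr (d - (s+2))"
    show thesis
    proof (rule that)
      show "0 \<le> D" using C C' by (simp add: D_def)
      fix h I assume h: "0 < h" and I: "finite I" "I \<subseteq> lattice h - {0::real^'n}"
        and "\<And>z. z \<in> I \<Longrightarrow> cell h z \<subseteq> ball (0::real^'n) \<delta>"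
      have "(\<Sum>z\<in>I. h ^ CARD('n) * norm z powr -(s+2)) \<le> (1 + real CARD('n)) powr (s+2) *
          integral (- ball 0 (h/2)) (\<lambda>y::real^'n. norm y powr -(s+2))"
      proof (rule cells_sum_powr_le[OF h I])
        show "cell h z \<subseteq> - ball 0 (h/2)" if "z \<in> I" for z
          using lattice_nonzero_cell(1)[OF h, of z] that I by force
        show "(\<lambda>y::real^'n. norm y powr -(s+2)) integrable_on - ball 0 (h/2)"
          using C'(2)[of "h/2"] h by (intro set_lebesgue_integral_eq_integral(1)) auto
      qed (use s in auto)
      also have "\<dots> \<le> (1 + d) powr (s+2) * (C' * (h/2) powr (d - (s+2)))"
        unfolding d_def using C'(3)[of "h/2"] h by (intro mult_left_mono) auto
      also have "(h/2) powr (d - (s+2)) = (1/2) powr (d - (s+2)) * h powr (d - (s+2))"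
        using h by (subst powr_mult[symmetric]) auto
      finally have le: "(\<Sum>z\<in>I. h ^ CARD('n) * norm z powr -(s+2))
         \<le> (1 + d) powr (s+2) * (C' * ((1/2) powr (d - (s+2)) * h powr (d - (s+2))))" .
      have "(\<Sum>z\<in>I. \<bar>integral (cell h z) (\<lambda>y. norm y powr -s) - h ^ CARD('n) * norm z powr -s\<bar>)
         \<le> (\<Sum>z\<in>I. C * h\<^sup>2 * (h ^ CARD('n) * norm z powr -(s+2)))"
        using C(2)[OF h] I by (intro sum_mono) (force simp: mult_ac)
      also have "\<dots> = C * h\<^sup>2 * (\<Sum>z\<in>I. h ^ CARD('n) * norm z powr -(s+2))"
        by (simp only: sum_distrib_left)
      also have "\<dots> \<le> C * h\<^sup>2 * ((1 + d) powr (s+2) * (C' * ((1/2) powr (d - (s+2)) * h powr (d - (s+2)))))"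
        using C by (intro mult_left_mono le) auto
      also have "\<dots> = D * (h powr 2 * h powr (d - (s+2)))"
        using h by (simp add: D_def mult_ac)
      also have "h powr 2 * h powr (d - (s+2)) = h powr (2 + (d - (s+2)))"
        by (rule powr_add[symmetric])
      also have "2 + (d - (s+2)) = min 1 (real CARD('n) - s)" using True by (simp add: d_def)
      finally show "(\<Sum>z\<in>I. \<bar>integral (cell h z) (\<lambda>y. norm y powr -s) - h ^ CARD('n) * norm z powr -s\<bar>)
         \<le> D * h powr (min 1 (real CARD('n) - s))" .
    qed
  next
    case False
    then have p: "0 \<le> s + 1" "s + 1 < real CARD('n)" using s by (auto simp: d_def)
    define M where "M = integral (ball 0 \<delta>) (\<lambda>y::real^'n. norm y powr -(s+1))"
    have K: "(\<lambda>y::real^'n. norm y powr -(s+1)) integrable_on ball 0 \<delta>"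
      using norm_powr_absolutely_integrable[OF p \<delta>] by (rule set_lebesgue_integral_eq_integral(1))
    have M: "0 \<le> M" unfolding M_def using K by (intro integral_nonneg) auto
    define D where "D = C * ((1+d) powr (s+1) * M)"
    show thesis
    proof (rule that)
      show "0 \<le> D" using C M by (simp add: D_def)
      fix h I assume h: "0 < h" and I: "finite I" "I \<subseteq> lattice h - {0::real^'n}"
        and cI: "\<And>z. z \<in> I \<Longrightarrow> cell h z \<subseteq> ball (0::real^'n) \<delta>"
      have le: "(\<Sum>z\<in>I. h ^ CARD('n) * norm z powr -(s+1)) \<le> (1 + d) powr (s+1) * M"
        unfolding d_def M_def by (rule cells_sum_powr_le[OF h I cI p(1) K])
      have "(\<Sum>z\<in>I. \<bar>integral (cell h z) (\<lambda>y. norm y powr -s) - h ^ CARD('n) * norm z powr -s\<bar>)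
         \<le> (\<Sum>z\<in>I. C * h * (h ^ CARD('n) * norm z powr -(s+1)))"
      proof (rule sum_mono)
        fix z assume "z \<in> I"
        then have z: "z \<in> lattice h" "z \<noteq> 0" using I by auto
        obtain i where "h \<le> \<bar>z $ i - 0 $ i\<bar>" using lattice_diff_coord[OF h z(1) zero_mem_lattice z(2)] by blast
        then have hz: "h \<le> norm z" using component_le_norm_cart[of z i] by simp
        have "h * norm z powr (-s-2) \<le> norm z powr 1 * norm z powr (-s-2)"
          using hz h by (intro mult_right_mono) auto
        also have "\<dots> = norm z powr (1 + (-s-2))" by (rule powr_add[symmetric])
        also have "1 + (-s-2) = -(s+1)" by simp
        finally have "C * h * h ^ CARD('n) * (h * norm z powr (-s-2)) \<le> C * h * h ^ CARD('n) * norm z powr -(s+1)"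
          using C h by (intro mult_left_mono) auto
        then show "\<bar>integral (cell h z) (\<lambda>y. norm y powr -s) - h ^ CARD('n) * norm z powr -s\<bar>
            \<le> C * h * (h ^ CARD('n) * norm z powr -(s+1))"
          using C(2)[OF h z] by (simp add: power2_eq_square mult_ac)
      qed
      also have "\<dots> = C * h * (\<Sum>z\<in>I. h ^ CARD('n) * norm z powr -(s+1))"
        by (simp only: sum_distrib_left)
      also have "\<dots> \<le> C * h * ((1 + d) powr (s+1) * M)"
        using C h by (intro mult_left_mono le) auto
      also have "\<dots> = D * h powr (min 1 (real CARD('n) - s))"
        using False h by (simp add: D_def d_def mult_ac)
      finally show "(\<Sum>z\<in>I. \<bar>integral (cell h z) (\<lambda>y. norm y powr -s) - h ^ CARD('n) * norm z powr -s\<bar>)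
         \<le> D * h powr (min 1 (real CARD('n) - s))" .
    qed
  qed
qed

lemma lip_bounded_continuous_on:
  assumes "lip_bounded S M F" shows "continuous_on S F"
proof -
  have "\<bar>M\<bar>-lipschitz_on S F"
  proof (rule lipschitz_onI)
    fix x y assume "x \<in> S" "y \<in> S"
    then have "\<bar>F x - F y\<bar> \<le> M * norm (x - y)" using assms by (simp add: lip_bounded_def)
    also have "\<dots> \<le> \<bar>M\<bar> * norm (x - y)" by (intro mult_right_mono) auto
    finally show "dist (F x) (F y) \<le> \<bar>M\<bar> * dist x y" by (simp add: dist_norm)
  qed simp
  then show ?thesis by (rule lipschitz_on_continuous_on)
qed

lemma powr_times_lip_bounded_integrable:
  assumes s: "0 \<le> s" "s < real CARD('n)" and \<delta>: "0 < \<delta>"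
    and F: "lip_bounded (ball (0::real^'n) \<delta>) N F"
  shows "(\<lambda>y. norm y powr -s * F y) absolutely_integrable_on ball 0 \<delta>"
proof -
  have K: "(\<lambda>y::real^'n. norm y powr -s) absolutely_integrable_on ball 0 \<delta>"
    by (rule norm_powr_absolutely_integrable[OF s \<delta>])
  have "(\<lambda>y. F y * norm y powr -s) absolutely_integrable_on ball 0 \<delta>"
  proof (rule absolutely_integrable_bounded_measurable_product[OF bilinear_times _ _ _ K])
    show "F \<in> borel_measurable (lebesgue_on (ball 0 \<delta>))"
      using lip_bounded_continuous_on[OF F] by (rule continuous_imp_measurable_on_sets_lebesgue) simp
    show "bounded (F ` ball 0 \<delta>)" using F by (auto simp: bounded_iff lip_bounded_def)
  qed auto
  then show ?thesis by (simp add: mult.commute)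
qed

lemma cells_powr_lipschitz_error_sum:
  assumes s: "0 \<le> s" "s < real CARD('n)" and \<delta>: "0 < \<delta>"
  obtains C where "0 \<le> C" "\<And>h I N F. 0 < h \<Longrightarrow> finite I \<Longrightarrow> I \<subseteq> lattice h - {0} \<Longrightarrow>
      (\<And>z. z \<in> I \<Longrightarrow> cell h z \<subseteq> ball (0::real^'n) \<delta>) \<Longrightarrow> 0 \<le> N \<Longrightarrow>
      (\<And>y. y \<in> ball 0 \<delta> \<Longrightarrow> \<bar>F y\<bar> \<le> N * norm y) \<Longrightarrow>
      (\<And>y y'. y \<in> ball 0 \<delta> \<Longrightarrow> y' \<in> ball 0 \<delta> \<Longrightarrow> \<bar>F y - F y'\<bar> \<le> N * norm (y - y')) \<Longrightarrow>
      (\<Sum>z\<in>I. \<bar>integral (cell h z) (\<lambda>y. norm y powr -s * F y) - h ^ CARD('n) * (norm z powr -s * F z)\<bar>)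
      \<le> C * N * h"
proof -
  obtain C where C: "0 \<le> C" "\<And>h z N F. 0 < h \<Longrightarrow> z \<in> lattice h \<Longrightarrow> z \<noteq> 0 \<Longrightarrow> 0 \<le> N \<Longrightarrow>
    (\<And>y. y \<in> cell h z \<Longrightarrow> \<bar>F y\<bar> \<le> N * norm y) \<Longrightarrow>
    (\<And>y y'. y \<in> cell h z \<Longrightarrow> y' \<in> cell h z \<Longrightarrow> \<bar>F y - F y'\<bar> \<le> N * norm (y - y')) \<Longrightarrow>
    \<bar>integral (cell h z) (\<lambda>y::real^'n. norm y powr -s * F y) - h ^ CARD('n) * (norm z powr -s * F z)\<bar>
      \<le> C * N * h * norm z powr -s * h ^ CARD('n)"
    using cell_powr_lipschitz_integral_error[OF s(1)] by blast
  define M where "M = integral (ball 0 \<delta>) (\<lambda>y::real^'n. norm y powr -s)"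
  have K: "(\<lambda>y::real^'n. norm y powr -s) integrable_on ball 0 \<delta>"
    using norm_powr_absolutely_integrable[OF s \<delta>] by (rule set_lebesgue_integral_eq_integral(1))
  have M: "0 \<le> M" unfolding M_def using K by (intro integral_nonneg) auto
  define D where "D = C * ((1 + real CARD('n)) powr s * M)"
  show thesis
  proof (rule that)
    show "0 \<le> D" using C M by (simp add: D_def)
    fix h N I and F :: "real^'n \<Rightarrow> real"
    assume h: "0 < h" and I: "finite I" "I \<subseteq> lattice h - {0::real^'n}"
      and cI: "\<And>z. z \<in> I \<Longrightarrow> cell h z \<subseteq> ball (0::real^'n) \<delta>" and N: "0 \<le> N"
      and F: "\<And>y. y \<in> ball 0 \<delta> \<Longrightarrow> \<bar>F y\<bar> \<le> N * norm y"
        "\<And>y y'. y \<in> ball 0 \<delta> \<Longrightarrow> y' \<in> ball 0 \<delta> \<Longrightarrow> \<bar>F y - F y'\<bar> \<le> N * norm (y - y')"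
    have "(\<Sum>z\<in>I. \<bar>integral (cell h z) (\<lambda>y. norm y powr -s * F y) - h ^ CARD('n) * (norm z powr -s * F z)\<bar>)
       \<le> (\<Sum>z\<in>I. C * N * h * (h ^ CARD('n) * norm z powr -s))"
    proof (rule sum_mono)
      fix z assume zI: "z \<in> I"
      then have z: "z \<in> lattice h" "z \<noteq> 0" using I by auto
      have "\<bar>integral (cell h z) (\<lambda>y. norm y powr -s * F y) - h ^ CARD('n) * (norm z powr -s * F z)\<bar>
         \<le> C * N * h * norm z powr -s * h ^ CARD('n)"
        by (rule C(2)[OF h z N]) (use F cI[OF zI] in blast)+
      then show "\<bar>integral (cell h z) (\<lambda>y. norm y powr -s * F y) - h ^ CARD('n) * (norm z powr -s * F z)\<bar>
         \<le> C * N * h * (h ^ CARD('n) * norm z powr -s)" by (simp only: mult_ac)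
    qed
    also have "\<dots> = C * N * h * (\<Sum>z\<in>I. h ^ CARD('n) * norm z powr -s)"
      by (simp only: sum_distrib_left)
    also have "\<dots> \<le> C * N * h * ((1 + real CARD('n)) powr s * M)"
      unfolding M_def using C N h by (intro mult_left_mono cells_sum_powr_le[OF h I cI s(1) K]) auto
    also have "\<dots> = D * N * h" by (simp add: D_def mult_ac)
    finally show "(\<Sum>z\<in>I. \<bar>integral (cell h z) (\<lambda>y. norm y powr -s * F y) - h ^ CARD('n) * (norm z powr -s * F z)\<bar>)
       \<le> D * N * h" .
  qed
qed

lemma riemann_sum_error:
  assumes s: "0 \<le> s" "s < real CARD('n)" and \<delta>: "0 < \<delta>"
  defines "\<alpha> \<equiv> min 1 (real CARD('n) - s)"
  obtains C where "0 \<le> C" "\<And>h N F. 0 < h \<Longrightarrow> 2 * real CARD('n) * h \<le> \<delta> \<Longrightarrow> 0 \<le> N \<Longrightarrow>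
     lip_bounded (ball (0::real^'n) \<delta>) N F \<Longrightarrow>
     \<bar>integral (ball 0 \<delta>) (\<lambda>y. norm y powr -s * F y)
       - h ^ CARD('n) * (\<Sum>z\<in>lattice h \<inter> ball 0 \<delta> - {0}. norm z powr -s * F z)\<bar> \<le> C * N * h powr \<alpha>"
proof -
  let ?K = "\<lambda>y::real^'n. norm y powr -s"
  define d where "d = real CARD('n)"
  have d1: "1 \<le> d" unfolding d_def by (simp add: Suc_le_eq)
  obtain C1 where C1: "0 \<le> C1" "\<And>h I. 0 < h \<Longrightarrow> finite I \<Longrightarrow> I \<subseteq> lattice h - {0} \<Longrightarrow>
      (\<And>z. z \<in> I \<Longrightarrow> cell h z \<subseteq> ball (0::real^'n) \<delta>) \<Longrightarrow>
      (\<Sum>z\<in>I. \<bar>integral (cell h z) ?K - h ^ CARD('n) * ?K z\<bar>) \<le> C1 * h powr (min 1 (real CARD('n) - s))"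
    using cells_powr_error_sum[OF s \<delta>] by blast
  obtain C2 where C2: "0 \<le> C2" "\<And>h I N F. 0 < h \<Longrightarrow> finite I \<Longrightarrow> I \<subseteq> lattice h - {0} \<Longrightarrow>
      (\<And>z. z \<in> I \<Longrightarrow> cell h z \<subseteq> ball (0::real^'n) \<delta>) \<Longrightarrow> 0 \<le> N \<Longrightarrow>
      (\<And>y. y \<in> ball 0 \<delta> \<Longrightarrow> \<bar>F y\<bar> \<le> N * norm y) \<Longrightarrow>
      (\<And>y y'. y \<in> ball 0 \<delta> \<Longrightarrow> y' \<in> ball 0 \<delta> \<Longrightarrow> \<bar>F y - F y'\<bar> \<le> N * norm (y - y')) \<Longrightarrow>
      (\<Sum>z\<in>I. \<bar>integral (cell h z) (\<lambda>y. ?K y * F y) - h ^ CARD('n) * (?K z * F z)\<bar>) \<le> C2 * N * h"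
    using cells_powr_lipschitz_error_sum[OF s \<delta>] by blast
  obtain C3 where C3: "0 \<le> C3"
    "\<And>\<rho>. 0 < \<rho> \<Longrightarrow> integral (ball 0 \<rho>) ?K \<le> C3 * \<rho> powr (real CARD('n) - s)"
  proof (rule norm_powr_integral_ball[OF s])
    fix C assume "0 \<le> C" "\<And>\<rho>. 0 < \<rho> \<Longrightarrow> integral (ball 0 \<rho>) ?K \<le> C * \<rho> powr (real CARD('n) - s)"
    then show thesis by (rule that)
  qed
  define C4 where "C4 = 3 * unit_ball_vol d * d * (2 * \<delta>) ^ (CARD('n) - 1)"
  have C4: "0 \<le> C4" unfolding C4_def using d1 \<delta> by simp
  \<comment> \<open>One contribution per constant: \<open>C1\<close> for the kernel times
    \<open>F 0\<close>, \<open>C2\<close> for the kernel times \<open>F - F 0\<close>,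
    \<open>C3\<close> for the ball around the origin, \<open>C4\<close> for the boundary
    shell.\<close>
  define D where "D = C1 + C2 * \<delta> powr (1 - \<alpha>) + (C3 * d powr (d - s) * \<delta> powr (d - s - \<alpha>)
     + 2 * (\<delta>/2) powr -s * (C4 * (d / 2) * \<delta> powr (1 - \<alpha>)))"
  have \<alpha>: "\<alpha> \<le> 1" "\<alpha> \<le> d - s" by (auto simp: \<alpha>_def d_def)
  show thesis
  proof (rule that)
    show "0 \<le> D" unfolding D_def using C1(1) C2(1) C3(1) C4 d1 by simp
    fix h N and F :: "real^'n \<Rightarrow> real"
    assume h: "0 < h" and hd: "2 * real CARD('n) * h \<le> \<delta>" and N: "0 \<le> N"
      and F: "lip_bounded (ball (0::real^'n) \<delta>) N F"
    define a where "a = real CARD('n) * h / 2"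
    have a: "0 < a" "4 * a \<le> \<delta>" "a = d / 2 * h" using h hd by (auto simp: a_def d_def mult_ac)
    have "1 * h \<le> (2 * d) * h" using d1 h by (intro mult_right_mono) auto
    then have h\<delta>: "h \<le> \<delta>" using hd by (simp add: d_def)
    \<comment> \<open>Every contribution carries a power of \<open>h\<close> of exponent at least
      \<alpha>; as \<open>h \<le> \<delta>\<close>, the surplus is absorbed into a power of
      \<delta>.\<close>
    have hp: "h powr e \<le> \<delta> powr (e - \<alpha>) * h powr \<alpha>" if "\<alpha> \<le> e" for e
    proof -
      have "h powr e = h powr (e - \<alpha>) * h powr \<alpha>" by (simp add: powr_add[symmetric])
      also have "\<dots> \<le> \<delta> powr (e - \<alpha>) * h powr \<alpha>"
        using h h\<delta> that by (intro mult_right_mono powr_mono2) auto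
      finally show ?thesis .
    qed
    have h1: "h \<le> \<delta> powr (1 - \<alpha>) * h powr \<alpha>" using hp[OF \<alpha>(1)] h by simp
    define I where "I = {z\<in>lattice h. z \<noteq> 0 \<and> norm (z::real^'n) < \<delta> - a}"
    define G where "G y = F y - F 0" for y
    have F0: "\<bar>F 0\<bar> \<le> N" using F \<delta> by (simp add: lip_bounded_def)
    have Fb: "\<bar>F y\<bar> \<le> N" if "y \<in> ball 0 \<delta>" for y using F that unfolding lip_bounded_def by blast
    have Gb: "\<bar>G y\<bar> \<le> N * norm y" if "y \<in> ball 0 \<delta>" for y
    proof -
      have "\<bar>F y - F 0\<bar> \<le> N * norm (y - 0)" using F that \<delta> unfolding lip_bounded_def by (meson centre_in_ball)
      then show ?thesis by (simp add: G_def)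
    qed
    have Gl: "\<bar>G y - G y'\<bar> \<le> N * norm (y - y')" if "y \<in> ball 0 \<delta>" "y' \<in> ball 0 \<delta>" for y y'
      using F that unfolding lip_bounded_def G_def by simp
    have Isub: "I \<subseteq> lattice h - {0}" by (auto simp: I_def)
    have "I \<subseteq> lattice h \<inter> ball 0 \<delta>" using a by (auto simp: I_def)
    then have finI: "finite I" using finite_lattice_bounded[OF h bounded_ball] finite_subset by blast
    have cI: "cell h z \<subseteq> ball 0 \<delta>" if "z \<in> I" for z
    proof
      fix y assume "y \<in> cell h z"
      from cell_dist[OF this] that norm_triangle_sub[of y z] show "y \<in> ball 0 \<delta>"
        by (simp add: I_def a_def)
    qed
    have split: "integral (cell h z) (\<lambda>y. ?K y * F y) - h ^ CARD('n) * (?K z * F z)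
       = F 0 * (integral (cell h z) ?K - h ^ CARD('n) * ?K z)
       + (integral (cell h z) (\<lambda>y. ?K y * G y) - h ^ CARD('n) * (?K z * G z))" if z: "z \<in> I" for z
    proof -
      have zl: "z \<in> lattice h" "z \<noteq> 0" using z Isub by auto
      have cK: "continuous_on (cell h z) ?K" by (rule lattice_cell_continuous_powr[OF h zl])
      have cG: "continuous_on (cell h z) G" unfolding G_def
        using lip_bounded_continuous_on[OF F] cI[OF z] by (intro continuous_intros) (rule continuous_on_subset)
      have i1: "?K integrable_on cell h z" using cK unfolding cell_def by (rule integrable_continuous)
      have i2: "(\<lambda>y. ?K y * G y) integrable_on cell h z"
        using continuous_on_mult[OF cK cG] unfolding cell_def by (rule integrable_continuous)
      have "integral (cell h z) (\<lambda>y. ?K y * F y) = integral (cell h z) (\<lambda>y. ?K y * F 0 + ?K y * G y)"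
        by (simp add: G_def algebra_simps)
      also have "\<dots> = integral (cell h z) ?K * F 0 + integral (cell h z) (\<lambda>y. ?K y * G y)"
        using i1 i2 by (subst integral_add) (auto intro: integrable_on_mult_left)
      finally show ?thesis by (simp add: G_def algebra_simps)
    qed
    have "\<bar>\<Sum>z\<in>I. integral (cell h z) (\<lambda>y. ?K y * F y) - h ^ CARD('n) * (?K z * F z)\<bar>
      \<le> (\<Sum>z\<in>I. N * \<bar>integral (cell h z) ?K - h ^ CARD('n) * ?K z\<bar>
           + \<bar>integral (cell h z) (\<lambda>y. ?K y * G y) - h ^ CARD('n) * (?K z * G z)\<bar>)"
    proof (rule order_trans[OF sum_abs sum_mono])
      fix z assume z: "z \<in> I"
      have "\<bar>F 0 * x + y\<bar> \<le> N * \<bar>x\<bar> + \<bar>y\<bar>" for x y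
        using abs_triangle_ineq[of "F 0 * x" y] mult_right_mono[OF F0 abs_ge_zero[of x]] by (simp add: abs_mult)
      then show "\<bar>integral (cell h z) (\<lambda>y. ?K y * F y) - h ^ CARD('n) * (?K z * F z)\<bar>
        \<le> N * \<bar>integral (cell h z) ?K - h ^ CARD('n) * ?K z\<bar>
           + \<bar>integral (cell h z) (\<lambda>y. ?K y * G y) - h ^ CARD('n) * (?K z * G z)\<bar>"
        unfolding split[OF z] .
    qed
    also have "\<dots> = N * (\<Sum>z\<in>I. \<bar>integral (cell h z) ?K - h ^ CARD('n) * ?K z\<bar>)
           + (\<Sum>z\<in>I. \<bar>integral (cell h z) (\<lambda>y. ?K y * G y) - h ^ CARD('n) * (?K z * G z)\<bar>)"
      by (simp only: sum.distrib sum_distrib_left)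
    also have "\<dots> \<le> N * (C1 * h powr \<alpha>) + C2 * N * h"
      unfolding \<alpha>_def by (intro add_mono mult_left_mono C1(2) C2(2)) (use h finI Isub cI N Gb Gl in auto)
    finally have S: "\<bar>\<Sum>z\<in>I. integral (cell h z) (\<lambda>y. ?K y * F y) - h ^ CARD('n) * (?K z * F z)\<bar>
       \<le> N * (C1 * h powr \<alpha>) + C2 * N * h" .
    have fi: "(\<lambda>y. ?K y * F y) absolutely_integrable_on ball 0 \<delta>"
      by (rule powr_times_lip_bounded_integrable[OF s \<delta> F])
    have fN: "\<bar>?K y * F y\<bar> \<le> N * ?K y" if "y \<in> ball 0 \<delta>" for y
      using mult_right_mono[OF Fb[OF that], of "?K y"] by (simp add: abs_mult mult.commute)
    have R: "\<bar>integral (ball 0 \<delta>) (\<lambda>y. ?K y * F y)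
       - h ^ CARD('n) * (\<Sum>z\<in>lattice h \<inter> ball 0 \<delta> - {0}. ?K z * F z)\<bar>
       \<le> \<bar>\<Sum>z\<in>I. integral (cell h z) (\<lambda>y. ?K y * F y) - h ^ CARD('n) * (?K z * F z)\<bar>
      + N * (integral (ball 0 (2 * a)) ?K
         + 2 * (\<delta>/2) powr -s * measure lebesgue (ball (0::real^'n) (\<delta> + a) - ball 0 (\<delta> - 2 * a)))"
      unfolding I_def a_def
      by (rule riemann_error_decomposition[OF h _ s fi N fN]) (use a in \<open>auto simp: a_def\<close>)
    have e: "2 * a = d * h" "0 < d * h" using h d1 by (auto simp: a_def d_def)
    have "integral (ball 0 (2 * a)) ?K \<le> C3 * (d * h) powr (d - s)"
      unfolding e(1) using C3(2)[OF e(2)] by (simp add: d_def)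
    also have "(d * h) powr (d - s) = d powr (d - s) * h powr (d - s)"
      using d1 h by (simp add: powr_mult)
    also have "C3 * (d powr (d - s) * h powr (d - s)) \<le> C3 * (d powr (d - s) * (\<delta> powr (d - s - \<alpha>) * h powr \<alpha>))"
      using C3(1) by (intro mult_left_mono hp \<alpha>) auto
    finally have R1: "integral (ball 0 (2 * a)) ?K \<le> C3 * (d powr (d - s) * (\<delta> powr (d - s - \<alpha>) * h powr \<alpha>))" .
    have "measure lebesgue (ball (0::real^'n) (\<delta> + a) - ball 0 (\<delta> - 2 * a)) \<le> C4 * a"
      unfolding C4_def d_def by (rule measure_shell_le) (use a(1,2) in linarith)+
    also have "\<dots> \<le> C4 * (d / 2) * (\<delta> powr (1 - \<alpha>) * h powr \<alpha>)"
      using mult_left_mono[OF h1, of "C4 * (d / 2)"] C4 d1 by (simp add: a(3) mult.assoc)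
    finally have R2: "measure lebesgue (ball (0::real^'n) (\<delta> + a) - ball 0 (\<delta> - 2 * a))
      \<le> C4 * (d / 2) * (\<delta> powr (1 - \<alpha>) * h powr \<alpha>)" .
    have "C2 * N * h \<le> C2 * N * (\<delta> powr (1 - \<alpha>) * h powr \<alpha>)"
      using C2(1) N by (intro mult_left_mono h1) auto
    moreover have "N * (integral (ball 0 (2 * a)) ?K
         + 2 * (\<delta>/2) powr -s * measure lebesgue (ball (0::real^'n) (\<delta> + a) - ball 0 (\<delta> - 2 * a)))
       \<le> N * (C3 * (d powr (d - s) * (\<delta> powr (d - s - \<alpha>) * h powr \<alpha>))
         + 2 * (\<delta>/2) powr -s * (C4 * (d / 2) * (\<delta> powr (1 - \<alpha>) * h powr \<alpha>)))"
      using N by (intro mult_left_mono add_mono R1 R2) auto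
    moreover have "N * (C1 * h powr \<alpha>) + C2 * N * (\<delta> powr (1 - \<alpha>) * h powr \<alpha>)
       + N * (C3 * (d powr (d - s) * (\<delta> powr (d - s - \<alpha>) * h powr \<alpha>))
         + 2 * (\<delta>/2) powr -s * (C4 * (d / 2) * (\<delta> powr (1 - \<alpha>) * h powr \<alpha>))) = D * N * h powr \<alpha>"
      by (simp add: D_def algebra_simps)
    ultimately show "\<bar>integral (ball 0 \<delta>) (\<lambda>y. ?K y * F y)
       - h ^ CARD('n) * (\<Sum>z\<in>lattice h \<inter> ball 0 \<delta> - {0}. ?K z * F z)\<bar> \<le> D * N * h powr \<alpha>"
      using R S by linarith
  qed
qed

section \<open>Orthogonal projection onto a finite span\<close>

definition lin_comb :: "'k set \<Rightarrow> ('k \<Rightarrow> 'a \<Rightarrow> real) \<Rightarrow> ('k \<Rightarrow> real) \<Rightarrow> 'a \<Rightarrow> real" where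
  "lin_comb I \<phi> c = (\<lambda>x. \<Sum>k\<in>I. c k * \<phi> k x)"

lemma lin_comb_combine:
  "a * lin_comb I \<phi> c x + b * lin_comb I \<phi> e x = lin_comb I \<phi> (\<lambda>k. a * c k + b * e k) x"
  by (simp add: lin_comb_def sum_distrib_left sum.distrib algebra_simps)

lemma lin_comb_insert:
  assumes "finite I" "k \<notin> I"
  shows "lin_comb (insert k I) \<phi> c x = c k * \<phi> k x + lin_comb I \<phi> c x"
  using assms by (simp add: lin_comb_def)

lemma lin_comb_cong: "(\<And>k. k \<in> I \<Longrightarrow> c k = e k) \<Longrightarrow> lin_comb I \<phi> c = lin_comb I \<phi> e"
  by (auto simp: lin_comb_def fun_eq_iff intro!: sum.cong)

text \<open>Only semidefinite, because both instances have null functions: a sum over a stencil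
  ignores values off the stencil, an integral ignores values off the ball. One projection argument
  then serves both the optimal weights and the norm equivalence.\<close>

locale semi_inner =
  fixes V :: "('a \<Rightarrow> real) set" and ip :: "('a \<Rightarrow> real) \<Rightarrow> ('a \<Rightarrow> real) \<Rightarrow> real"
  assumes zero_mem: "(\<lambda>x. 0) \<in> V"
    and lin_mem: "f \<in> V \<Longrightarrow> g \<in> V \<Longrightarrow> (\<lambda>x. a * f x + b * g x) \<in> V"
    and sym: "f \<in> V \<Longrightarrow> g \<in> V \<Longrightarrow> ip f g = ip g f"
    and lin: "f \<in> V \<Longrightarrow> g \<in> V \<Longrightarrow> k \<in> V \<Longrightarrow> ip (\<lambda>x. a * f x + b * g x) k = a * ip f k + b * ip g k"
    and nonneg: "f \<in> V \<Longrightarrow> 0 \<le> ip f f"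
begin

lemma lin_right: "f \<in> V \<Longrightarrow> g \<in> V \<Longrightarrow> k \<in> V \<Longrightarrow> ip k (\<lambda>x. a * f x + b * g x) = a * ip k f + b * ip k g"
  using lin[of f g k a b] sym lin_mem by metis

lemma lin_comb_mem:
  assumes "finite I" "\<And>k. k \<in> I \<Longrightarrow> \<phi> k \<in> V" shows "lin_comb I \<phi> c \<in> V"
  using assms
proof (induction I)
  case empty
  then show ?case using zero_mem by (simp add: lin_comb_def)
next
  case (insert k I)
  have "lin_comb (insert k I) \<phi> c = (\<lambda>x. c k * \<phi> k x + 1 * lin_comb I \<phi> c x)"
    using insert by (auto simp: lin_comb_insert)
  then show ?case using insert lin_mem[of "\<phi> k" "lin_comb I \<phi> c" "c k" 1] by auto
qed

lemma orthogonal_lin_comb: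
  assumes "finite I" "\<And>k. k \<in> I \<Longrightarrow> \<phi> k \<in> V" "v \<in> V" "\<And>k. k \<in> I \<Longrightarrow> ip v (\<phi> k) = 0"
  shows "ip v (lin_comb I \<phi> c) = 0"
  using assms
proof (induction I)
  case empty
  then show ?case using lin_right[OF zero_mem zero_mem, of v 0 0] by (simp add: lin_comb_def)
next
  case (insert k I)
  have "lin_comb (insert k I) \<phi> c = (\<lambda>x. c k * \<phi> k x + 1 * lin_comb I \<phi> c x)"
    using insert by (auto simp: lin_comb_insert)
  then show ?case using insert lin_right[of "\<phi> k" "lin_comb I \<phi> c" v "c k" 1] lin_comb_mem[of I \<phi> c] by auto
qed

lemma null_orthogonal:
  assumes f: "f \<in> V" "ip f f = 0" and g: "g \<in> V" shows "ip g f = 0"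
proof (rule ccontr)
  assume n: "ip g f \<noteq> 0"
  \<comment> \<open>With \<open>ip f f = 0\<close> the form of \<open>g + t f\<close> with itself is
    affine in \<open>t\<close>; this choice gives it the value -1.\<close>
  define t where "t = - (ip g g + 1) / (2 * ip g f)"
  have "0 \<le> ip (\<lambda>x. 1 * g x + t * f x) (\<lambda>x. 1 * g x + t * f x)" by (intro nonneg lin_mem f g)
  also have "\<dots> = ip g g + 2 * t * ip g f"
    using f g sym[of f g] by (simp only: lin lin_right lin_mem) (simp add: algebra_simps)
  also have "\<dots> = -1" using n by (simp add: t_def field_simps)
  finally show False by simp
qed

lemma gram_schmidt_step:
  assumes I: "finite I" "\<And>k. k \<in> I \<Longrightarrow> \<phi> k \<in> V" and p: "p \<in> V" and ort: "\<And>k. k \<in> I \<Longrightarrow> ip p (\<phi> k) = 0"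
    and v: "v \<in> V" "\<And>k. k \<in> I \<Longrightarrow> ip v (\<phi> k) = 0"
  obtains t where "ip (\<lambda>x. 1 * v x + (-t) * p x) p = 0" "\<And>k. k \<in> I \<Longrightarrow> ip (\<lambda>x. 1 * v x + (-t) * p x) (\<phi> k) = 0"
proof
  \<comment> \<open>For a null \<open>p\<close> the quotient is 0 by convention, and
    \<open>null_orthogonal\<close> already gives the orthogonality to \<open>p\<close>.\<close>
  let ?t = "ip v p / ip p p"
  show "ip (\<lambda>x. 1 * v x + (-?t) * p x) p = 0"
    unfolding lin[OF v(1) p p] using null_orthogonal[OF p _ v(1)] by (cases "ip p p = 0") auto
  show "ip (\<lambda>x. 1 * v x + (-?t) * p x) (\<phi> k) = 0" if "k \<in> I" for k
    unfolding lin[OF v(1) p I(2)[OF that]] using that v ort by simp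
qed

text \<open>Gram-Schmidt without replacing the family: the smaller span is projected out of
  \<open>w\<close> and out of the new vector, and then the first residual loses its component along
  the second. Coefficients need not be unique, so dependent families are allowed.\<close>

lemma projection_exists:
  assumes I: "finite I" "\<And>k. k \<in> I \<Longrightarrow> \<phi> k \<in> V" and w: "w \<in> V"
  shows "\<exists>c. \<forall>k\<in>I. ip (\<lambda>x. w x - lin_comb I \<phi> c x) (\<phi> k) = 0"
  using I w
proof (induction I arbitrary: w)
  case (insert j I)
  then have V: "\<phi> j \<in> V" "\<And>k. k \<in> I \<Longrightarrow> \<phi> k \<in> V" by auto
  have L: "lin_comb I \<phi> c \<in> V" for c by (rule lin_comb_mem[OF insert(1) V(2)])
  obtain c where c: "\<And>k. k \<in> I \<Longrightarrow> ip (\<lambda>x. w x - lin_comb I \<phi> c x) (\<phi> k) = 0"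
    using insert.IH[OF V(2) insert.prems(2)] by auto
  obtain e where e: "\<And>k. k \<in> I \<Longrightarrow> ip (\<lambda>x. \<phi> j x - lin_comb I \<phi> e x) (\<phi> k) = 0"
    using insert.IH[OF V(2) V(1)] by auto
  define v where "v = (\<lambda>x. w x - lin_comb I \<phi> c x)"
  define p where "p = (\<lambda>x. \<phi> j x - lin_comb I \<phi> e x)"
  have v: "v \<in> V" unfolding v_def using lin_mem[OF insert.prems(2) L, of 1 "-1"] by simp
  have p: "p \<in> V" unfolding p_def using lin_mem[OF V(1) L, of 1 "-1"] by simp
  obtain t where t: "ip (\<lambda>x. 1 * v x + (-t) * p x) p = 0"
      "\<And>k. k \<in> I \<Longrightarrow> ip (\<lambda>x. 1 * v x + (-t) * p x) (\<phi> k) = 0"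
    using gram_schmidt_step[where \<phi>=\<phi>, OF insert(1) V(2) p _ v] e c unfolding v_def p_def by blast
  define u where "u = (\<lambda>x. 1 * v x + (-t) * p x)"
  have u: "u \<in> V" unfolding u_def by (rule lin_mem[OF v p])
  have uj: "ip u (\<phi> j) = 0"
  proof -
    have "\<phi> j = (\<lambda>x. 1 * p x + 1 * lin_comb I \<phi> e x)" by (simp add: p_def)
    then have "ip u (\<phi> j) = ip u p + ip u (lin_comb I \<phi> e)"
      using lin_right[OF p L[of e] u, of 1 1] by simp
    then show ?thesis using t(1) orthogonal_lin_comb[OF insert(1) V(2) u] t(2) by (simp add: u_def)
  qed
  \<comment> \<open>Removing \<open>t\<close> times the residual of the new vector subtracts
    \<open>t\<close> times that vector and adds back \<open>t\<close> times its projection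
    \<open>e\<close>.\<close>
  define c' where "c' k = (if k = j then t else 1 * c k + (-t) * e k)" for k
  have "u = (\<lambda>x. w x - lin_comb (insert j I) \<phi> c' x)"
  proof
    fix x
    have "lin_comb I \<phi> c' = lin_comb I \<phi> (\<lambda>k. 1 * c k + (-t) * e k)"
      using insert(2) by (intro lin_comb_cong) (auto simp: c'_def)
    then have "lin_comb I \<phi> c' x = 1 * lin_comb I \<phi> c x + (-t) * lin_comb I \<phi> e x"
      by (simp only: lin_comb_combine)
    then have "lin_comb (insert j I) \<phi> c' x = t * \<phi> j x + lin_comb I \<phi> c x - t * lin_comb I \<phi> e x"
      using insert by (simp add: lin_comb_insert c'_def)
    then show "u x = w x - lin_comb (insert j I) \<phi> c' x"
      by (simp add: u_def v_def p_def algebra_simps)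
  qed
  moreover have "\<forall>k\<in>insert j I. ip u (\<phi> k) = 0" using uj t(2) by (auto simp: u_def)
  ultimately show ?case by blast
qed simp

text \<open>Equivalence of norms on a finite span, obtained by adding one vector at a time instead
  of by compactness. \<open>Bd M f\<close> expresses that a seminorm of \<open>f\<close> is at most
  \<open>M\<close>; as a relation it can be \<open>lip_bounded\<close>, with no least constant to be
  named.\<close>

lemma norm_bound_on_span:
  fixes Bd :: "real \<Rightarrow> ('a \<Rightarrow> real) \<Rightarrow> bool"
  assumes Bd_lin: "\<And>M M' f g a b. Bd M f \<Longrightarrow> Bd M' g \<Longrightarrow> Bd (\<bar>a\<bar> * M + \<bar>b\<bar> * M') (\<lambda>x. a * f x + b * g x)"
    and Bd_mono: "\<And>M M' f. Bd M f \<Longrightarrow> M \<le> M' \<Longrightarrow> Bd M' f"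
    and Bd_ex: "\<And>f. f \<in> V \<Longrightarrow> \<exists>M\<ge>0. Bd M f"
    and Bd_null: "\<And>f. f \<in> V \<Longrightarrow> ip f f = 0 \<Longrightarrow> Bd 0 f"
    and I: "finite I" "\<And>k. k \<in> I \<Longrightarrow> \<phi> k \<in> V"
  shows "\<exists>K\<ge>0. \<forall>c. Bd (K * sqrt (ip (lin_comb I \<phi> c) (lin_comb I \<phi> c))) (lin_comb I \<phi> c)"
  using I
proof (induction I)
  case empty
  have "ip (\<lambda>x. 0) (\<lambda>x. 0) = 0" using lin[OF zero_mem zero_mem zero_mem, of 0 0] by simp
  then show ?case using Bd_null[OF zero_mem] by (auto simp: lin_comb_def)
next
  case (insert j I)
  then have V: "\<phi> j \<in> V" "\<And>k. k \<in> I \<Longrightarrow> \<phi> k \<in> V" by auto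
  have L: "lin_comb I \<phi> c \<in> V" for c by (rule lin_comb_mem[OF insert(1) V(2)])
  obtain K where K: "0 \<le> K" "\<And>c. Bd (K * sqrt (ip (lin_comb I \<phi> c) (lin_comb I \<phi> c))) (lin_comb I \<phi> c)"
    using insert.IH[OF V(2)] by auto
  obtain e where e: "\<And>k. k \<in> I \<Longrightarrow> ip (\<lambda>x. \<phi> j x - lin_comb I \<phi> e x) (\<phi> k) = 0"
    using projection_exists[where \<phi>=\<phi>, OF insert(1) V(2) V(1)] by auto
  define p where "p = (\<lambda>x. \<phi> j x - lin_comb I \<phi> e x)"
  have p: "p \<in> V" unfolding p_def using lin_mem[OF V(1) L, of 1 "-1"] by simp
  \<comment> \<open>With \<open>p\<close> orthogonal to the old span, the form splits by Pythagoras
    while \<open>Bd\<close> needs only the triangle inequality.\<close>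
  have split: "\<exists>g. g \<in> V \<and> Bd (K * sqrt (ip g g)) g \<and> lin_comb (insert j I) \<phi> c = (\<lambda>x. c j * p x + 1 * g x) \<and>
     ip (lin_comb (insert j I) \<phi> c) (lin_comb (insert j I) \<phi> c) = (c j)\<^sup>2 * ip p p + ip g g" for c
  proof -
    define g where "g = lin_comb I \<phi> (\<lambda>k. 1 * c k + c j * e k)"
    have g: "g \<in> V" unfolding g_def by (rule L)
    have eq: "lin_comb (insert j I) \<phi> c = (\<lambda>x. c j * p x + 1 * g x)"
    proof
      fix x
      have "g x = 1 * lin_comb I \<phi> c x + c j * lin_comb I \<phi> e x"
        unfolding g_def by (simp only: lin_comb_combine)
      then show "lin_comb (insert j I) \<phi> c x = c j * p x + 1 * g x"
        using insert by (simp add: lin_comb_insert p_def algebra_simps)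
    qed
    have pg: "ip p g = 0" unfolding g_def
      using e by (intro orthogonal_lin_comb[OF insert(1) V(2) p]) (auto simp: p_def)
    have gp: "ip g p = 0" using pg sym[OF p g] by simp
    have "ip (lin_comb (insert j I) \<phi> c) (lin_comb (insert j I) \<phi> c) = (c j)\<^sup>2 * ip p p + ip g g"
      unfolding eq using pg gp
      by (simp only: lin[OF p g lin_mem[OF p g]] lin_right[OF p g p] lin_right[OF p g g]) (simp add: power2_eq_square)
    moreover have "Bd (K * sqrt (ip g g)) g" unfolding g_def by (rule K(2))
    ultimately show ?thesis using g eq by blast
  qed
  show ?case
  proof (cases "ip p p = 0")
    \<comment> \<open>A null residual has bound 0, so the old constant still works.\<close>
    case True
    have "Bd (K * sqrt (ip (lin_comb (insert j I) \<phi> c) (lin_comb (insert j I) \<phi> c))) (lin_comb (insert j I) \<phi> c)" for c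
    proof -
      obtain g where g: "g \<in> V" "Bd (K * sqrt (ip g g)) g" "lin_comb (insert j I) \<phi> c = (\<lambda>x. c j * p x + 1 * g x)"
        "ip (lin_comb (insert j I) \<phi> c) (lin_comb (insert j I) \<phi> c) = (c j)\<^sup>2 * ip p p + ip g g"
        using split by blast
      show ?thesis
        using Bd_lin[OF Bd_null[OF p True] g(2), of "c j" 1] g(3,4) True by simp
    qed
    then show ?thesis using K(1) by blast
  next
    case False
    then have pp: "0 < ip p p" using nonneg[OF p] by simp
    obtain M where M: "0 \<le> M" "Bd M p" using Bd_ex[OF p] by blast
    \<comment> \<open>By Pythagoras both \<open>\<bar>c j\<bar> * sqrt (ip p p)\<close> and
      \<open>sqrt (ip g g)\<close> are at most the root of the whole form; this explains the two
      summands of the constant.\<close>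
    have "Bd ((M / sqrt (ip p p) + K) * sqrt (ip (lin_comb (insert j I) \<phi> c) (lin_comb (insert j I) \<phi> c)))
        (lin_comb (insert j I) \<phi> c)" for c
    proof -
      obtain g where g: "g \<in> V" "Bd (K * sqrt (ip g g)) g" "lin_comb (insert j I) \<phi> c = (\<lambda>x. c j * p x + 1 * g x)"
        "ip (lin_comb (insert j I) \<phi> c) (lin_comb (insert j I) \<phi> c) = (c j)\<^sup>2 * ip p p + ip g g"
        using split by blast
      define q where "q = (c j)\<^sup>2 * ip p p + ip g g"
      have gg: "0 \<le> ip g g" by (rule nonneg[OF g(1)])
      have "\<bar>c j\<bar> * sqrt (ip p p) = sqrt ((c j)\<^sup>2 * ip p p)" by (simp add: real_sqrt_mult)
      also have "\<dots> \<le> sqrt q" using gg by (simp add: q_def)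
      finally have "M / sqrt (ip p p) * (\<bar>c j\<bar> * sqrt (ip p p)) \<le> M / sqrt (ip p p) * sqrt q"
        using M pp by (intro mult_left_mono) auto
      then have 1: "\<bar>c j\<bar> * M \<le> M / sqrt (ip p p) * sqrt q" using pp by (simp add: field_simps)
      have "ip g g \<le> q" using pp by (simp add: q_def)
      then have "K * sqrt (ip g g) \<le> K * sqrt q" using K(1) by (intro mult_left_mono) auto
      then have "\<bar>c j\<bar> * M + \<bar>1\<bar> * (K * sqrt (ip g g)) \<le> (M / sqrt (ip p p) + K) * sqrt q"
        using 1 by (simp add: distrib_right)
      from Bd_mono[OF Bd_lin[OF M(2) g(2), of "c j" 1] this] show ?thesis
        unfolding g(4) q_def[symmetric] unfolding g(3) .
    qed
    moreover have "0 \<le> M / sqrt (ip p p) + K" using M K(1) pp by simp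
    ultimately show ?thesis by blast
  qed
qed

end

section \<open>Polynomials as Lipschitz functions on the ball\<close>

lemma lip_bounded_lin:
  assumes "lip_bounded S M f" "lip_bounded S M' g"
  shows "lip_bounded S (\<bar>a\<bar> * M + \<bar>b\<bar> * M') (\<lambda>x. a * f x + b * g x)"
  unfolding lip_bounded_def
proof (intro conjI ballI)
  fix y assume "y \<in> S"
  then have "\<bar>f y\<bar> \<le> M" "\<bar>g y\<bar> \<le> M'" using assms by (auto simp: lip_bounded_def)
  then have "\<bar>a\<bar> * \<bar>f y\<bar> + \<bar>b\<bar> * \<bar>g y\<bar> \<le> \<bar>a\<bar> * M + \<bar>b\<bar> * M'" by (intro add_mono mult_left_mono) auto
  then show "\<bar>a * f y + b * g y\<bar> \<le> \<bar>a\<bar> * M + \<bar>b\<bar> * M'"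
    using abs_triangle_ineq[of "a * f y" "b * g y"] by (simp add: abs_mult)
next
  fix y y' assume "y \<in> S" "y' \<in> S"
  then have "\<bar>f y - f y'\<bar> \<le> M * norm (y - y')" "\<bar>g y - g y'\<bar> \<le> M' * norm (y - y')"
    using assms by (auto simp: lip_bounded_def)
  then have "\<bar>a\<bar> * \<bar>f y - f y'\<bar> + \<bar>b\<bar> * \<bar>g y - g y'\<bar> \<le> \<bar>a\<bar> * (M * norm (y - y')) + \<bar>b\<bar> * (M' * norm (y - y'))"
    by (intro add_mono mult_left_mono) auto
  then have *: "\<bar>a\<bar> * \<bar>f y - f y'\<bar> + \<bar>b\<bar> * \<bar>g y - g y'\<bar> \<le> (\<bar>a\<bar> * M + \<bar>b\<bar> * M') * norm (y - y')"
    by (simp add: algebra_simps)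
  have "a * f y + b * g y - (a * f y' + b * g y') = a * (f y - f y') + b * (g y - g y')"
    by (simp add: algebra_simps)
  then have "\<bar>a * f y + b * g y - (a * f y' + b * g y')\<bar> \<le> \<bar>a\<bar> * \<bar>f y - f y'\<bar> + \<bar>b\<bar> * \<bar>g y - g y'\<bar>"
    using abs_triangle_ineq[of "a * (f y - f y')" "b * (g y - g y')"] by (simp only: abs_mult)
  with * show "\<bar>a * f y + b * g y - (a * f y' + b * g y')\<bar> \<le> (\<bar>a\<bar> * M + \<bar>b\<bar> * M') * norm (y - y')"
    by (rule order_trans[rotated])
qed

lemma lip_bounded_mono:
  assumes "lip_bounded S M f" "M \<le> M'" shows "lip_bounded S M' f"
  unfolding lip_bounded_def
proof (intro conjI ballI)
  show "\<bar>f y\<bar> \<le> M'" if "y \<in> S" for y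
    using that assms unfolding lip_bounded_def by fastforce
  show "\<bar>f y - f y'\<bar> \<le> M' * norm (y - y')" if "y \<in> S" "y' \<in> S" for y y'
    using that assms mult_right_mono[OF assms(2) norm_ge_zero[of "y - y'"]] unfolding lip_bounded_def by fastforce
qed

text \<open>The factor 2 comes from the two terms of the product rule in the Lipschitz part.\<close>

lemma lip_bounded_mult:
  assumes f: "lip_bounded S M f" and g: "lip_bounded S M' g" and "0 \<le> M" "0 \<le> M'"
  shows "lip_bounded S (2 * M * M') (\<lambda>x. f x * g x)"
  unfolding lip_bounded_def
proof (intro conjI ballI)
  fix y assume y: "y \<in> S"
  have "\<bar>f y * g y\<bar> \<le> M * M'"
    unfolding abs_mult using f g y assms(3,4) by (intro mult_mono) (auto simp: lip_bounded_def)
  also have "\<dots> \<le> 2 * M * M'" using assms(3,4) by simp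
  finally show "\<bar>f y * g y\<bar> \<le> 2 * M * M'" .
next
  fix y y' assume y: "y \<in> S" "y' \<in> S"
  have "\<bar>f y * g y - f y' * g y'\<bar> = \<bar>f y * (g y - g y') + (f y - f y') * g y'\<bar>" by (simp add: algebra_simps)
  also have "\<dots> \<le> \<bar>f y\<bar> * \<bar>g y - g y'\<bar> + \<bar>f y - f y'\<bar> * \<bar>g y'\<bar>"
    by (rule order_trans[OF abs_triangle_ineq]) (simp add: abs_mult)
  also have "\<dots> \<le> M * (M' * norm (y - y')) + M * norm (y - y') * M'"
    using f g y assms(3,4) by (intro add_mono mult_mono) (auto simp: lip_bounded_def)
  also have "\<dots> = 2 * M * M' * norm (y - y')" by simp
  finally show "\<bar>f y * g y - f y' * g y'\<bar> \<le> 2 * M * M' * norm (y - y')" .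
qed

lemma lip_bounded_const: "lip_bounded S \<bar>c\<bar> (\<lambda>x. c)"
  by (auto simp: lip_bounded_def)

lemma lip_bounded_prod:
  assumes "finite I" "\<And>i. i \<in> I \<Longrightarrow> \<exists>M\<ge>0. lip_bounded S M (f i)"
  shows "\<exists>M\<ge>0. lip_bounded S M (\<lambda>x. \<Prod>i\<in>I. f i x)"
  using assms
proof (induction I)
  case empty
  then show ?case using lip_bounded_const[of S 1] by (intro exI[of _ 1]) auto
next
  case (insert i I)
  obtain M where M: "0 \<le> M" "lip_bounded S M (f i)" using insert.prems by blast
  obtain M' where M': "0 \<le> M'" "lip_bounded S M' (\<lambda>x. \<Prod>i\<in>I. f i x)" using insert by blast
  have "lip_bounded S (2 * M * M') (\<lambda>x. f i x * (\<Prod>i\<in>I. f i x))"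
    by (rule lip_bounded_mult[OF M(2) M'(2) M(1) M'(1)])
  then show ?case using M M' insert.hyps by (intro exI[of _ "2 * M * M'"]) simp
qed

lemma lip_bounded_power:
  assumes "\<exists>M\<ge>0. lip_bounded S M f" shows "\<exists>M\<ge>0. lip_bounded S M (\<lambda>x. f x ^ (k::nat))"
proof -
  have "\<exists>M\<ge>0. lip_bounded S M (\<lambda>x. \<Prod>i\<in>{..<k}. f x)" by (rule lip_bounded_prod) (use assms in auto)
  then show ?thesis by (simp only: prod_constant card_lessThan)
qed

section \<open>Monomials and polynomials of bounded degree\<close>

definition monomial :: "('n \<Rightarrow> nat) \<Rightarrow> real^'n \<Rightarrow> real" where
  "monomial \<alpha> z = (\<Prod>i\<in>UNIV. (z $ i) ^ \<alpha> i)"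

definition multi_indices :: "nat \<Rightarrow> ('n::finite \<Rightarrow> nat) set" where
  "multi_indices m = {\<alpha>. (\<Sum>i\<in>UNIV. \<alpha> i) \<le> m}"

lemma finite_multi_indices: "finite (multi_indices m :: ('n::finite \<Rightarrow> nat) set)"
proof -
  have "\<alpha> i \<le> m" if "(\<Sum>i\<in>UNIV. \<alpha> i) \<le> m" for \<alpha> :: "'n \<Rightarrow> nat" and i
    using member_le_sum[of i UNIV \<alpha>] that by simp
  then have "(multi_indices m :: ('n \<Rightarrow> nat) set) \<subseteq> PiE UNIV (\<lambda>_. {..m})" by (auto simp: multi_indices_def)
  then show ?thesis by (rule finite_subset) (intro finite_PiE, auto)
qed

lemma poly_deg_le_lin_comb: "poly_deg_le m p \<longleftrightarrow> (\<exists>c. p = lin_comb (multi_indices m) monomial c)"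
  by (auto simp: poly_deg_le_def lin_comb_def monomial_def multi_indices_def fun_eq_iff)

lemma poly_deg_le_lin:
  assumes "poly_deg_le m p" "poly_deg_le m q" shows "poly_deg_le m (\<lambda>z. a * p z + b * q z)"
proof -
  obtain c e where "p = lin_comb (multi_indices m) monomial c" "q = lin_comb (multi_indices m) monomial e"
    using assms unfolding poly_deg_le_lin_comb by blast
  then have "(\<lambda>z. a * p z + b * q z) = lin_comb (multi_indices m) monomial (\<lambda>k. a * c k + b * e k)"
    by (simp only: lin_comb_combine)
  then show ?thesis unfolding poly_deg_le_lin_comb by blast
qed

lemma poly_deg_le_monomial:
  assumes "\<alpha> \<in> multi_indices m" shows "poly_deg_le m (monomial \<alpha>)"
proof -
  have "monomial \<alpha> = lin_comb (multi_indices m) monomial (\<lambda>\<beta>. if \<beta> = \<alpha> then 1 else 0)"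
  proof
    fix z :: "real^'a"
    have "lin_comb (multi_indices m) monomial (\<lambda>\<beta>. if \<beta> = \<alpha> then 1 else 0) z
       = (\<Sum>\<beta>\<in>multi_indices m. if \<beta> = \<alpha> then monomial \<beta> z else 0)"
      unfolding lin_comb_def by (rule sum.cong) auto
    then show "monomial \<alpha> z = lin_comb (multi_indices m) monomial (\<lambda>\<beta>. if \<beta> = \<alpha> then 1 else 0) z"
      using assms by (simp add: finite_multi_indices)
  qed
  then show ?thesis unfolding poly_deg_le_lin_comb by blast
qed

lemma poly_deg_le_const: "poly_deg_le m (\<lambda>z. c)"
proof -
  have one: "monomial (\<lambda>_. 0) = (\<lambda>z. 1)" by (simp add: monomial_def fun_eq_iff)
  have "poly_deg_le m (monomial (\<lambda>_. 0))"
    by (rule poly_deg_le_monomial) (simp add: multi_indices_def)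
  from poly_deg_le_lin[OF this this, of c 0] show ?thesis by (simp add: one)
qed

lemma monomial_single:
  fixes i :: "'n::finite"
  shows "monomial (\<lambda>j. if j = i then k else 0) = (\<lambda>z. (z $ i) ^ k)"
proof (rule ext)
  fix z :: "real^'n"
  have eq: "(z $ j) ^ (if j = i then k else 0) = (if j = i then (z $ j) ^ k else 1)" for j
    by (cases "j = i") simp_all
  show "monomial (\<lambda>j. if j = i then k else 0) z = (z $ i) ^ k"
    unfolding monomial_def eq by (rule trans[OF prod.delta]) simp_all
qed

lemma poly_deg_le_coord_power:
  fixes i :: "'n::finite"
  assumes "k \<le> m" shows "poly_deg_le m (\<lambda>z. (z $ i) ^ k)"
proof -
  have "(\<lambda>j. if j = i then k else 0) \<in> multi_indices m"
    using assms by (simp add: multi_indices_def)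
  from poly_deg_le_monomial[OF this] show ?thesis unfolding monomial_single .
qed

lemma monomial_lip_bounded: "\<exists>M\<ge>0. lip_bounded (ball 0 \<delta>) M (monomial \<alpha>)"
proof -
  have c: "\<exists>M\<ge>0. lip_bounded (ball 0 \<delta>) M (\<lambda>z::real^'n. z $ i)" for i
  proof -
    \<comment> \<open>On the ball a coordinate is bounded by \<delta> and has Lipschitz constant 1;
      \<open>L\<close> dominates both.\<close>
    define L where "L = max \<delta> 1"
    have L: "\<delta> \<le> L" "1 \<le> L" by (auto simp: L_def)
    have "\<bar>z $ i\<bar> \<le> L" if "z \<in> ball 0 \<delta>" for z :: "real^'n"
      using that component_le_norm_cart[of z i] L by simp
    moreover have "\<bar>z $ i - y $ i\<bar> \<le> L * norm (z - y)" for z y :: "real^'n"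
      using component_le_norm_cart[of "z - y" i] mult_right_mono[OF L(2) norm_ge_zero[of "z - y"]] by simp
    ultimately have "lip_bounded (ball 0 \<delta>) L (\<lambda>z::real^'n. z $ i)" unfolding lip_bounded_def by blast
    then show ?thesis using L by (intro exI[of _ L]) simp
  qed
  show ?thesis unfolding monomial_def[abs_def]
    by (intro lip_bounded_prod lip_bounded_power c finite)
qed

section \<open>The kernel-weighted inner product on the ball\<close>

lemma semi_inner_ball:
  assumes s: "0 \<le> s" "s < real CARD('n)" and \<delta>: "0 < \<delta>"
  shows "semi_inner {F. \<exists>M. lip_bounded (ball (0::real^'n) \<delta>) M F}
    (\<lambda>f g. integral (ball 0 \<delta>) (\<lambda>y. norm y powr -s * (f y * g y)))"
proof -
  have nn: "0 \<le> M" if "lip_bounded (ball (0::real^'n) \<delta>) M F" for M F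
    using that \<delta> unfolding lip_bounded_def by (meson abs_ge_zero centre_in_ball order_trans)
  have int: "(\<lambda>y. norm y powr -s * (f y * g y)) integrable_on ball 0 \<delta>"
    if fg: "\<exists>M. lip_bounded (ball (0::real^'n) \<delta>) M f" "\<exists>M. lip_bounded (ball (0::real^'n) \<delta>) M g" for f g
  proof -
    obtain M M' where "lip_bounded (ball 0 \<delta>) M f" "lip_bounded (ball 0 \<delta>) M' g" using fg by blast
    then have "lip_bounded (ball 0 \<delta>) (2 * M * M') (\<lambda>y. f y * g y)" by (intro lip_bounded_mult) (auto dest: nn)
    from powr_times_lip_bounded_integrable[OF s \<delta> this] show ?thesis
      by (rule set_lebesgue_integral_eq_integral(1))
  qed
  show ?thesis
  proof
    show "(\<lambda>x. 0) \<in> {F. \<exists>M. lip_bounded (ball (0::real^'n) \<delta>) M F}" using lip_bounded_const[of _ 0] by blast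
  next
    fix f g :: "real^'n \<Rightarrow> real" and a b
    assume "f \<in> {F. \<exists>M. lip_bounded (ball 0 \<delta>) M F}" "g \<in> {F. \<exists>M. lip_bounded (ball 0 \<delta>) M F}"
    then obtain M M' where "lip_bounded (ball 0 \<delta>) M f" "lip_bounded (ball 0 \<delta>) M' g" by blast
    from lip_bounded_lin[OF this, of a b]
    show "(\<lambda>x. a * f x + b * g x) \<in> {F. \<exists>M. lip_bounded (ball 0 \<delta>) M F}" by blast
  next
    fix f g :: "real^'n \<Rightarrow> real"
    show "integral (ball 0 \<delta>) (\<lambda>y. norm y powr -s * (f y * g y)) = integral (ball 0 \<delta>) (\<lambda>y. norm y powr -s * (g y * f y))"
      by (rule arg_cong[where f="integral (ball 0 \<delta>)"]) (rule ext, simp)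
  next
    fix f g k :: "real^'n \<Rightarrow> real" and a b
    assume "f \<in> {F. \<exists>M. lip_bounded (ball 0 \<delta>) M F}" "g \<in> {F. \<exists>M. lip_bounded (ball 0 \<delta>) M F}"
      "k \<in> {F. \<exists>M. lip_bounded (ball 0 \<delta>) M F}"
    then have i: "(\<lambda>y. norm y powr -s * (f y * k y)) integrable_on ball 0 \<delta>"
       "(\<lambda>y. norm y powr -s * (g y * k y)) integrable_on ball 0 \<delta>" using int by auto
    have "integral (ball 0 \<delta>) (\<lambda>y. norm y powr -s * ((a * f y + b * g y) * k y))
       = integral (ball 0 \<delta>) (\<lambda>y. a * (norm y powr -s * (f y * k y)) + b * (norm y powr -s * (g y * k y)))"
      by (simp add: algebra_simps)
    also have "\<dots> = a * integral (ball 0 \<delta>) (\<lambda>y. norm y powr -s * (f y * k y)) + b * integral (ball 0 \<delta>) (\<lambda>y. norm y powr -s * (g y * k y))"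
      using i by (subst integral_add) (auto intro: integrable_on_mult_right)
    finally show "integral (ball 0 \<delta>) (\<lambda>y. norm y powr -s * ((a * f y + b * g y) * k y)) =
       a * integral (ball 0 \<delta>) (\<lambda>y. norm y powr -s * (f y * k y)) + b * integral (ball 0 \<delta>) (\<lambda>y. norm y powr -s * (g y * k y))" .
  next
    fix f :: "real^'n \<Rightarrow> real" assume "f \<in> {F. \<exists>M. lip_bounded (ball 0 \<delta>) M F}"
    then show "0 \<le> integral (ball 0 \<delta>) (\<lambda>y. norm y powr -s * (f y * f y))"
      using int by (intro integral_nonneg) auto
  qed
qed

text \<open>The integrand is nonnegative, so it vanishes almost everywhere; the set where the
  continuous \<open>f\<close> is nonzero is then open and negligible, hence empty.\<close>

lemma ball_null_imp_zero:
  assumes s: "0 \<le> s" "s < real CARD('n)" and \<delta>: "0 < \<delta>"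
    and f: "lip_bounded (ball (0::real^'n) \<delta>) M f"
    and z: "integral (ball 0 \<delta>) (\<lambda>y. norm y powr -s * (f y * f y)) = 0" and y: "y \<in> ball 0 \<delta>"
  shows "f y = 0"
proof -
  have M: "0 \<le> M" using f \<delta> unfolding lip_bounded_def by (meson abs_ge_zero centre_in_ball order_trans)
  have "lip_bounded (ball 0 \<delta>) (2 * M * M) (\<lambda>y. f y * f y)" by (rule lip_bounded_mult[OF f f M M])
  from powr_times_lip_bounded_integrable[OF s \<delta> this]
  have ai: "(\<lambda>y. norm y powr -s * (f y * f y)) absolutely_integrable_on ball 0 \<delta>" .
  have "(LINT y|lebesgue. indicator (ball 0 \<delta>) y *\<^sub>R (norm y powr -s * (f y * f y))) = 0"
    using set_lebesgue_integral_eq_integral(2)[OF ai] z by (simp add: set_lebesgue_integral_def)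
  moreover have "AE y in lebesgue. 0 \<le> indicator (ball 0 \<delta>) y *\<^sub>R (norm y powr -s * (f y * f y))"
    by (intro AE_I2) (auto simp: indicator_def)
  ultimately have "AE y in lebesgue. indicator (ball 0 \<delta>) y *\<^sub>R (norm y powr -s * (f y * f y)) = 0"
    using integral_nonneg_eq_0_iff_AE[of lebesgue] ai unfolding set_integrable_def by blast
  then obtain X where X: "X \<in> null_sets lebesgue"
    "{y. indicator (ball 0 \<delta>) y *\<^sub>R (norm y powr -s * (f y * f y)) \<noteq> 0} \<subseteq> X"
    by (auto simp: eventually_ae_filter)
  have "{y \<in> ball 0 \<delta>. norm y powr -s * (f y * f y) \<noteq> 0} \<subseteq> X" using X(2) by auto
  then have neg: "negligible {y \<in> ball 0 \<delta>. norm y powr -s * (f y * f y) \<noteq> 0}"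
    using X(1) negligible_subset negligible_iff_null_sets by blast
  have op: "open {y \<in> ball 0 \<delta>. f y \<noteq> 0}"
  proof -
    have "open (ball 0 \<delta> \<inter> f -` (- {0}))"
      by (rule continuous_open_preimage[OF lip_bounded_continuous_on[OF f] open_ball]) (simp add: open_Compl)
    moreover have "ball 0 \<delta> \<inter> f -` (- {0}) = {y \<in> ball 0 \<delta>. f y \<noteq> 0}" by blast
    ultimately show ?thesis by simp
  qed
  \<comment> \<open>The convention \<open>0 powr -s = 0\<close> makes the weight vanish at the
    origin, so that point is added as a null set of its own.\<close>
  have "{y \<in> ball 0 \<delta>. f y \<noteq> 0} \<subseteq> {0} \<union> {y \<in> ball 0 \<delta>. norm y powr -s * (f y * f y) \<noteq> 0}" by auto
  then have "negligible {y \<in> ball 0 \<delta>. f y \<noteq> 0}"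
    by (rule negligible_subset[rotated]) (intro negligible_Un neg negligible_sing)
  then have "{y \<in> ball 0 \<delta>. f y \<noteq> 0} = {}" using open_not_negligible[OF op] by blast
  then show ?thesis using y by blast
qed

section \<open>Quadrature with polynomial weights\<close>

text \<open>The comparison norm is an integral over the ball and not a sum over a grid, so
  \<open>K\<close> depends on neither the mesh nor the weights.\<close>

lemma poly_norm_equivalence:
  assumes s: "0 \<le> s" "s < real CARD('n)" and \<delta>: "0 < \<delta>"
  obtains K where "0 \<le> K" "\<And>p. poly_deg_le m p \<Longrightarrow>
    lip_bounded (ball (0::real^'n) \<delta>) (K * sqrt (integral (ball 0 \<delta>) (\<lambda>y. norm y powr -s * (p y * p y)))) p"
proof -
  interpret semi_inner "{F. \<exists>M. lip_bounded (ball (0::real^'n) \<delta>) M F}"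
      "\<lambda>f g. integral (ball 0 \<delta>) (\<lambda>y. norm y powr -s * (f y * g y))"
    by (rule semi_inner_ball[OF s \<delta>])
  have "\<exists>K\<ge>0. \<forall>c. lip_bounded (ball (0::real^'n) \<delta>)
     (K * sqrt (integral (ball 0 \<delta>) (\<lambda>y. norm y powr -s *
        (lin_comb (multi_indices m) monomial c y * lin_comb (multi_indices m) monomial c y))))
     (lin_comb (multi_indices m) monomial c)"
  proof (rule norm_bound_on_span)
    show "\<exists>M\<ge>0. lip_bounded (ball (0::real^'n) \<delta>) M f" if "f \<in> {F. \<exists>M. lip_bounded (ball (0::real^'n) \<delta>) M F}" for f
    proof -
      obtain M where "lip_bounded (ball (0::real^'n) \<delta>) M f" using \<open>f \<in> _\<close> by blast
      from lip_bounded_mono[OF this, of "\<bar>M\<bar>"] show ?thesis by (intro exI[of _ "\<bar>M\<bar>"]) simp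
    qed
    show "lip_bounded (ball (0::real^'n) \<delta>) 0 f"
      if f: "f \<in> {F. \<exists>M. lip_bounded (ball (0::real^'n) \<delta>) M F}"
        and z: "integral (ball 0 \<delta>) (\<lambda>y. norm y powr -s * (f y * f y)) = 0" for f
    proof -
      obtain M where M: "lip_bounded (ball (0::real^'n) \<delta>) M f" using f by blast
      show ?thesis unfolding lip_bounded_def using ball_null_imp_zero[OF s \<delta> M z] by simp
    qed
    show "finite (multi_indices m :: ('n \<Rightarrow> nat) set)" by (rule finite_multi_indices)
    show "monomial k \<in> {F. \<exists>M. lip_bounded (ball (0::real^'n) \<delta>) M F}" for k
      using monomial_lip_bounded[of \<delta> k] by blast
  qed (fact lip_bounded_lin lip_bounded_mono)+
  then obtain K where K: "0 \<le> K" "\<And>c. lip_bounded (ball (0::real^'n) \<delta>)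
     (K * sqrt (integral (ball 0 \<delta>) (\<lambda>y. norm y powr -s *
        (lin_comb (multi_indices m) monomial c y * lin_comb (multi_indices m) monomial c y))))
     (lin_comb (multi_indices m) monomial c)" by blast
  show thesis
  proof (rule that[OF K(1)])
    fix p :: "real^'n \<Rightarrow> real" assume "poly_deg_le m p"
    then obtain c where "p = lin_comb (multi_indices m) monomial c" unfolding poly_deg_le_lin_comb by blast
    then show "lip_bounded (ball (0::real^'n) \<delta>) (K * sqrt (integral (ball 0 \<delta>) (\<lambda>y. norm y powr -s * (p y * p y)))) p"
      using K(2)[of c] by (simp only:)
  qed
qed

text \<open>
  With weights \<open>h\<^sup>d (1 + Q)\<close>, exactness says that testing \<open>Q\<close> against a polynomial \<open>p\<close> gives the error of
  the Riemann sum for \<open>p\<close>; testing against \<open>Q\<close> itself bounds \<open>Q\<close>.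
\<close>

lemma polynomial_quadrature_error:
  assumes s: "0 \<le> s" "s < real CARD('n)" and \<delta>: "0 < \<delta>"
  defines "\<alpha> \<equiv> min 1 (real CARD('n) - s)"
  obtains C h0 where "0 \<le> C" "0 < h0" "\<And>h w P N G. 0 < h \<Longrightarrow> h < h0 \<Longrightarrow> poly_deg_le m P \<Longrightarrow>
     (\<And>z. z \<in> lattice h \<inter> ball (0::real^'n) \<delta> - {0} \<Longrightarrow> w z = P z) \<Longrightarrow>
     (\<And>p. poly_deg_le m p \<Longrightarrow> (\<Sum>z\<in>lattice h \<inter> ball 0 \<delta> - {0}. norm z powr -s * (p z * w z))
         = integral (ball 0 \<delta>) (\<lambda>y. norm y powr -s * p y)) \<Longrightarrow> 0 \<le> N \<Longrightarrow>
     lip_bounded (ball 0 \<delta>) N G \<Longrightarrow>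
     \<bar>(\<Sum>z\<in>lattice h \<inter> ball 0 \<delta> - {0}. norm z powr -s * (G z * w z))
        - integral (ball 0 \<delta>) (\<lambda>y. norm y powr -s * G y)\<bar> \<le> C * N * h powr \<alpha>"
proof -
  let ?K = "\<lambda>y::real^'n. norm y powr -s"
  define int where "int F = integral (ball 0 \<delta>) (\<lambda>y. ?K y * F y)" for F
  define S where "S h = lattice h \<inter> ball (0::real^'n) \<delta> - {0}" for h
  define T where "T h F = h ^ CARD('n) * (\<Sum>z\<in>S h. ?K z * F z)" for h and F :: "real^'n \<Rightarrow> real"
  obtain C where C: "0 \<le> C" "\<And>h N F. 0 < h \<Longrightarrow> 2 * real CARD('n) * h \<le> \<delta> \<Longrightarrow> 0 \<le> N \<Longrightarrow>
     lip_bounded (ball (0::real^'n) \<delta>) N F \<Longrightarrow> \<bar>int F - T h F\<bar> \<le> C * N * h powr \<alpha>"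
    using riemann_sum_error[OF s \<delta>] unfolding \<alpha>_def int_def T_def S_def by blast
  obtain K where K: "0 \<le> K" "\<And>p. poly_deg_le m p \<Longrightarrow>
      lip_bounded (ball (0::real^'n) \<delta>) (K * sqrt (int (\<lambda>y. p y * p y))) p"
    using poly_norm_equivalence[OF s \<delta>] unfolding int_def by blast
  have \<alpha>: "0 < \<alpha>" using s by (simp add: \<alpha>_def)
  define M where "M = int (\<lambda>_. 1) + C * \<delta> powr \<alpha>"
  have int1: "0 \<le> int (\<lambda>_. 1)" unfolding int_def
    using set_lebesgue_integral_eq_integral(1)[OF norm_powr_absolutely_integrable[OF s \<delta>]]
    by (intro integral_nonneg) auto
  have M: "0 \<le> M" using int1 C by (simp add: M_def)
  \<comment> \<open>Chosen so that the Riemann error of \<open>Q * Q\<close>, at most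
    \<open>2 * C * K^2 * n^2 * h powr \<alpha>\<close>, is no more than half of \<open>n^2\<close>
    and can be absorbed; the summand 1 keeps \<open>B\<close> positive.\<close>
  define B where "B = 4 * C * K\<^sup>2 + 1"
  have B: "0 < B" using C by (simp add: B_def add_nonneg_pos)
  \<comment> \<open>The first entry gives \<open>2 * d * h \<le> \<delta>\<close>, which the Riemann
    estimate demands; the second gives \<open>h powr \<alpha> \<le> 1 / B\<close>.\<close>
  define h0 where "h0 = min (\<delta> / (2 * real CARD('n))) ((1 / B) powr (1 / \<alpha>))"
  define D where "D = C + M * (2 * C * K\<^sup>2)"
  show thesis
  proof (rule that)
    show "0 \<le> D" using C M by (simp add: D_def)
    show "0 < h0" using \<delta> B by (simp add: h0_def)
    fix h w P N and G :: "real^'n \<Rightarrow> real"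
    assume h: "0 < h" "h < h0" and P: "poly_deg_le m P"
      and w: "\<And>z. z \<in> lattice h \<inter> ball (0::real^'n) \<delta> - {0} \<Longrightarrow> w z = P z"
      and ex: "\<And>p. poly_deg_le m p \<Longrightarrow> (\<Sum>z\<in>lattice h \<inter> ball 0 \<delta> - {0}. ?K z * (p z * w z))
         = integral (ball 0 \<delta>) (\<lambda>y. ?K y * p y)"
      and N: "0 \<le> N" and G: "lip_bounded (ball 0 \<delta>) N G"
    have d1: "1 \<le> real CARD('n)" by (simp add: Suc_le_eq)
    have "h < \<delta> / (2 * real CARD('n))" using h by (simp add: h0_def)
    then have hd: "2 * real CARD('n) * h \<le> \<delta>" using d1 by (simp add: field_simps)
    have "1 * h \<le> (2 * real CARD('n)) * h" using d1 h by (intro mult_right_mono) linarith+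
    then have "h \<le> \<delta>" using hd by linarith
    then have h\<delta>: "h powr \<alpha> \<le> \<delta> powr \<alpha>" using h \<alpha> by (intro powr_mono2) auto
    have hB: "h powr \<alpha> \<le> 1 / B"
    proof -
      have "h powr \<alpha> \<le> ((1 / B) powr (1 / \<alpha>)) powr \<alpha>"
        using h \<alpha> by (intro powr_mono2) (auto simp: h0_def)
      also have "\<dots> = 1 / B" using \<alpha> B by (simp add: powr_powr)
      finally show ?thesis .
    qed
    define e where "e F = int F - T h F" for F
    have e: "\<bar>e F\<bar> \<le> C * N' * h powr \<alpha>" if "0 \<le> N'" "lip_bounded (ball 0 \<delta>) N' F" for N' F
      unfolding e_def by (rule C(2)[OF h(1) hd that])
    define Q where "Q z = (1 / h ^ CARD('n)) * P z + (-1) * 1" for z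
    have Q: "poly_deg_le m Q" unfolding Q_def by (rule poly_deg_le_lin[OF P poly_deg_le_const])
    have wQ: "w z = h ^ CARD('n) * (1 + Q z)" if "z \<in> S h" for z
      using w that h by (simp add: S_def Q_def)
    have sumw: "(\<Sum>z\<in>S h. ?K z * (F z * w z)) = T h F + T h (\<lambda>z. F z * Q z)" for F
    proof -
      have "(\<Sum>z\<in>S h. ?K z * (F z * w z)) = (\<Sum>z\<in>S h. h ^ CARD('n) * (?K z * F z) + h ^ CARD('n) * (?K z * (F z * Q z)))"
        using wQ by (intro sum.cong) (auto simp: algebra_simps)
      then show ?thesis by (simp add: T_def sum.distrib sum_distrib_left)
    qed
    have exQ: "T h (\<lambda>z. p z * Q z) = e p" if "poly_deg_le m p" for p
      using ex[OF that] sumw[of p] by (simp add: e_def int_def S_def)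
    define n where "n = sqrt (int (\<lambda>y. Q y * Q y))"
    have QK: "lip_bounded (ball 0 \<delta>) (K * n) Q" unfolding n_def by (rule K(2)[OF Q])
    have n0: "0 \<le> int (\<lambda>y. Q y * Q y)"
    proof -
      have Kn: "0 \<le> K * n" using QK \<delta> unfolding lip_bounded_def by (meson abs_ge_zero centre_in_ball order_trans)
      show ?thesis unfolding int_def
        using set_lebesgue_integral_eq_integral(1)[OF powr_times_lip_bounded_integrable[OF s \<delta> lip_bounded_mult[OF QK QK Kn Kn]]]
        by (intro integral_nonneg) auto
    qed
    then have n: "0 \<le> n" "n\<^sup>2 = int (\<lambda>y. Q y * Q y)" by (auto simp: n_def)
    have Kn: "0 \<le> K * n" using K n by simp
    \<comment> \<open>The product \<open>Q * Q\<close> may exceed the degree \<open>m\<close>, but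
      only its Lipschitz bound enters. Its Riemann sum is the pairing of \<open>Q\<close> with
      itself, which exactness turns into the Riemann error of \<open>Q\<close>; that one is linear
      in \<open>n\<close>, so a factor \<open>n\<close> cancels.\<close>
    have "n\<^sup>2 = e (\<lambda>y. Q y * Q y) + T h (\<lambda>y. Q y * Q y)" by (simp add: e_def n)
    also have "T h (\<lambda>y. Q y * Q y) = e Q" by (rule exQ[OF Q])
    also have "e (\<lambda>y. Q y * Q y) + e Q \<le> C * (2 * (K * n) * (K * n)) * h powr \<alpha> + C * (K * n) * h powr \<alpha>"
      using e[OF _ lip_bounded_mult[OF QK QK Kn Kn]] e[OF Kn QK] Kn by fastforce
    also have "C * (2 * (K * n) * (K * n)) * h powr \<alpha> = (2 * C * K\<^sup>2 * n\<^sup>2) * h powr \<alpha>"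
      by (simp add: power2_eq_square)
    also have "\<dots> \<le> (2 * C * K\<^sup>2 * n\<^sup>2) * (1 / B)" using C by (intro mult_left_mono hB) auto
    also have "\<dots> = n\<^sup>2 * ((2 * C * K\<^sup>2) / B)" by simp
    also have "\<dots> \<le> n\<^sup>2 * (1/2)"
      using C B by (intro mult_left_mono) (auto simp: B_def field_simps)
    finally have "n * n \<le> n * (2 * C * K * h powr \<alpha>)" by (simp add: power2_eq_square algebra_simps)
    then have nb: "n \<le> 2 * C * K * h powr \<alpha>"
      using n C K by (cases "n = 0") auto
    have Qb: "\<bar>Q z\<bar> \<le> 2 * C * K\<^sup>2 * h powr \<alpha>" if "z \<in> ball 0 \<delta>" for z
    proof -
      have "\<bar>Q z\<bar> \<le> K * n" using QK that by (simp add: lip_bounded_def)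
      also have "\<dots> \<le> K * (2 * C * K * h powr \<alpha>)" using K by (intro mult_left_mono nb)
      finally show ?thesis by (simp add: power2_eq_square mult_ac)
    qed
    have T1: "T h (\<lambda>_. 1) \<le> M"
    proof -
      have "\<bar>e (\<lambda>_. 1)\<bar> \<le> C * 1 * h powr \<alpha>" using e[of 1 "\<lambda>_. 1"] lip_bounded_const[of "ball (0::real^'n) \<delta>" 1] by simp
      moreover have "C * h powr \<alpha> \<le> C * \<delta> powr \<alpha>" using C by (intro mult_left_mono h\<delta>)
      ultimately show ?thesis by (simp add: e_def M_def)
    qed
    have "\<bar>T h (\<lambda>z. G z * Q z)\<bar> \<le> T h (\<lambda>z. N * (2 * C * K\<^sup>2 * h powr \<alpha>))"
    proof -
      have "\<bar>\<Sum>z\<in>S h. ?K z * (G z * Q z)\<bar> \<le> (\<Sum>z\<in>S h. ?K z * (N * (2 * C * K\<^sup>2 * h powr \<alpha>)))"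
      proof (rule order_trans[OF sum_abs sum_mono])
        fix z assume "z \<in> S h"
        then have z: "z \<in> ball 0 \<delta>" by (simp add: S_def)
        have "\<bar>G z\<bar> * \<bar>Q z\<bar> \<le> N * (2 * C * K\<^sup>2 * h powr \<alpha>)"
          using G z N by (intro mult_mono Qb) (auto simp: lip_bounded_def)
        then show "\<bar>?K z * (G z * Q z)\<bar> \<le> ?K z * (N * (2 * C * K\<^sup>2 * h powr \<alpha>))"
          by (simp add: abs_mult mult_left_mono)
      qed
      then show ?thesis using h by (simp add: T_def abs_mult)
    qed
    also have "\<dots> = T h (\<lambda>_. 1) * (N * (2 * C * K\<^sup>2 * h powr \<alpha>))"
      unfolding T_def sum_distrib_right[symmetric] by simp
    also have "\<dots> \<le> M * (N * (2 * C * K\<^sup>2 * h powr \<alpha>))"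
      using T1 N C by (intro mult_right_mono) auto
    finally have TGQ: "\<bar>T h (\<lambda>z. G z * Q z)\<bar> \<le> M * (N * (2 * C * K\<^sup>2 * h powr \<alpha>))" .
    \<comment> \<open>The error splits into the Riemann sum of \<open>G * Q\<close>, small because
      \<open>Q\<close> is, and the Riemann error of \<open>G\<close>.\<close>
    have "(\<Sum>z\<in>S h. ?K z * (G z * w z)) - int G = T h (\<lambda>z. G z * Q z) - e G"
      unfolding sumw by (simp add: e_def)
    then have "\<bar>(\<Sum>z\<in>S h. ?K z * (G z * w z)) - int G\<bar> \<le> M * (N * (2 * C * K\<^sup>2 * h powr \<alpha>)) + C * N * h powr \<alpha>"
      using TGQ e[OF N G] by linarith
    also have "\<dots> = D * N * h powr \<alpha>" by (simp add: D_def algebra_simps)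
    finally show "\<bar>(\<Sum>z\<in>lattice h \<inter> ball 0 \<delta> - {0}. ?K z * (G z * w z))
        - integral (ball 0 \<delta>) (\<lambda>y. ?K y * G y)\<bar> \<le> D * N * h powr \<alpha>" by (simp only: S_def int_def)
  qed
qed

section \<open>The optimal weights\<close>

text \<open>Allowing \<open>c\<close> to be 1 or -1 covers translations and point reflections at
  once; the Jacobian is a power of \<open>\<bar>c\<bar>\<close>.\<close>

lemma lebesgue_integral_isometry:
  fixes g :: "'a::euclidean_space \<Rightarrow> real"
  assumes c: "\<bar>c\<bar> = 1" and g: "integrable lebesgue g"
  shows "integrable lebesgue (\<lambda>y. g (t + c *\<^sub>R y))" "(LINT y|lebesgue. g (t + c *\<^sub>R y)) = (LINT z|lebesgue. g z)"
proof -
  define T where "T = (\<lambda>x::'a. t + c *\<^sub>R x)"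
  have T: "T = (\<lambda>x. t + (\<Sum>j\<in>Basis. (c * (x \<bullet> j)) *\<^sub>R j))"
    unfolding T_def scaleR_scaleR[symmetric] scaleR_sum_right[symmetric] euclidean_representation ..
  have c0: "c \<noteq> 0" using c by auto
  have meas: "T \<in> lebesgue \<rightarrow>\<^sub>M lebesgue"
    unfolding T by (rule lebesgue_affine_measurable) (use c0 in auto)
  have "lebesgue = density (distr lebesgue lebesgue T) (\<lambda>_. (\<Prod>j\<in>(Basis :: 'a set). ennreal \<bar>c\<bar>))"
    unfolding T using lebesgue_affine_euclidean[of "\<lambda>_. c" t] c0 by (simp add: prod_ennreal ennreal_power)
  then have eq: "lebesgue = distr lebesgue lebesgue T" by (simp add: c density_1)
  have gm: "g \<in> borel_measurable lebesgue" using g by simp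
  have "integrable (distr lebesgue lebesgue T) g" using g eq by simp
  then show "integrable lebesgue (\<lambda>y. g (t + c *\<^sub>R y))"
    using integrable_distr[OF meas] by (simp add: T_def)
  have "(LINT z|lebesgue. g z) = (LINT z|distr lebesgue lebesgue T. g z)" using eq by simp
  also have "\<dots> = (LINT y|lebesgue. g (T y))" by (rule integral_distr[OF meas gm])
  finally show "(LINT y|lebesgue. g (t + c *\<^sub>R y)) = (LINT z|lebesgue. g z)" by (simp add: T_def)
qed

text \<open>\<open>H\<close> is compared with the shifted \<open>F\<close> only off the centre,
  because the kernel has an arbitrary value at 0. The discrepancy at that single point is written as
  \<open>k\<close> times the indicator of a null set.\<close>

lemma ball_integral_translate:
  fixes F :: "'a::euclidean_space \<Rightarrow> real"
  assumes F: "F absolutely_integrable_on ball 0 \<delta>"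
    and H: "\<And>y. y \<in> ball x \<delta> \<Longrightarrow> y \<noteq> x \<Longrightarrow> H y = F (y - x)"
  shows "(LINT y:ball x \<delta>|lebesgue. H y) = integral (ball 0 \<delta>) F"
proof -
  define g where "g z = indicator (ball 0 \<delta>) z *\<^sub>R F z" for z
  define k where "k = indicator (ball x \<delta>) x *\<^sub>R H x - g 0"
  have g: "integrable lebesgue g" using F unfolding set_integrable_def g_def .
  have gi: "integrable lebesgue (\<lambda>y. g (-x + 1 *\<^sub>R y))" by (rule lebesgue_integral_isometry(1)[OF _ g]) simp
  have fin: "emeasure lebesgue {x} < \<infinity>" by simp
  have ki: "integrable lebesgue (\<lambda>y. k * indicator {x} y)"
    using fin by (intro integrable_mult_right integrable_real_indicator) auto
  have "indicator (ball x \<delta>) y *\<^sub>R H y = g (-x + 1 *\<^sub>R y) + k * indicator {x} y" for y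
    using H[of y] by (cases "y = x") (auto simp: g_def k_def indicator_def dist_norm norm_minus_commute)
  then have "(LINT y:ball x \<delta>|lebesgue. H y) = (LINT y|lebesgue. g (-x + 1 *\<^sub>R y) + k * indicator {x} y)"
    by (simp only: set_lebesgue_integral_def)
  also have "\<dots> = (LINT y|lebesgue. g (-x + 1 *\<^sub>R y)) + (LINT y|lebesgue. k * indicator {x} y)"
    by (rule Bochner_Integration.integral_add[OF gi ki])
  also have "(LINT y|lebesgue. k * indicator {x} y) = 0" by simp
  also have "(LINT y|lebesgue. g (-x + 1 *\<^sub>R y)) = (LINT z|lebesgue. g z)"
    by (rule lebesgue_integral_isometry(2)[OF _ g]) simp
  also have "\<dots> = integral (ball 0 \<delta>) F"
    using set_lebesgue_integral_eq_integral(2)[OF F] by (simp add: set_lebesgue_integral_def g_def)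
  finally show ?thesis by simp
qed

lemma ball_integral_odd:
  fixes F :: "'a::euclidean_space \<Rightarrow> real"
  assumes F: "F absolutely_integrable_on ball 0 \<delta>" and odd: "\<And>y. F (- y) = - F y"
  shows "integral (ball 0 \<delta>) F = 0"
proof -
  define g where "g z = indicator (ball 0 \<delta>) z *\<^sub>R F z" for z
  have g: "integrable lebesgue g" using F unfolding set_integrable_def g_def .
  have "(LINT y|lebesgue. g (0 + (-1) *\<^sub>R y)) = (LINT z|lebesgue. g z)"
    by (rule lebesgue_integral_isometry(2)[OF _ g]) simp
  moreover have "g (0 + (-1) *\<^sub>R y) = - g y" for y
    by (simp add: g_def odd indicator_def)
  ultimately have "(LINT z|lebesgue. g z) = 0" by simp
  then show ?thesis
    using set_lebesgue_integral_eq_integral(2)[OF F] by (simp add: set_lebesgue_integral_def g_def)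
qed

section \<open>The kernel as a multiple of a power of the norm\<close>

lemma kernel_profile_exponent_nonneg:
  assumes "kernel_profile D0 s \<gamma>1" shows "0 \<le> s"
proof (rule ccontr)
  assume "\<not> 0 \<le> s"
  then have s: "s < 0" by simp
  have D0: "0 < D0" and eq: "\<And>\<tau>. 0 < \<tau> \<Longrightarrow> \<tau> < 1 \<Longrightarrow> \<gamma>1 \<tau> = D0 / \<tau> powr s"
    and mono: "antimono_on {0<..} \<gamma>1" using assms unfolding kernel_profile_def by auto
  have "\<gamma>1 (1/2) \<le> \<gamma>1 (1/4)" using mono by (auto intro: monotone_onD)
  then have "D0 / (1/2) powr s \<le> D0 / (1/4) powr s" using eq[of "1/2"] eq[of "1/4"] by simp
  then have "(1/4) powr s \<le> (1/2) powr s" using D0 by (simp add: field_simps)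
  moreover have "(1/2) powr s < (1/4::real) powr s" using s by (intro powr_less_mono2_neg) auto
  ultimately show False by simp
qed

text \<open>This is D0 / \<delta>^(d+2-s), the factor in front of |z|^(-s); splitting it off lets
  all estimates be made for the bare power.\<close>

definition kernel_const :: "real \<Rightarrow> real \<Rightarrow> real \<Rightarrow> nat \<Rightarrow> real" where
  "kernel_const D0 s \<delta> d = D0 * \<delta> powr s / \<delta> ^ (d + 2)"

lemma kernel_eq:
  fixes z :: "real^'n"
  assumes "kernel_profile D0 s \<gamma>1" "0 < \<delta>" "z \<noteq> 0" "norm z < \<delta>"
  shows "kernel \<gamma>1 \<delta> z = kernel_const D0 s \<delta> CARD('n) * norm z powr -s"
proof -
  have "\<gamma>1 (norm z / \<delta>) = D0 / (norm z / \<delta>) powr s"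
    using assms by (auto simp: kernel_profile_def)
  also have "\<dots> = D0 * \<delta> powr s * norm z powr -s"
    using assms by (simp add: powr_divide powr_minus_divide)
  finally show ?thesis by (simp add: kernel_def kernel_const_def)
qed

lemma kernel_const_pos:
  assumes "kernel_profile D0 s \<gamma>1" "0 < \<delta>" shows "0 < kernel_const D0 s \<delta> d"
  using assms by (simp add: kernel_profile_def kernel_const_def)

lemma kernel_minus: "kernel \<gamma>1 \<delta> (x - y) = kernel \<gamma>1 \<delta> (y - x)"
  by (simp add: kernel_def norm_minus_commute)

text \<open>A segment from a point of the domain to a point outside crosses the frontier, and the
  crossing is no farther from the outer end than the segment is long.\<close>

lemma ball_subset_domain:
  fixes \<Omega> :: "(real^'n) set"
  assumes "x \<in> \<Omega>" shows "ball x \<delta> \<subseteq> \<Omega> \<union> collar \<delta> \<Omega>"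
proof
  fix y assume y: "y \<in> ball x \<delta>"
  show "y \<in> \<Omega> \<union> collar \<delta> \<Omega>"
  proof (cases "y \<in> \<Omega>")
    case False
    have "closed_segment x y \<inter> frontier \<Omega> \<noteq> {}"
      using assms False by (intro connected_Int_frontier) auto
    then obtain p where p: "p \<in> closed_segment x y" "p \<in> frontier \<Omega>" by blast
    have "infdist y (frontier \<Omega>) \<le> dist y p" by (rule infdist_le[OF p(2)])
    also have "\<dots> \<le> dist x y" using dist_in_closed_segment[OF p(1)] by (simp add: dist_commute)
    finally show ?thesis using False y by (simp add: collar_def)
  qed simp
qed

section \<open>Grid and stencils\<close>

lemma grid_eq: "grid \<Omega> \<delta> h = lattice h \<inter> (\<Omega> \<union> collar \<delta> \<Omega>)"
  by (simp add: grid_def lattice_def)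

text \<open>By \<open>ball_subset_domain\<close> no lattice point of the ball is cut off: all
  stencils of interior nodes are translates of one set, which makes the estimates independent of the
  node.\<close>

lemma stencil_eq:
  assumes xi: "xi \<in> grid \<Omega> \<delta> h \<inter> \<Omega>"
  shows "stencil \<Omega> \<delta> h xi = (+) xi ` (lattice h \<inter> ball 0 \<delta> - {0})"
proof
  have l: "xi \<in> lattice h" "xi \<in> \<Omega>" using xi by (auto simp: grid_eq)
  show "stencil \<Omega> \<delta> h xi \<subseteq> (+) xi ` (lattice h \<inter> ball 0 \<delta> - {0})"
  proof
    fix y assume y: "y \<in> stencil \<Omega> \<delta> h xi"
    then have "y - xi \<in> lattice h \<inter> ball 0 \<delta> - {0}"
      using lattice_diff[of y h xi] l by (auto simp: stencil_def grid_eq dist_norm norm_minus_commute)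
    then show "y \<in> (+) xi ` (lattice h \<inter> ball 0 \<delta> - {0})" by (rule image_eqI[rotated]) simp
  qed
  show "(+) xi ` (lattice h \<inter> ball 0 \<delta> - {0}) \<subseteq> stencil \<Omega> \<delta> h xi"
  proof
    fix y assume "y \<in> (+) xi ` (lattice h \<inter> ball 0 \<delta> - {0})"
    then obtain z where z: "y = xi + z" "z \<in> lattice h" "z \<in> ball 0 \<delta>" "z \<noteq> 0" by blast
    then have yb: "y \<in> ball xi \<delta>" by (simp add: dist_norm)
    then have "y \<in> \<Omega> \<union> collar \<delta> \<Omega>" using ball_subset_domain[OF l(2)] by blast
    then show "y \<in> stencil \<Omega> \<delta> h xi"
      using z yb lattice_add[OF l(1) z(2)] by (simp add: stencil_def grid_eq)
  qed
qed

lemma sum_stencil: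
  assumes "xi \<in> grid \<Omega> \<delta> h \<inter> \<Omega>"
  shows "(\<Sum>xj\<in>stencil \<Omega> \<delta> h xi. F xj) = (\<Sum>z\<in>lattice h \<inter> ball 0 \<delta> - {0}. F (xi + z))"
  unfolding stencil_eq[OF assms] by (subst sum.reindex) auto

text \<open>The minimizer of the energy is the orthogonal projection onto the span of the constraints.\<close>

lemma optimal_weights_polynomial:
  fixes \<Omega> :: "(real^'n) set"
  assumes fin: "finite (stencil \<Omega> \<delta> h xi)"
    and pos: "\<And>xj. xj \<in> stencil \<Omega> \<delta> h xi \<Longrightarrow> 0 < kernel \<gamma>1 \<delta> (xi - xj)"
    and opt: "optimal_weights \<Omega> \<gamma>1 \<delta> h xi w"
  obtains P where "poly_deg_le 3 P" "\<And>xj. xj \<in> stencil \<Omega> \<delta> h xi \<Longrightarrow> w xj = P (xj - xi)"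
proof -
  define S where "S = stencil \<Omega> \<delta> h xi"
  define k where "k x = kernel \<gamma>1 \<delta> (xi - x)" for x
  have k: "0 < k x" if "x \<in> S" for x using pos that by (simp add: k_def S_def)
  define ip where "ip f g = (\<Sum>x\<in>S. k x * (f x * g x))" for f g :: "real^'n \<Rightarrow> real"
  interpret semi_inner UNIV ip
  proof
    show "ip f g = ip g f" for f g by (simp add: ip_def mult.commute)
    show "ip (\<lambda>x. a * f x + b * g x) u = a * ip f u + b * ip g u" for a f b g u
      by (simp add: ip_def sum_distrib_left sum.distrib[symmetric] algebra_simps)
    show "0 \<le> ip f f" for f unfolding ip_def using k by (intro sum_nonneg) (simp add: less_imp_le)
  qed auto
  define I where "I = (multi_indices 3 :: ('n \<Rightarrow> nat) set)"
  have finI: "finite I" unfolding I_def by (rule finite_multi_indices)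
  define \<phi> where "\<phi> \<alpha> x = monomial \<alpha> (x - xi)" for \<alpha> x
  have lc: "lin_comb I \<phi> e x = lin_comb I monomial e (x - xi)" for e x by (simp add: lin_comb_def \<phi>_def)
  obtain c where c: "\<And>j. j \<in> I \<Longrightarrow> ip (\<lambda>x. w x - lin_comb I \<phi> c x) (\<phi> j) = 0"
    using projection_exists[OF finI, where \<phi>=\<phi> and w=w] by auto
  define p where "p = lin_comb I \<phi> c"
  define v where "v = (\<lambda>x. w x - p x)"
  have vort: "ip v (lin_comb I \<phi> e) = 0" for e
    by (rule orthogonal_lin_comb[OF finI]) (use c in \<open>auto simp: v_def p_def\<close>)
  have ex: "exact_weights \<Omega> \<gamma>1 \<delta> h xi w" using opt by (simp add: optimal_weights_def)
  \<comment> \<open>The residual \<open>v\<close> is orthogonal to all constraints, so the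
    projection \<open>p\<close> is exact as well and competes in the minimization.\<close>
  have "exact_weights \<Omega> \<gamma>1 \<delta> h xi p"
    unfolding exact_weights_def
  proof (intro allI impI)
    fix q :: "real^'n \<Rightarrow> real" assume q: "poly_deg_le 3 q"
    then obtain e where e: "q = lin_comb I monomial e" unfolding poly_deg_le_lin_comb I_def by blast
    have "0 = ip v (lin_comb I \<phi> e)" using vort by simp
    also have "\<dots> = (\<Sum>xj\<in>S. q (xj - xi) * k xj * w xj) - (\<Sum>xj\<in>S. q (xj - xi) * k xj * p xj)"
      unfolding ip_def v_def lc e by (simp add: sum_subtractf[symmetric] algebra_simps)
    finally show "(\<Sum>xj\<in>stencil \<Omega> \<delta> h xi. q (xj - xi) * kernel \<gamma>1 \<delta> (xi - xj) * p xj)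
        = (LINT y:ball xi \<delta>|lebesgue. q (y - xi) * kernel \<gamma>1 \<delta> (xi - y))"
      using ex q unfolding exact_weights_def S_def k_def by simp
  qed
  then have "weight_energy \<Omega> \<gamma>1 \<delta> h xi w \<le> weight_energy \<Omega> \<gamma>1 \<delta> h xi p"
    using opt by (simp add: optimal_weights_def)
  moreover have en: "weight_energy \<Omega> \<gamma>1 \<delta> h xi f = 1/2 * ip f f" for f
    unfolding weight_energy_def ip_def S_def k_def kernel_minus[of _ _ xi]
    by (simp add: sum_distrib_left power2_eq_square mult_ac)
  \<comment> \<open>Pythagoras: the energy of \<open>w\<close> is that of \<open>p\<close> plus that
    of \<open>v\<close>. Minimality forces the latter to be 0, and positivity of the kernel makes
    \<open>v\<close> vanish on the stencil.\<close>
  moreover have "ip w w = ip p p + ip v v"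
  proof -
    have "ip w w = ip p p + 2 * ip v p + ip v v"
      unfolding ip_def v_def by (simp add: sum_distrib_left sum.distrib[symmetric] algebra_simps)
    then show ?thesis using vort[of c] by (simp add: p_def)
  qed
  ultimately have "ip v v \<le> 0" by simp
  then have "ip v v = 0" using nonneg[of v] by simp
  then have v0: "v x = 0" if "x \<in> S" for x
  proof -
    have "\<forall>x\<in>S. k x * (v x * v x) = 0"
      using \<open>ip v v = 0\<close> fin k unfolding ip_def S_def[symmetric]
      by (subst (asm) sum_nonneg_eq_0_iff) (auto simp: less_imp_le)
    then show ?thesis using that k[OF that] by auto
  qed
  show thesis
  proof (rule that[of "lin_comb I monomial c"])
    show "poly_deg_le 3 (lin_comb I monomial c)" unfolding poly_deg_le_lin_comb I_def by blast
    show "w xj = lin_comb I monomial c (xj - xi)" if "xj \<in> stencil \<Omega> \<delta> h xi" for xj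
      using v0[of xj] that by (simp add: v_def p_def S_def lc)
  qed
qed

section \<open>Stability\<close>

text \<open>Adding \<open>\<tau> * \<psi>\<close> makes the operator strictly positive on
  \<open>I\<close>, which is impossible at a maximum; so the maximum of \<open>f\<close> sits at a
  node where \<open>e\<close> vanishes. The strict bound on the operator of \<open>e\<close> is the
  source of this strictness. The barrier may have either sign, hence the factor 2.\<close>

lemma discrete_maximum_principle:
  fixes e \<psi> :: "'a \<Rightarrow> real"
  assumes G: "finite G" and St: "\<And>x. x \<in> I \<Longrightarrow> S x \<subseteq> G"
    and a: "\<And>x y. x \<in> I \<Longrightarrow> y \<in> S x \<Longrightarrow> 0 \<le> a x y"
    and \<psi>: "\<And>x. x \<in> I \<Longrightarrow> 1 \<le> (\<Sum>y\<in>S x. a x y * (\<psi> y - \<psi> x))" "\<And>x. x \<in> G \<Longrightarrow> \<bar>\<psi> x\<bar> \<le> \<Psi>"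
    and e: "\<And>x. x \<in> I \<Longrightarrow> - \<tau> < (\<Sum>y\<in>S x. a x y * (e y - e x))" "\<And>x. x \<in> G - I \<Longrightarrow> e x = 0"
    and \<tau>: "0 \<le> \<tau>" and x: "x \<in> G"
  shows "e x \<le> 2 * \<Psi> * \<tau>"
proof -
  define f where "f x = e x + \<tau> * \<psi> x" for x
  obtain m where m: "m \<in> G" "\<And>y. y \<in> G \<Longrightarrow> f y \<le> f m"
  proof -
    have "finite (f ` G)" "f ` G \<noteq> {}" using G x by auto
    then have "Max (f ` G) \<in> f ` G" by (rule Max_in)
    then obtain m where m: "m \<in> G" "f m = Max (f ` G)" by auto
    then show thesis using that[of m] G by simp
  qed
  have "m \<notin> I"
  proof
    assume mI: "m \<in> I"
    have "(\<Sum>y\<in>S m. a m y * (f y - f m)) = (\<Sum>y\<in>S m. a m y * (e y - e m)) + \<tau> * (\<Sum>y\<in>S m. a m y * (\<psi> y - \<psi> m))"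
      by (simp add: f_def sum_distrib_left sum.distrib[symmetric] algebra_simps)
    moreover have "\<tau> * 1 \<le> \<tau> * (\<Sum>y\<in>S m. a m y * (\<psi> y - \<psi> m))"
      by (intro mult_left_mono \<psi> mI \<tau>)
    ultimately have "0 < (\<Sum>y\<in>S m. a m y * (f y - f m))" using e(1)[OF mI] by linarith
    moreover have "(\<Sum>y\<in>S m. a m y * (f y - f m)) \<le> 0"
    proof (rule sum_nonpos)
      fix y assume y: "y \<in> S m"
      then have "f y \<le> f m" using St[OF mI] m(2) by blast
      then show "a m y * (f y - f m) \<le> 0" using a[OF mI y] by (simp add: mult_nonneg_nonpos)
    qed
    ultimately show False by linarith
  qed
  then have "f x \<le> \<tau> * \<psi> m" using m(2)[OF x] e(2)[of m] m(1) by (simp add: f_def)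
  then have "e x \<le> \<tau> * (\<psi> m - \<psi> x)" by (simp add: f_def algebra_simps)
  also have "\<dots> \<le> \<tau> * (2 * \<Psi>)"
    using \<psi>(2)[OF x] \<psi>(2)[OF m(1)] by (intro mult_left_mono \<tau>) (simp add: abs_le_iff)
  finally show ?thesis by (simp only: mult_ac)
qed

text \<open>Forward, \<open>t + \<delta> \<le> 2 * \<delta>\<close> and convexity of the exponential
  suffice. Backward, the quadratic is nonpositive on the interval from \<open>-\<delta>\<close> to
  0, and the exponential term is never below \<open>-A\<close>, hence never below
  \<open>-R\<close>.\<close>

lemma exp_barrier_pointwise:
  fixes t :: real
  assumes "0 < \<delta>" "\<bar>t\<bar> < \<delta>" "0 \<le> l" "0 < r" "r \<le> A" "A \<le> R"
  shows "r * (l / (2 * \<delta>)) * (t\<^sup>2 + \<delta> * t) - R \<le> A * (exp (l * t) - 1)"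
proof (cases "0 \<le> t")
  case True
  have "(l / (2 * \<delta>)) * (t\<^sup>2 + \<delta> * t) = (l / (2 * \<delta>)) * t * (t + \<delta>)"
    by (simp add: power2_eq_square algebra_simps)
  also have "\<dots> \<le> (l / (2 * \<delta>)) * t * (2 * \<delta>)"
    using assms True by (intro mult_left_mono) auto
  also have "\<dots> = l * t" using assms by simp
  also have "\<dots> \<le> exp (l * t) - 1" using exp_ge_add_one_self[of "l * t"] by linarith
  finally have *: "(l / (2 * \<delta>)) * (t\<^sup>2 + \<delta> * t) \<le> exp (l * t) - 1" .
  have p: "0 \<le> exp (l * t) - 1" using True assms by simp
  have "r * ((l / (2 * \<delta>)) * (t\<^sup>2 + \<delta> * t)) \<le> r * (exp (l * t) - 1)"
    using * assms by (intro mult_left_mono) auto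
  also have "\<dots> \<le> A * (exp (l * t) - 1)" using p assms by (intro mult_right_mono) auto
  finally show ?thesis using assms by simp
next
  case False
  have "t\<^sup>2 + \<delta> * t = t * (t + \<delta>)" by (simp add: power2_eq_square algebra_simps)
  also have "\<dots> \<le> 0" using False assms by (intro mult_nonpos_nonneg) auto
  finally have "r * (l / (2 * \<delta>)) * (t\<^sup>2 + \<delta> * t) \<le> 0"
    using assms by (intro mult_nonneg_nonpos) auto
  moreover have "A * -1 \<le> A * (exp (l * t) - 1)" using assms by (intro mult_left_mono) auto
  ultimately show ?thesis using assms by linarith
qed

lemma second_moment_pos:
  assumes s: "0 \<le> s" "s < real CARD('n)" and \<delta>: "0 < \<delta>"
  shows "0 < integral (ball 0 \<delta>) (\<lambda>y::real^'n. norm y powr -s * (y $ i)\<^sup>2)"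
proof -
  have eq: "(y $ i)\<^sup>2 = y $ i * y $ i" for y :: "real^'n" by (simp add: power2_eq_square)
  have mon: "monomial (\<lambda>j. if j = i then 1 else 0) = (\<lambda>z::real^'n. z $ i)"
    using monomial_single[of i 1] by simp
  obtain M where M: "0 \<le> M" "lip_bounded (ball (0::real^'n) \<delta>) M (\<lambda>y. y $ i)"
    using monomial_lip_bounded[of \<delta> "\<lambda>j. if j = i then 1 else 0"] unfolding mon by blast
  have "(\<lambda>y::real^'n. norm y powr -s * (y $ i * y $ i)) integrable_on ball 0 \<delta>"
    using powr_times_lip_bounded_integrable[OF s \<delta> lip_bounded_mult[OF M(2) M(2) M(1) M(1)]]
    by (rule set_lebesgue_integral_eq_integral(1))
  then have "0 \<le> integral (ball 0 \<delta>) (\<lambda>y::real^'n. norm y powr -s * (y $ i * y $ i))"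
    by (intro integral_nonneg) auto
  moreover have "integral (ball 0 \<delta>) (\<lambda>y::real^'n. norm y powr -s * (y $ i * y $ i)) \<noteq> 0"
  proof
    assume z: "integral (ball 0 \<delta>) (\<lambda>y::real^'n. norm y powr -s * (y $ i * y $ i)) = 0"
    \<comment> \<open>A point of the ball at which the coordinate is nonzero.\<close>
    have "(\<delta>/2) *\<^sub>R axis i 1 \<in> ball (0::real^'n) \<delta>" using \<delta> by (simp add: norm_axis_1)
    from ball_null_imp_zero[OF s \<delta> M(2) z this] show False using \<delta> by simp
  qed
  ultimately show ?thesis unfolding eq by linarith
qed

lemma first_moment_zero:
  assumes s: "0 \<le> s" "s < real CARD('n)" and \<delta>: "0 < \<delta>"
  shows "integral (ball 0 \<delta>) (\<lambda>y::real^'n. norm y powr -s * y $ i) = 0"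
proof -
  have mon: "monomial (\<lambda>j. if j = i then 1 else 0) = (\<lambda>z::real^'n. z $ i)"
    using monomial_single[of i 1] by simp
  obtain M where M: "0 \<le> M" "lip_bounded (ball (0::real^'n) \<delta>) M (\<lambda>y. y $ i)"
    using monomial_lip_bounded[of \<delta> "\<lambda>j. if j = i then 1 else 0"] unfolding mon by blast
  show ?thesis
    by (rule ball_integral_odd[OF powr_times_lip_bounded_integrable[OF s \<delta> M(2)]]) simp
qed

text \<open>
  Exactness for the polynomial \<open>t\<^sup>2 + \<delta> t\<close>, which lies below a multiple of the positive part of \<open>t\<close>,
  gives enough weight to forward jumps for an exponential to be a strict subsolution.
\<close>

lemma exp_barrier:
  fixes i :: "'n::finite"
  assumes s: "0 \<le> s" "s < real CARD('n)" and \<delta>: "0 < \<delta>" and r: "0 < r" "r \<le> R"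
  obtains l where "0 \<le> l" "\<And>S w A. finite S \<Longrightarrow> S \<subseteq> ball (0::real^'n) \<delta> \<Longrightarrow> (\<And>z. z \<in> S \<Longrightarrow> 0 \<le> w z) \<Longrightarrow>
    (\<And>p. poly_deg_le 3 p \<Longrightarrow> (\<Sum>z\<in>S. norm z powr -s * (p z * w z)) = integral (ball 0 \<delta>) (\<lambda>y. norm y powr -s * p y)) \<Longrightarrow>
    (\<And>z. z \<in> S \<Longrightarrow> r \<le> A z \<and> A z \<le> R) \<Longrightarrow>
    1 \<le> (\<Sum>z\<in>S. norm z powr -s * (A z * (exp (l * z $ i) - 1) * w z))"
proof -
  let ?K = "\<lambda>y::real^'n. norm y powr -s"
  define m0 where "m0 = integral (ball 0 \<delta>) (\<lambda>y. ?K y * 1)"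
  define m2 where "m2 = integral (ball 0 \<delta>) (\<lambda>y. ?K y * (y $ i)\<^sup>2)"
  have m2: "0 < m2" unfolding m2_def by (rule second_moment_pos[OF s \<delta>])
  have m0: "0 \<le> m0" unfolding m0_def
    using set_lebesgue_integral_eq_integral(1)[OF norm_powr_absolutely_integrable[OF s \<delta>]]
    by (intro integral_nonneg) auto
  \<comment> \<open>Makes \<open>c * m2\<close> exceed \<open>R * m0\<close> by exactly 1, where
    \<open>c\<close> is the coefficient of the quadratic in the pointwise bound.\<close>
  define l where "l = 2 * \<delta> * (R * m0 + 1) / (r * m2)"
  have l: "0 \<le> l" using m0 m2 r \<delta> by (simp add: l_def)
  show thesis
  proof (rule that[OF l])
    fix S w A
    assume S: "finite S" "S \<subseteq> ball (0::real^'n) \<delta>" and w: "\<And>z. z \<in> S \<Longrightarrow> 0 \<le> w z"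
      and ex: "\<And>p. poly_deg_le 3 p \<Longrightarrow> (\<Sum>z\<in>S. ?K z * (p z * w z)) = integral (ball 0 \<delta>) (\<lambda>y. ?K y * p y)"
      and A: "\<And>z. z \<in> S \<Longrightarrow> r \<le> A z \<and> A z \<le> R"
    define c where "c = r * (l / (2 * \<delta>))"
    have c: "c * m2 = R * m0 + 1" using m2 r \<delta> by (simp add: c_def l_def)
    have e2: "(\<Sum>z\<in>S. ?K z * ((z $ i)\<^sup>2 * w z)) = m2"
      unfolding m2_def by (rule ex[OF poly_deg_le_coord_power]) simp
    have "poly_deg_le 3 (\<lambda>z::real^'n. z $ i)" using poly_deg_le_coord_power[of 1 3 i] by simp
    from ex[OF this] have e1: "(\<Sum>z\<in>S. ?K z * (z $ i * w z)) = 0"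
      using first_moment_zero[OF s \<delta>, of i] by simp
    have e0: "(\<Sum>z\<in>S. ?K z * (1 * w z)) = m0"
      unfolding m0_def by (rule ex[OF poly_deg_le_const])
    \<comment> \<open>The linear part of the quadratic contributes nothing, since the first moment
      vanishes by symmetry; the loss \<open>-R\<close> costs \<open>R * m0\<close>.\<close>
    have "1 = c * m2 + c * \<delta> * 0 - R * m0" using c by simp
    also have "\<dots> = (\<Sum>z\<in>S. c * (?K z * ((z $ i)\<^sup>2 * w z)) + c * \<delta> * (?K z * (z $ i * w z)) - R * (?K z * (1 * w z)))"
      by (simp only: sum_subtractf sum.distrib sum_distrib_left[symmetric] e0 e1 e2)
    also have "\<dots> = (\<Sum>z\<in>S. ?K z * w z * (c * ((z $ i)\<^sup>2 + \<delta> * z $ i) - R))"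
      by (rule sum.cong) (auto simp: algebra_simps)
    also have "\<dots> \<le> (\<Sum>z\<in>S. ?K z * w z * (A z * (exp (l * z $ i) - 1)))"
    proof (rule sum_mono)
      fix z assume z: "z \<in> S"
      have "\<bar>z $ i\<bar> < \<delta>" using S(2) z component_le_norm_cart[of z i] by force
      then have "c * ((z $ i)\<^sup>2 + \<delta> * z $ i) - R \<le> A z * (exp (l * z $ i) - 1)"
        unfolding c_def using exp_barrier_pointwise[of \<delta> "z $ i" l r "A z" R] \<delta> l r A[OF z] by simp
      then show "?K z * w z * (c * ((z $ i)\<^sup>2 + \<delta> * z $ i) - R) \<le> ?K z * w z * (A z * (exp (l * z $ i) - 1))"
        using w[OF z] by (intro mult_left_mono) auto
    qed
    also have "\<dots> = (\<Sum>z\<in>S. ?K z * (A z * (exp (l * z $ i) - 1) * w z))"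
      by (simp only: mult_ac)
    finally show "1 \<le> (\<Sum>z\<in>S. ?K z * (A z * (exp (l * z $ i) - 1) * w z))" .
  qed
qed

section \<open>Convergence\<close>

text \<open>Both sides carry the factor \<open>kernel_const\<close>, which cancels; the weights
  become a quadrature rule for the bare power on the ball around 0.\<close>

lemma exact_weights_translated:
  fixes \<Omega> :: "(real^'n) set"
  assumes kp: "kernel_profile D0 s \<gamma>1" and s: "s < real CARD('n)" and \<delta>: "0 < \<delta>"
    and xi: "xi \<in> grid \<Omega> \<delta> h \<inter> \<Omega>" and ex: "exact_weights \<Omega> \<gamma>1 \<delta> h xi w" and p: "poly_deg_le 3 p"
  shows "(\<Sum>z\<in>lattice h \<inter> ball 0 \<delta> - {0}. norm z powr -s * (p z * w (xi + z)))
    = integral (ball 0 \<delta>) (\<lambda>y. norm y powr -s * p y)"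
proof -
  have s0: "0 \<le> s" by (rule kernel_profile_exponent_nonneg[OF kp])
  define \<kappa> where "\<kappa> = kernel_const D0 s \<delta> CARD('n)"
  have \<kappa>: "0 < \<kappa>" unfolding \<kappa>_def by (rule kernel_const_pos[OF kp \<delta>])
  obtain M where M: "lip_bounded (ball (0::real^'n) \<delta>) M p"
    using poly_norm_equivalence[OF s0 s \<delta>, of 3] p by blast
  have ai: "(\<lambda>y. \<kappa> * (norm y powr -s * p y)) absolutely_integrable_on ball 0 \<delta>"
    by (intro set_integrable_mult_right powr_times_lip_bounded_integrable[OF s0 s \<delta> M])
  have "(\<Sum>xj\<in>stencil \<Omega> \<delta> h xi. p (xj - xi) * kernel \<gamma>1 \<delta> (xi - xj) * w xj)
     = (\<Sum>z\<in>lattice h \<inter> ball 0 \<delta> - {0}. \<kappa> * (norm z powr -s * (p z * w (xi + z))))"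
    unfolding sum_stencil[OF xi]
  proof (rule sum.cong[OF refl])
    fix z :: "real^'n" assume z: "z \<in> lattice h \<inter> ball 0 \<delta> - {0}"
    have "kernel \<gamma>1 \<delta> (xi - (xi + z)) = \<kappa> * norm z powr -s"
      using kernel_eq[OF kp \<delta>, of "xi - (xi + z)"] z by (simp add: \<kappa>_def)
    then show "p (xi + z - xi) * kernel \<gamma>1 \<delta> (xi - (xi + z)) * w (xi + z) = \<kappa> * (norm z powr -s * (p z * w (xi + z)))"
      by simp
  qed
  also have "\<dots> = \<kappa> * (\<Sum>z\<in>lattice h \<inter> ball 0 \<delta> - {0}. norm z powr -s * (p z * w (xi + z)))"
    by (simp only: sum_distrib_left)
  finally have 1: "(\<Sum>xj\<in>stencil \<Omega> \<delta> h xi. p (xj - xi) * kernel \<gamma>1 \<delta> (xi - xj) * w xj)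
     = \<kappa> * (\<Sum>z\<in>lattice h \<inter> ball 0 \<delta> - {0}. norm z powr -s * (p z * w (xi + z)))" .
  have "(LINT y:ball xi \<delta>|lebesgue. p (y - xi) * kernel \<gamma>1 \<delta> (xi - y))
     = integral (ball 0 \<delta>) (\<lambda>y. \<kappa> * (norm y powr -s * p y))"
  proof (rule ball_integral_translate[OF ai])
    fix y assume "y \<in> ball xi \<delta>" "y \<noteq> xi"
    then show "p (y - xi) * kernel \<gamma>1 \<delta> (xi - y) = \<kappa> * (norm (y - xi) powr -s * p (y - xi))"
      using kernel_eq[OF kp \<delta>, of "xi - y"] by (simp add: \<kappa>_def dist_norm norm_minus_commute)
  qed
  also have "\<dots> = \<kappa> * integral (ball 0 \<delta>) (\<lambda>y. norm y powr -s * p y)" by simp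
  finally show ?thesis using 1 ex p \<kappa> unfolding exact_weights_def by simp
qed

lemma quadrature_consistency:
  fixes \<Omega> :: "(real^'n) set"
  assumes kp: "kernel_profile D0 s \<gamma>1" and s: "s < real CARD('n)" and \<delta>: "0 < \<delta>"
    and pc: "positivity_constant \<Omega> \<gamma>1 Cpos"
  obtains C where "0 \<le> C" "\<And>h xi w N G. 0 < h \<Longrightarrow> h < Cpos * \<delta> \<Longrightarrow> xi \<in> grid \<Omega> \<delta> h \<inter> \<Omega> \<Longrightarrow>
    optimal_weights \<Omega> \<gamma>1 \<delta> h xi w \<Longrightarrow> 0 \<le> N \<Longrightarrow> lip_bounded (ball 0 \<delta>) N G \<Longrightarrow>
    \<bar>(\<Sum>z\<in>lattice h \<inter> ball 0 \<delta> - {0}. norm z powr -s * (G z * w (xi + z)))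
       - integral (ball 0 \<delta>) (\<lambda>y. norm y powr -s * G y)\<bar> \<le> C * N * h powr (min 1 (real CARD('n) - s))"
proof -
  let ?K = "\<lambda>y::real^'n. norm y powr -s"
  define \<alpha> where "\<alpha> = min 1 (real CARD('n) - s)"
  have \<alpha>: "0 < \<alpha>" using s by (simp add: \<alpha>_def)
  have s0: "0 \<le> s" by (rule kernel_profile_exponent_nonneg[OF kp])
  obtain C h0 where C: "0 \<le> C" and h0: "0 < h0" and small: "\<And>h w P N G. 0 < h \<Longrightarrow> h < h0 \<Longrightarrow> poly_deg_le 3 P \<Longrightarrow>
     (\<And>z. z \<in> lattice h \<inter> ball (0::real^'n) \<delta> - {0} \<Longrightarrow> w z = P z) \<Longrightarrow>
     (\<And>p. poly_deg_le 3 p \<Longrightarrow> (\<Sum>z\<in>lattice h \<inter> ball 0 \<delta> - {0}. ?K z * (p z * w z))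
         = integral (ball 0 \<delta>) (\<lambda>y. ?K y * p y)) \<Longrightarrow> 0 \<le> N \<Longrightarrow>
     lip_bounded (ball 0 \<delta>) N G \<Longrightarrow>
     \<bar>(\<Sum>z\<in>lattice h \<inter> ball 0 \<delta> - {0}. ?K z * (G z * w z))
        - integral (ball 0 \<delta>) (\<lambda>y. ?K y * G y)\<bar> \<le> C * N * h powr \<alpha>"
    unfolding \<alpha>_def by (rule polynomial_quadrature_error[OF s0 s \<delta>, of 3]) blast
  define m0 where "m0 = integral (ball 0 \<delta>) (\<lambda>y. ?K y * 1)"
  have K: "?K integrable_on ball 0 \<delta>"
    using norm_powr_absolutely_integrable[OF s0 s \<delta>] by (rule set_lebesgue_integral_eq_integral(1))
  have m0: "0 \<le> m0" unfolding m0_def using K by (intro integral_nonneg) auto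
  \<comment> \<open>The second summand serves \<open>h \<ge> h0\<close>: there the error is at most
    \<open>2 * N * m0\<close>, and \<open>h powr \<alpha> / h0 powr \<alpha>\<close> is at least
    1.\<close>
  define D where "D = C + 2 * m0 / h0 powr \<alpha>"
  show thesis
  proof (rule that)
    show D: "0 \<le> D" using C m0 by (simp add: D_def)
    fix h xi w N and G :: "real^'n \<Rightarrow> real"
    assume h: "0 < h" "h < Cpos * \<delta>" and xi: "xi \<in> grid \<Omega> \<delta> h \<inter> \<Omega>"
      and opt: "optimal_weights \<Omega> \<gamma>1 \<delta> h xi w" and N: "0 \<le> N" and G: "lip_bounded (ball 0 \<delta>) N G"
    define S where "S = lattice h \<inter> ball (0::real^'n) \<delta> - {0}"
    have fin: "finite S" unfolding S_def using finite_lattice_bounded[OF h(1) bounded_ball] by simp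
    have st: "stencil \<Omega> \<delta> h xi = (+) xi ` S" unfolding S_def by (rule stencil_eq[OF xi])
    have exw: "exact_weights \<Omega> \<gamma>1 \<delta> h xi w" using opt by (simp add: optimal_weights_def)
    have ex: "(\<Sum>z\<in>S. ?K z * (p z * w (xi + z))) = integral (ball 0 \<delta>) (\<lambda>y. ?K y * p y)" if "poly_deg_le 3 p" for p
      unfolding S_def by (rule exact_weights_translated[OF kp s \<delta> xi exw that])
    show "\<bar>(\<Sum>z\<in>lattice h \<inter> ball 0 \<delta> - {0}. ?K z * (G z * w (xi + z)))
       - integral (ball 0 \<delta>) (\<lambda>y. ?K y * G y)\<bar> \<le> D * N * h powr (min 1 (real CARD('n) - s))"
      unfolding \<alpha>_def[symmetric] S_def[symmetric]
    proof (cases "h < h0")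
      case True
      have kpos: "0 < kernel \<gamma>1 \<delta> (xi - xj)" if "xj \<in> stencil \<Omega> \<delta> h xi" for xj
      proof -
        have "xi - xj \<noteq> 0" "norm (xi - xj) < \<delta>" using that by (auto simp: stencil_def dist_norm)
        then show ?thesis using kernel_eq[OF kp \<delta>, of "xi - xj"] kernel_const_pos[OF kp \<delta>] by simp
      qed
      obtain P where P: "poly_deg_le 3 P" "\<And>xj. xj \<in> stencil \<Omega> \<delta> h xi \<Longrightarrow> w xj = P (xj - xi)"
        using optimal_weights_polynomial[OF _ kpos opt] fin st by auto
      have wP: "w (xi + z) = P z" if "z \<in> S" for z using P(2)[of "xi + z"] that st by simp
      have "\<bar>(\<Sum>z\<in>S. ?K z * (G z * w (xi + z))) - integral (ball 0 \<delta>) (\<lambda>y. ?K y * G y)\<bar> \<le> C * N * h powr \<alpha>"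
        unfolding S_def by (rule small[OF h(1) True P(1)]) (use wP ex N G in \<open>auto simp: S_def\<close>)
      also have "\<dots> \<le> D * N * h powr \<alpha>" using m0 N by (intro mult_right_mono) (auto simp: D_def)
      finally show "\<bar>(\<Sum>z\<in>S. ?K z * (G z * w (xi + z))) - integral (ball 0 \<delta>) (\<lambda>y. ?K y * G y)\<bar> \<le> D * N * h powr \<alpha>" .
    next
      case False
      have wpos: "0 < w (xi + z)" if "z \<in> S" for z
        using pc h \<delta> xi opt that st unfolding positivity_constant_def by blast
      \<comment> \<open>Positive weights that are exact for the constant 1 have total kernel mass
        \<open>m0\<close>, whatever \<open>h\<close> is.\<close>
      have "\<bar>\<Sum>z\<in>S. ?K z * (G z * w (xi + z))\<bar> \<le> (\<Sum>z\<in>S. N * (?K z * (1 * w (xi + z))))"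
      proof (rule order_trans[OF sum_abs sum_mono])
        fix z assume z: "z \<in> S"
        then have "\<bar>G z\<bar> \<le> N" using G by (simp add: lip_bounded_def S_def)
        then have "\<bar>G z\<bar> * (?K z * w (xi + z)) \<le> N * (?K z * w (xi + z))"
          using wpos[OF z] by (intro mult_right_mono) auto
        then show "\<bar>?K z * (G z * w (xi + z))\<bar> \<le> N * (?K z * (1 * w (xi + z)))"
          using wpos[OF z] by (simp add: abs_mult mult_ac)
      qed
      also have "\<dots> = N * m0" unfolding sum_distrib_left[symmetric] m0_def
        using ex[OF poly_deg_le_const, of 1] by simp
      finally have 1: "\<bar>\<Sum>z\<in>S. ?K z * (G z * w (xi + z))\<bar> \<le> N * m0" .
      have "norm (integral (ball 0 \<delta>) (\<lambda>y. ?K y * G y)) \<le> integral (ball 0 \<delta>) (\<lambda>y. N * (?K y * 1))"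
      proof (rule integral_norm_bound_integral)
        show "(\<lambda>y. ?K y * G y) integrable_on ball 0 \<delta>"
          using powr_times_lip_bounded_integrable[OF s0 s \<delta> G] by (rule set_lebesgue_integral_eq_integral(1))
        show "(\<lambda>y. N * (?K y * 1)) integrable_on ball 0 \<delta>" using K by (simp add: integrable_on_mult_right)
        show "norm (?K y * G y) \<le> N * (?K y * 1)" if "y \<in> ball 0 \<delta>" for y
        proof -
          have "\<bar>G y\<bar> \<le> N" using G that by (simp add: lip_bounded_def)
          then have "\<bar>G y\<bar> * ?K y \<le> N * ?K y" by (rule mult_right_mono) simp
          then show ?thesis by (simp add: abs_mult mult.commute)
        qed
      qed
      also have "\<dots> = N * m0" unfolding m0_def by simp
      finally have "\<bar>(\<Sum>z\<in>S. ?K z * (G z * w (xi + z))) - integral (ball 0 \<delta>) (\<lambda>y. ?K y * G y)\<bar> \<le> 2 * (N * m0) * 1"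
        using 1 by simp
      also have "\<dots> \<le> 2 * (N * m0) * (h powr \<alpha> / h0 powr \<alpha>)"
      proof (intro mult_left_mono)
        have "h0 powr \<alpha> \<le> h powr \<alpha>" using False h0 \<alpha> by (intro powr_mono2) auto
        then show "1 \<le> h powr \<alpha> / h0 powr \<alpha>" using h0 by simp
      qed (use N m0 in auto)
      also have "\<dots> = (2 * m0 / h0 powr \<alpha>) * N * h powr \<alpha>" by simp
      also have "\<dots> \<le> D * N * h powr \<alpha>" using C N by (intro mult_right_mono) (auto simp: D_def)
      finally show "\<bar>(\<Sum>z\<in>S. ?K z * (G z * w (xi + z))) - integral (ball 0 \<delta>) (\<lambda>y. ?K y * G y)\<bar> \<le> D * N * h powr \<alpha>" .
    qed
  qed
qed

section \<open>Bounded domains, Lipschitz bounds from derivatives, and empty grids\<close>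

lemma bounded_domain_collar:
  fixes \<Omega> :: "(real^'n) set"
  assumes b: "bounded \<Omega>" and ne: "\<Omega> \<noteq> {}"
  shows "bounded (\<Omega> \<union> collar \<delta> \<Omega>)"
proof -
  \<comment> \<open>The value of \<open>infdist\<close> to the empty set is 0, which would put the
    whole complement into the collar; a nonempty bounded set has a nonempty frontier.\<close>
  have "\<Omega> \<noteq> UNIV" using b not_bounded_UNIV by blast
  then have fr: "frontier \<Omega> \<noteq> {}" using ne frontier_not_empty by blast
  have "bounded (frontier \<Omega>)" using bounded_subset[OF bounded_closure[OF b]] by (auto simp: frontier_def)
  then obtain M where M: "\<And>p. p \<in> frontier \<Omega> \<Longrightarrow> norm p \<le> M" by (auto simp: bounded_iff)
  have "norm x \<le> M + \<delta>" if "x \<in> collar \<delta> \<Omega>" for x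
  proof -
    obtain p where p: "p \<in> frontier \<Omega>" "infdist x (frontier \<Omega>) = dist x p"
      using infdist_attains_inf[OF frontier_closed fr] by blast
    then have "dist x p < \<delta>" using that by (simp add: collar_def)
    then show ?thesis using M[OF p(1)] norm_triangle_sub[of x p] by (simp add: dist_norm)
  qed
  then have "bounded (collar \<delta> \<Omega>)" by (auto simp: bounded_iff)
  then show ?thesis using b by simp
qed

text \<open>The mean value inequality is applied on the ball, which is convex, and not on
  \<open>S\<close>. The gradient has norm at most \<open>d * B\<close>; one more \<open>B\<close>
  covers the values.\<close>

lemma Ck_bounded_lip_bounded:
  fixes S :: "(real^'n) set"
  assumes f: "Ck_bounded B 1 S f" and S: "ball x \<delta> \<subseteq> S" and \<delta>: "0 < \<delta>"
  shows "0 \<le> B" "lip_bounded (ball 0 \<delta>) ((1 + real CARD('n)) * B) (\<lambda>z. f (x + z))"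
proof -
  have f': "Ck_bounded B (Suc 0) S f" using f by simp
  then have fB: "\<And>y. y \<in> S \<Longrightarrow> \<bar>f y\<bar> \<le> B" by simp
  obtain g where g': "\<forall>y\<in>S. GDERIV f y :> g y" "\<forall>i. Ck_bounded B 0 S (\<lambda>x. g x $ i)"
    using f' unfolding Ck_bounded.simps(2) by blast
  then have g: "\<And>y. y \<in> S \<Longrightarrow> GDERIV f y :> g y" and gB: "\<And>y i. y \<in> S \<Longrightarrow> \<bar>g y $ i\<bar> \<le> B"
    by simp_all
  have xS: "x \<in> S" using S \<delta> by auto
  show B: "0 \<le> B" using fB[OF xS] by simp
  have gn: "norm (g y) \<le> real CARD('n) * B" if "y \<in> S" for y
  proof -
    have "norm (g y) \<le> (\<Sum>i\<in>UNIV. \<bar>g y $ i\<bar>)" by (rule norm_le_l1_cart)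
    also have "\<dots> \<le> (\<Sum>i\<in>(UNIV::'n set). B)" by (intro sum_mono gB that)
    finally show ?thesis by simp
  qed
  have lip: "norm (f y - f y') \<le> (real CARD('n) * B) * norm (y - y')" if "y \<in> ball x \<delta>" "y' \<in> ball x \<delta>" for y y'
  proof (rule differentiable_bound[of "ball x \<delta>" f "\<lambda>y h. h \<bullet> g y"])
    show "(f has_derivative (\<lambda>h. h \<bullet> g z)) (at z within ball x \<delta>)" if "z \<in> ball x \<delta>" for z
    proof -
      have "z \<in> S" using that S by blast
      from g[OF this] show ?thesis unfolding gderiv_def by (rule has_derivative_at_withinI)
    qed
    show "onorm (\<lambda>h. h \<bullet> g z) \<le> real CARD('n) * B" if "z \<in> ball x \<delta>" for z
    proof (rule onorm_le)
      fix h
      have "norm (h \<bullet> g z) \<le> norm h * norm (g z)" by (simp add: Cauchy_Schwarz_ineq2)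
      also have "\<dots> \<le> norm h * (real CARD('n) * B)" using gn[of z] that S by (intro mult_left_mono) auto
      finally show "norm (h \<bullet> g z) \<le> real CARD('n) * B * norm h" by (simp add: mult.commute)
    qed
  qed (use that in auto)
  have xb: "x + z \<in> ball x \<delta>" if "z \<in> ball 0 \<delta>" for z using that by (simp add: dist_norm)
  show "lip_bounded (ball 0 \<delta>) ((1 + real CARD('n)) * B) (\<lambda>z. f (x + z))"
    unfolding lip_bounded_def
  proof (intro conjI ballI)
    fix z assume z: "z \<in> ball (0::real^'n) \<delta>"
    have "\<bar>f (x + z)\<bar> \<le> B" using fB xb[OF z] S by blast
    also have "\<dots> \<le> (1 + real CARD('n)) * B" using B by (simp add: distrib_right)
    finally show "\<bar>f (x + z)\<bar> \<le> (1 + real CARD('n)) * B" .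
    fix z' assume z': "z' \<in> ball (0::real^'n) \<delta>"
    have "\<bar>f (x + z) - f (x + z')\<bar> \<le> (real CARD('n) * B) * norm (z - z')"
      using lip[OF xb[OF z] xb[OF z']] by simp
    also have "\<dots> \<le> ((1 + real CARD('n)) * B) * norm (z - z')"
      using B by (intro mult_right_mono) (auto simp: distrib_right)
    finally show "\<bar>f (x + z) - f (x + z')\<bar> \<le> (1 + real CARD('n)) * B * norm (z - z')" .
  qed
qed

text \<open>On an empty grid \<open>grid_norm\<close> is the unspecified value
  \<open>Max {}\<close>, and the rate must hold for it too. This can only happen for
  \<open>h\<close> bounded below, where a constant absorbs it.\<close>

lemma empty_grid_spacing:
  fixes \<Omega> :: "(real^'n) set"
  assumes ne: "\<Omega> \<noteq> {}" and h: "0 < h" and e: "grid \<Omega> \<delta> h = {}"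
  shows "2 * \<delta> \<le> real CARD('n) * h"
proof (rule ccontr)
  assume a: "\<not> 2 * \<delta> \<le> real CARD('n) * h"
  obtain x where x: "x \<in> \<Omega>" using ne by blast
  obtain z where z: "z \<in> lattice h" "x \<in> cell h z" using cells_cover[OF h] by blast
  have "norm (x - z) < \<delta>" using cell_dist[OF z(2)] a by simp
  then have "z \<in> ball x \<delta>" by (simp add: dist_norm)
  then have "z \<in> grid \<Omega> \<delta> h" using ball_subset_domain[OF x, of \<delta>] z(1) by (auto simp: grid_eq)
  then show False using e by blast
qed

lemma discrete_op_diff:
  "discrete_op \<Omega> A \<gamma>1 \<delta> h \<omega> v xi - discrete_op \<Omega> A \<gamma>1 \<delta> h \<omega> u xi
     = (\<Sum>xj\<in>stencil \<Omega> \<delta> h xi. 2 * A xi xj * kernel \<gamma>1 \<delta> (xi - xj) * \<omega> xi xj * ((v xj - u xj) - (v xi - u xi)))"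
  unfolding discrete_op_def
  by (simp add: sum_distrib_left sum_subtractf[symmetric] algebra_simps)

text \<open>All constants are fixed before the mesh, the weights and the discrete solution are; only
  then is the consistency bound fed into the maximum principle.\<close>

lemma convergence_fixed_horizon:
  fixes \<Omega> :: "(real^'n) set"
  assumes b\<Omega>: "bounded \<Omega>" and ne: "\<Omega> \<noteq> {}" and kp: "kernel_profile D0 s \<gamma>1" and s: "s < real CARD('n)"
    and r: "0 < r" and pc: "positivity_constant \<Omega> \<gamma>1 Cpos" and \<delta>: "0 < \<delta>"
    and adm: "admissible_coefficient \<Omega> \<delta> r R A" and sol: "nonlocal_solution \<Omega> A \<gamma>1 \<delta> f uD u"
    and u1: "Ck_bounded B1 1 (\<Omega> \<union> collar \<delta> \<Omega>) u"
  shows "\<exists>C. \<forall>h uh. 0 < h \<and> h < Cpos * \<delta> \<and> discrete_solution \<Omega> A \<gamma>1 \<delta> h f uD uh \<longrightarrow>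
     grid_norm (grid \<Omega> \<delta> h) (\<lambda>x. uh x - u x) \<le> C * h powr (min 1 (real CARD('n) - s))"
proof -
  let ?K = "\<lambda>y::real^'n. norm y powr -s"
  define \<alpha> where "\<alpha> = min 1 (real CARD('n) - s)"
  have \<alpha>: "0 < \<alpha>" using s by (simp add: \<alpha>_def)
  have s0: "0 \<le> s" by (rule kernel_profile_exponent_nonneg[OF kp])
  define \<kappa> where "\<kappa> = kernel_const D0 s \<delta> CARD('n)"
  have \<kappa>: "0 < \<kappa>" unfolding \<kappa>_def by (rule kernel_const_pos[OF kp \<delta>])
  define D where "D = \<Omega> \<union> collar \<delta> \<Omega>"
  have ballD: "ball x \<delta> \<subseteq> D" if "x \<in> \<Omega>" for x unfolding D_def by (rule ball_subset_domain[OF that])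
  have A: "r \<le> A x y \<and> A x y \<le> R" if "x \<in> D" "y \<in> D" for x y
  proof -
    have "(x, y) \<in> closure (D \<times> D)" using that closure_subset[of "D \<times> D"] by blast
    then show ?thesis using adm unfolding admissible_coefficient_def Let_def D_def[symmetric] by blast
  qed
  obtain B2 where B2: "\<And>y. y \<in> D \<Longrightarrow> Ck_bounded B2 1 D (\<lambda>x. A y x)"
    using adm unfolding admissible_coefficient_def Let_def D_def[symmetric] by blast
  obtain x0 where x0: "x0 \<in> \<Omega>" using ne by blast
  have x0D: "x0 \<in> D" using x0 by (simp add: D_def)
  have rR: "r \<le> R" using A[OF x0D x0D] by linarith
  \<comment> \<open>The translate of \<open>u\<close> contributes \<open>(1 + d) * B1\<close>, the
    subtracted constant \<open>u x\<close> another \<open>B1\<close>.\<close>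
  define M1 where "M1 = (1 + real CARD('n)) * B1 + B1"
  define M2 where "M2 = (1 + real CARD('n)) * B2"
  have B1: "0 \<le> B1" by (rule Ck_bounded_lip_bounded(1)[OF u1[folded D_def] ballD[OF x0] \<delta>])
  have B2n: "0 \<le> B2" by (rule Ck_bounded_lip_bounded(1)[OF B2[OF x0D] ballD[OF x0] \<delta>])
  have M1: "0 \<le> M1" and M2: "0 \<le> M2" using B1 B2n by (auto simp: M1_def M2_def)
  define N where "N = 2 * M2 * M1"
  have N: "0 \<le> N" using M1 M2 by (simp add: N_def)
  \<comment> \<open>The integrand of the operator at \<open>x\<close> without the kernel; its
    constant \<open>N\<close> is uniform in \<open>x\<close>. The factors 1 and -1 match
    \<open>lip_bounded_lin\<close>.\<close>
  define G where "G x z = A x (x + z) * (1 * u (x + z) + (-1) * u x)" for x z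
  have G: "lip_bounded (ball 0 \<delta>) N (G x)" if x: "x \<in> \<Omega>" for x
  proof -
    have xD: "x \<in> D" using x by (simp add: D_def)
    have LA: "lip_bounded (ball 0 \<delta>) M2 (\<lambda>z. A x (x + z))"
      unfolding M2_def by (rule Ck_bounded_lip_bounded(2)[OF B2[OF xD] ballD[OF x] \<delta>])
    have Lu: "lip_bounded (ball 0 \<delta>) ((1 + real CARD('n)) * B1) (\<lambda>z. u (x + z))"
      by (rule Ck_bounded_lip_bounded(2)[OF u1[folded D_def] ballD[OF x] \<delta>])
    have "\<bar>u x\<bar> \<le> B1" using u1 xD by (simp add: D_def)
    then have "lip_bounded (ball 0 \<delta>) M1 (\<lambda>z. 1 * u (x + z) + (-1) * u x)"
      by (intro lip_bounded_mono[OF lip_bounded_lin[OF Lu lip_bounded_const]]) (simp add: M1_def)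
    then show ?thesis unfolding G_def[abs_def] N_def by (intro lip_bounded_mult LA M1 M2)
  qed
  obtain Cq where Cq: "0 \<le> Cq" and quad: "\<And>h xi w N G. 0 < h \<Longrightarrow> h < Cpos * \<delta> \<Longrightarrow> xi \<in> grid \<Omega> \<delta> h \<inter> \<Omega> \<Longrightarrow>
    optimal_weights \<Omega> \<gamma>1 \<delta> h xi w \<Longrightarrow> 0 \<le> N \<Longrightarrow> lip_bounded (ball 0 \<delta>) N G \<Longrightarrow>
    \<bar>(\<Sum>z\<in>lattice h \<inter> ball 0 \<delta> - {0}. ?K z * (G z * w (xi + z)))
       - integral (ball 0 \<delta>) (\<lambda>y. ?K y * G y)\<bar> \<le> Cq * N * h powr \<alpha>"
    unfolding \<alpha>_def by (rule quadrature_consistency[OF kp s \<delta> pc]) blast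
  \<comment> \<open>Any coordinate direction will do for the barrier.\<close>
  define i :: 'n where "i = undefined"
  obtain l where l: "0 \<le> l" and barrier: "\<And>S w A. finite S \<Longrightarrow> S \<subseteq> ball (0::real^'n) \<delta> \<Longrightarrow> (\<And>z. z \<in> S \<Longrightarrow> 0 \<le> w z) \<Longrightarrow>
    (\<And>p. poly_deg_le 3 p \<Longrightarrow> (\<Sum>z\<in>S. ?K z * (p z * w z)) = integral (ball 0 \<delta>) (\<lambda>y. ?K y * p y)) \<Longrightarrow>
    (\<And>z. z \<in> S \<Longrightarrow> r \<le> A z \<and> A z \<le> R) \<Longrightarrow>
    1 \<le> (\<Sum>z\<in>S. ?K z * (A z * (exp (l * z $ i) - 1) * w z))"
    by (rule exp_barrier[OF s0 s \<delta> r rR, of i]) blast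
  have bD: "bounded D" unfolding D_def by (rule bounded_domain_collar[OF b\<Omega> ne])
  obtain X where X: "\<And>x. x \<in> D \<Longrightarrow> \<bar>x $ i\<bar> \<le> X"
  proof -
    obtain X where "\<And>x. x \<in> D \<Longrightarrow> norm x \<le> X" using bD by (auto simp: bounded_iff)
    then show thesis using that[of X] component_le_norm_cart order_trans by blast
  qed
  \<comment> \<open>A lower bound of \<open>2 * \<kappa> * exp (l * x $ i)\<close> on
    \<open>D\<close>; dividing by it normalizes the barrier so that the operator is at least 1 at
    every interior node.\<close>
  define c0 where "c0 = 2 * \<kappa> * exp (- (l * X))"
  have c0: "0 < c0" using \<kappa> by (simp add: c0_def)
  define \<psi> where "\<psi> x = exp (l * x $ i) / c0" for x :: "real^'n"
  define \<Psi> where "\<Psi> = exp (l * X) / c0"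
  have \<Psi>0: "0 \<le> \<Psi>" using c0 by (simp add: \<Psi>_def)
  have \<Psi>: "\<bar>\<psi> x\<bar> \<le> \<Psi>" if "x \<in> D" for x
  proof -
    have "l * x $ i \<le> l * X" using X[OF that] l by (intro mult_left_mono) auto
    then show ?thesis using c0 by (simp add: \<psi>_def \<Psi>_def divide_right_mono)
  qed
  \<comment> \<open>The summand 1 makes the consistency bound strict, as the maximum principle
    requires.\<close>
  define T where "T = 2 * \<kappa> * (Cq * N) + 1"
  have T: "0 < T" using \<kappa> Cq N by (simp add: T_def add_nonneg_pos)
  define h1 where "h1 = 2 * \<delta> / real CARD('n)"
  have h1: "0 < h1" using \<delta> by (simp add: h1_def)
  \<comment> \<open>The second summand takes care of an empty grid, where
    \<open>h \<ge> h1\<close>.\<close>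
  define C where "C = 2 * \<Psi> * T + \<bar>Max ({} :: real set)\<bar> / h1 powr \<alpha>"
  have "grid_norm (grid \<Omega> \<delta> h) (\<lambda>x. uh x - u x) \<le> C * h powr \<alpha>"
    if h: "0 < h" "h < Cpos * \<delta>" and ds: "discrete_solution \<Omega> A \<gamma>1 \<delta> h f uD uh" for h uh
  proof (cases "grid \<Omega> \<delta> h = {}")
    case True
    have "h1 \<le> h" using empty_grid_spacing[OF ne h(1) True] by (simp add: h1_def field_simps)
    then have "h1 powr \<alpha> \<le> h powr \<alpha>" using h1 \<alpha> by (intro powr_mono2) auto
    then have "1 \<le> h powr \<alpha> / h1 powr \<alpha>" using h1 by simp
    then have "\<bar>Max ({} :: real set)\<bar> * 1 \<le> \<bar>Max ({} :: real set)\<bar> * (h powr \<alpha> / h1 powr \<alpha>)"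
      by (intro mult_left_mono) auto
    also have "\<dots> \<le> C * h powr \<alpha>" using \<Psi>0 T by (simp add: C_def distrib_right)
    finally show ?thesis by (simp add: grid_norm_def True)
  next
    case False
    define I where "I = grid \<Omega> \<delta> h \<inter> \<Omega>"
    define S where "S = lattice h \<inter> ball (0::real^'n) \<delta> - {0}"
    obtain \<omega> where \<omega>: "\<And>xi. xi \<in> I \<Longrightarrow> optimal_weights \<Omega> \<gamma>1 \<delta> h xi (\<omega> xi)"
      and eq: "\<And>xi. xi \<in> I \<Longrightarrow> - discrete_op \<Omega> A \<gamma>1 \<delta> h \<omega> uh xi = f xi"
      and bc: "\<And>xi. xi \<in> grid \<Omega> \<delta> h \<inter> collar \<delta> \<Omega> \<Longrightarrow> uh xi = uD xi"
      using ds unfolding discrete_solution_def I_def by blast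
    have finG: "finite (grid \<Omega> \<delta> h)" unfolding grid_eq D_def[symmetric] by (rule finite_lattice_bounded[OF h(1) bD])
    have finS: "finite S" unfolding S_def using finite_lattice_bounded[OF h(1) bounded_ball] by simp
    have gridD: "grid \<Omega> \<delta> h \<subseteq> D" by (auto simp: grid_eq D_def)
    define a where "a x y = 2 * A x y * kernel \<gamma>1 \<delta> (x - y) * \<omega> x y" for x y
    have stI: "stencil \<Omega> \<delta> h x = (+) x ` S" if "x \<in> I" for x
      using stencil_eq[of x \<Omega> \<delta> h] that by (simp add: S_def I_def)
    have wpos: "0 < \<omega> x (x + z)" if "x \<in> I" "z \<in> S" for x z
    proof -
      have "x + z \<in> stencil \<Omega> \<delta> h x" using stI[OF that(1)] that(2) by blast
      then show ?thesis using pc h \<delta> \<omega>[OF that(1)] that(1) unfolding positivity_constant_def I_def by blast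
    qed
    have az: "a x (x + z) = 2 * \<kappa> * (?K z * (A x (x + z) * \<omega> x (x + z)))" if "x \<in> I" "z \<in> S" for x z
      using kernel_eq[OF kp \<delta>, of "x - (x + z)"] that by (simp add: a_def \<kappa>_def S_def)
    have inD: "x + z \<in> D" if "x \<in> I" "z \<in> S" for x z
      using ballD[of x] that by (auto simp: I_def S_def dist_norm)
    have sumI: "(\<Sum>y\<in>stencil \<Omega> \<delta> h x. a x y * F y) = 2 * \<kappa> * (\<Sum>z\<in>S. ?K z * (A x (x + z) * F (x + z) * \<omega> x (x + z)))"
      if x: "x \<in> I" for x F
    proof -
      have "(\<Sum>y\<in>stencil \<Omega> \<delta> h x. a x y * F y) = (\<Sum>z\<in>S. a x (x + z) * F (x + z))"
        unfolding S_def by (rule sum_stencil) (use x in \<open>simp add: I_def\<close>)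
      also have "\<dots> = (\<Sum>z\<in>S. 2 * \<kappa> * (?K z * (A x (x + z) * F (x + z) * \<omega> x (x + z))))"
        using x by (intro sum.cong) (auto simp: az)
      finally show ?thesis by (simp only: sum_distrib_left)
    qed
    have xI: "x \<in> D" "x \<in> \<Omega>" if "x \<in> I" for x using that by (auto simp: I_def D_def)
    have a0: "0 \<le> a x y" if x: "x \<in> I" and y: "y \<in> stencil \<Omega> \<delta> h x" for x y
    proof -
      obtain z where z: "y = x + z" "z \<in> S" using stI[OF x] y by blast
      have "0 \<le> A x (x + z)" using A[OF xI(1)[OF x] inD[OF x z(2)]] r by linarith
      then show ?thesis unfolding z(1) az[OF x z(2)] using wpos[OF x z(2)] \<kappa> by simp
    qed
    have bar: "1 \<le> (\<Sum>y\<in>stencil \<Omega> \<delta> h x. a x y * (\<psi> y - \<psi> x))" if x: "x \<in> I" for x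
    proof -
      have "exact_weights \<Omega> \<gamma>1 \<delta> h x (\<omega> x)" using \<omega>[OF x] by (simp add: optimal_weights_def)
      note ex = exact_weights_translated[OF kp s \<delta> x[unfolded I_def] this]
      have 1: "1 \<le> (\<Sum>z\<in>S. ?K z * (A x (x + z) * (exp (l * z $ i) - 1) * \<omega> x (x + z)))"
      proof (rule barrier[OF finS])
        show "S \<subseteq> ball 0 \<delta>" by (auto simp: S_def)
        show "0 \<le> \<omega> x (x + z)" if "z \<in> S" for z using wpos[OF x that] by simp
        show "(\<Sum>z\<in>S. ?K z * (p z * \<omega> x (x + z))) = integral (ball 0 \<delta>) (\<lambda>y. ?K y * p y)" if "poly_deg_le 3 p" for p
          unfolding S_def by (rule ex[OF that])
        show "r \<le> A x (x + z) \<and> A x (x + z) \<le> R" if "z \<in> S" for z by (rule A[OF xI(1)[OF x] inD[OF x that]])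
      qed
      \<comment> \<open>Differences of an exponential are a positive multiple of the same difference
        at the origin, so one barrier estimate serves all nodes.\<close>
      have \<psi>d: "\<psi> (x + z) - \<psi> x = exp (l * x $ i) / c0 * (exp (l * z $ i) - 1)" for z
        by (simp add: \<psi>_def distrib_left exp_add diff_divide_distrib[symmetric] algebra_simps)
      have "- (l * X) \<le> l * x $ i"
        using mult_left_mono[of "-X" "x $ i" l] X[OF xI(1)[OF x]] l by simp
      then have "1 \<le> 2 * \<kappa> * (exp (l * x $ i) / c0)"
        using \<kappa> c0 by (simp add: c0_def field_simps)
      also have "\<dots> * 1 \<le> 2 * \<kappa> * (exp (l * x $ i) / c0) * (\<Sum>z\<in>S. ?K z * (A x (x + z) * (exp (l * z $ i) - 1) * \<omega> x (x + z)))"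
        using \<kappa> c0 by (intro mult_left_mono 1) auto
      also have "\<dots> = 2 * \<kappa> * (\<Sum>z\<in>S. ?K z * (A x (x + z) * (\<psi> (x + z) - \<psi> x) * \<omega> x (x + z)))"
        unfolding \<psi>d by (simp add: sum_distrib_left mult_ac)
      also have "\<dots> = (\<Sum>y\<in>stencil \<Omega> \<delta> h x. a x y * (\<psi> y - \<psi> x))"
        by (rule sumI[OF x, symmetric])
      finally show ?thesis by simp
    qed
    define e where "e x = uh x - u x" for x
    have cons: "\<bar>\<Sum>y\<in>stencil \<Omega> \<delta> h x. a x y * (e y - e x)\<bar> < T * h powr \<alpha>" if x: "x \<in> I" for x
    proof -
      have Gx: "lip_bounded (ball 0 \<delta>) N (G x)" by (rule G[OF xI(2)[OF x]])
      have ai: "(\<lambda>y. \<kappa> * (?K y * G x y)) absolutely_integrable_on ball 0 \<delta>"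
        by (intro set_integrable_mult_right powr_times_lip_bounded_integrable[OF s0 s \<delta> Gx])
      have "(LINT y:ball x \<delta>|lebesgue. A x y * kernel \<gamma>1 \<delta> (x - y) * (u y - u x))
         = integral (ball 0 \<delta>) (\<lambda>y. \<kappa> * (?K y * G x y))"
      proof (rule ball_integral_translate[OF ai])
        fix y assume "y \<in> ball x \<delta>" "y \<noteq> x"
        then show "A x y * kernel \<gamma>1 \<delta> (x - y) * (u y - u x) = \<kappa> * (norm (y - x) powr -s * G x (y - x))"
          using kernel_eq[OF kp \<delta>, of "x - y"] by (simp add: \<kappa>_def dist_norm norm_minus_commute G_def)
      qed
      then have nl: "nonlocal_op A \<gamma>1 \<delta> u x = 2 * \<kappa> * integral (ball 0 \<delta>) (\<lambda>y. ?K y * G x y)"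
        by (simp add: nonlocal_op_def)
      have "discrete_op \<Omega> A \<gamma>1 \<delta> h \<omega> u x = (\<Sum>y\<in>stencil \<Omega> \<delta> h x. a x y * (u y - u x))"
        by (simp add: discrete_op_def a_def sum_distrib_left mult_ac)
      also have "\<dots> = 2 * \<kappa> * (\<Sum>z\<in>S. ?K z * (G x z * \<omega> x (x + z)))"
        unfolding sumI[OF x] by (simp add: G_def)
      finally have dl: "discrete_op \<Omega> A \<gamma>1 \<delta> h \<omega> u x = 2 * \<kappa> * (\<Sum>z\<in>S. ?K z * (G x z * \<omega> x (x + z)))" .
      \<comment> \<open>At an interior node both sides equal \<open>- f x\<close>, so the discrete
        operator applied to the error is the consistency error of \<open>u\<close>.\<close>
      have "nonlocal_op A \<gamma>1 \<delta> u x = discrete_op \<Omega> A \<gamma>1 \<delta> h \<omega> uh x"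
        using sol xI(2)[OF x] eq[OF x] unfolding nonlocal_solution_def by force
      then have "(\<Sum>y\<in>stencil \<Omega> \<delta> h x. a x y * (e y - e x))
          = nonlocal_op A \<gamma>1 \<delta> u x - discrete_op \<Omega> A \<gamma>1 \<delta> h \<omega> u x"
        using discrete_op_diff[of \<Omega> A \<gamma>1 \<delta> h \<omega> uh x u] by (simp add: e_def a_def)
      also have "\<dots> = - (2 * \<kappa>) * ((\<Sum>z\<in>S. ?K z * (G x z * \<omega> x (x + z))) - integral (ball 0 \<delta>) (\<lambda>y. ?K y * G x y))"
        unfolding nl dl by (simp add: algebra_simps)
      finally have "\<bar>\<Sum>y\<in>stencil \<Omega> \<delta> h x. a x y * (e y - e x)\<bar>
        = 2 * \<kappa> * \<bar>(\<Sum>z\<in>S. ?K z * (G x z * \<omega> x (x + z))) - integral (ball 0 \<delta>) (\<lambda>y. ?K y * G x y)\<bar>"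
        using \<kappa> by (simp add: abs_mult)
      also have "\<dots> \<le> 2 * \<kappa> * (Cq * N * h powr \<alpha>)"
        unfolding S_def using \<kappa> by (intro mult_left_mono quad[OF h x[unfolded I_def] \<omega>[OF x] N Gx]) auto
      also have "\<dots> < T * h powr \<alpha>" using h by (simp add: T_def algebra_simps)
      finally show ?thesis .
    qed
    \<comment> \<open>A grid node outside \<Omega> lies in the collar, where both solutions take the
      values \<open>uD\<close>.\<close>
    have e0: "e x = 0" if "x \<in> grid \<Omega> \<delta> h - I" for x
    proof -
      have "x \<in> grid \<Omega> \<delta> h \<inter> collar \<delta> \<Omega>" using that gridD by (auto simp: I_def D_def)
      then show ?thesis using bc[of x] sol unfolding nonlocal_solution_def e_def by auto
    qed
    have st: "stencil \<Omega> \<delta> h x \<subseteq> grid \<Omega> \<delta> h" for x by (auto simp: stencil_def)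
    have Th: "0 \<le> T * h powr \<alpha>" using T by simp
    have \<Psi>g: "\<bar>\<psi> x\<bar> \<le> \<Psi>" if "x \<in> grid \<Omega> \<delta> h" for x using \<Psi> that gridD by blast
    have lo: "- (T * h powr \<alpha>) < (\<Sum>y\<in>stencil \<Omega> \<delta> h x. a x y * (e y - e x))" if "x \<in> I" for x
      using cons[OF that] by linarith
    have up: "e x \<le> 2 * \<Psi> * (T * h powr \<alpha>)" if x: "x \<in> grid \<Omega> \<delta> h" for x
      by (rule discrete_maximum_principle[OF finG st a0 bar \<Psi>g lo e0 Th x])
    \<comment> \<open>The lower bound uses the same barrier for the negated error.\<close>
    have down: "- e x \<le> 2 * \<Psi> * (T * h powr \<alpha>)" if x: "x \<in> grid \<Omega> \<delta> h" for x
    proof (rule discrete_maximum_principle[OF finG st a0 bar \<Psi>g _ _ Th x])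
      fix x assume x: "x \<in> I"
      have "(\<Sum>y\<in>stencil \<Omega> \<delta> h x. a x y * (- e y - - e x)) = - (\<Sum>y\<in>stencil \<Omega> \<delta> h x. a x y * (e y - e x))"
        by (simp add: sum_negf[symmetric] algebra_simps)
      then show "- (T * h powr \<alpha>) < (\<Sum>y\<in>stencil \<Omega> \<delta> h x. a x y * (- e y - - e x))"
        using cons[OF x] by (simp add: abs_less_iff)
    qed (use e0 in auto)
    have "\<bar>e x\<bar> \<le> C * h powr \<alpha>" if x: "x \<in> grid \<Omega> \<delta> h" for x
    proof -
      have "\<bar>e x\<bar> \<le> 2 * \<Psi> * (T * h powr \<alpha>)" using up[OF x] down[OF x] by (simp add: abs_le_iff)
      also have "\<dots> = 2 * \<Psi> * T * h powr \<alpha>" by simp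
      also have "\<dots> \<le> C * h powr \<alpha>" by (intro mult_right_mono) (auto simp: C_def)
      finally show ?thesis .
    qed
    then show ?thesis unfolding grid_norm_def e_def[symmetric] using finG False by (intro Max.boundedI) auto
  qed
  then show ?thesis unfolding \<alpha>_def by blast
qed

theorem theorem3p7:
  fixes \<Omega> :: "(real^'n) set"
    and A :: "real^'n \<Rightarrow> real^'n \<Rightarrow> real"
    and f uD :: "real^'n \<Rightarrow> real"
    and \<gamma>1 :: "real \<Rightarrow> real"
    and s D0 r R Cpos :: real
  assumes "bounded \<Omega>" and "lipschitz_domain \<Omega>"
    and "kernel_profile D0 s \<gamma>1"
    and "(LINT z:ball (0 :: real^'n) 1|lebesgue. \<gamma>1 (norm z) * (norm z)\<^sup>2) = real CARD('n)"
    and "s < real CARD('n)"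
    and "0 < r"
    and "positivity_constant \<Omega> \<gamma>1 Cpos"
  shows "\<exists>\<delta>0>0. \<forall>\<delta> u. 0 < \<delta> \<and> \<delta> < \<delta>0 \<and>
           admissible_coefficient \<Omega> \<delta> r R A \<and>
           C1_domain (\<Omega> \<union> collar \<delta> \<Omega>) \<and>
           nonlocal_solution \<Omega> A \<gamma>1 \<delta> f uD u \<and>
           (\<exists>B. Ck_bounded B 1 (\<Omega> \<union> collar \<delta> \<Omega>) u) \<longrightarrow>
         (\<exists>C. \<forall>h uh. 0 < h \<and> h < Cpos * \<delta> \<and>
            discrete_solution \<Omega> A \<gamma>1 \<delta> h f uD uh \<longrightarrow>
            grid_norm (grid \<Omega> \<delta> h) (\<lambda>x. uh x - u x) \<le> C * h powr (min 1 (real CARD('n) - s)))"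
proof (rule exI[of _ 1], rule conjI[OF zero_less_one], intro allI impI)
  \<comment> \<open>The constant may depend on the horizon, so any positive threshold serves as
    \<open>\<delta>0\<close>; here it is 1.\<close>
  fix \<delta> u
  assume a: "0 < \<delta> \<and> \<delta> < 1 \<and> admissible_coefficient \<Omega> \<delta> r R A \<and> C1_domain (\<Omega> \<union> collar \<delta> \<Omega>) \<and>
    nonlocal_solution \<Omega> A \<gamma>1 \<delta> f uD u \<and> (\<exists>B. Ck_bounded B 1 (\<Omega> \<union> collar \<delta> \<Omega>) u)"
  then obtain B where B: "Ck_bounded B 1 (\<Omega> \<union> collar \<delta> \<Omega>) u" by blast
  have ne: "\<Omega> \<noteq> {}" using assms(2) by (simp add: lipschitz_domain_def)
  show "\<exists>C. \<forall>h uh. 0 < h \<and> h < Cpos * \<delta> \<and> discrete_solution \<Omega> A \<gamma>1 \<delta> h f uD uh \<longrightarrow>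
      grid_norm (grid \<Omega> \<delta> h) (\<lambda>x. uh x - u x) \<le> C * h powr (min 1 (real CARD('n) - s))"
    using a by (intro convergence_fixed_horizon[OF assms(1) ne assms(3,5-7) _ _ _ B]) auto
qed

end
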